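(* Let $K$ be an algebraically closed field of characteristic zero with a complete (multiplicative) non-Archimedean norm $|\cdot|$, and let $f : \mathbb{P}^1_K \rightarrow \mathbb{P}^1_K$ be a rational map over $K$ of degree $d$, where $d$ is greater than $2$. Suppose that $f$ is immediately expanding and that $\infty$ is not in the Julia set $\mathcal{J}_f$ of $f$. Then there exists a neighborhood $U$ of $f$ in the set $\mathcal{R}_d$ of rational maps over $K$ of degree $d$ such that for any $g$ in $U$ there exists a homeomorphism $h : \mathcal{J}_f \rightarrow \mathcal{J}_g$ such that for any $z$ in $\mathcal{J}_f$ we have $$h \circ f(z) = g \circ h(z).$$
   Context: $\mathbb{P}^1_K := K \cup \{\infty\}$ carries the chordal metric $\rho$: for $z,w \in K$, $\rho(z,w) = \frac{|z-w|}{\max\{1,|z|\}\cdot\max\{1,|w|\}}$, and for $z \in K$, $\rho(z,\infty) = \frac{1}{\max\{1,|z|\}}$. Subsets of $\mathbb{P}^1_K$ carry the topology induced by $\rho$. A rational map over $K$ of degree $d$ is a map $\mathbb{P}^1_K \to \mathbb{P}^1_K$ determined by two homogeneous polynomials in two variables over $K$ of degree $d$ without common factors; equivalently, a quotient of two polynomials over $K$ with no common factors whose maximal degree is $d$. $\mathcal{R}_d$ denotes the set of rational maps over $K$ of degree $d$; via the coefficients of the two polynomials (up to common scaling) it is identified with an open subset of the $(2d+1)$-dimensional projective space over $K$, and it carries the induced topology. For a non-constant rational map $f$, $f^k$ is the $k$-th iterate. The Fatou set $\mathcal{F}_f$ is the largest open set in $\mathbb{P}^1_K$ on which the family $\{f^k\}_{k=0}^\infty$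 is equicontinuous with respect to $\rho$; the Julia set is $\mathcal{J}_f := \mathbb{P}^1_K \setminus \mathcal{F}_f$. A non-constant rational map $f$ is immediately expanding if (1) $\mathcal{J}_f$ is non-empty, and (2) there exists $\lambda > 1$ such that $|f'(z)| \geq \lambda$ for any $z$ in $\mathcal{J}_f$, where $f'$ is the derivative of $f$. *)

theory Defs
  imports "HOL-Analysis.Analysis" "HOL-Computational_Algebra.Computational_Algebra"
begin

section \<open>Non-Archimedean normed fields\<close>

text \<open>\<^const>\<open>norm\<close> is constrained to \<^class>\<open>real_normed_vector\<close>, which forces an Archimedean norm,
  hence a norm of our own. Its nonnegativity and definiteness follow from \<^class>\<open>metric_space\<close>;
  the trivial norm is allowed.\<close>

class nonarch_normed_field = field + metric_space +
  fixes nrm :: "'a \<Rightarrow> real"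
  assumes dist_nrm: "dist x y = nrm (x - y)"
    and nrm_mult: "nrm (x * y) = nrm x * nrm y"
    and nrm_add: "nrm (x + y) \<le> max (nrm x) (nrm y)"
begin

lemma nrm_nonneg: "0 \<le> nrm x"
  using zero_le_dist[of x 0] by (simp add: dist_nrm)

lemma nrm_eq_zero_iff: "nrm x = 0 \<longleftrightarrow> x = 0"
  using dist_eq_0_iff[of x 0] by (simp add: dist_nrm)

lemma nrm_minus_commute: "nrm (x - y) = nrm (y - x)"
  using dist_commute[of x y] by (simp add: dist_nrm)

lemma nrm_diff: "nrm (x - y) \<le> max (nrm x) (nrm y)"
  using nrm_add[of x "- y"] nrm_minus_commute[of 0 y] by simp

end


section \<open>The projective line with the chordal metric\<close>

datatype 'a proj_line = Fin 'a | Infty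

fun chordal :: "'k::nonarch_normed_field proj_line \<Rightarrow> 'k proj_line \<Rightarrow> real" where
  "chordal (Fin z) (Fin w) = nrm (z - w) / (max 1 (nrm z) * max 1 (nrm w))"
| "chordal (Fin z) Infty = 1 / max 1 (nrm z)"
| "chordal Infty (Fin z) = 1 / max 1 (nrm z)"
| "chordal Infty Infty = 0"

lemma chordal_nonneg: "0 \<le> chordal x y"
  by (cases x; cases y) (auto simp: nrm_nonneg)

lemma chordal_eq_0_iff: "chordal x y = 0 \<longleftrightarrow> x = y"
proof -
  have "max 1 (nrm z) \<noteq> 0" for z :: 'a
    by linarith
  then show ?thesis
    by (cases x; cases y) (auto simp: nrm_eq_zero_iff)
qed

lemma chordal_commute: "chordal x y = chordal y x"
  by (cases x; cases y) (auto simp: nrm_minus_commute mult.commute)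

lemma chordal_ultrametric_Fin_aux:
  fixes x y z :: "'k::nonarch_normed_field"
  shows "nrm (x - z) * max 1 (nrm y) \<le>
    max (nrm (x - y) * max 1 (nrm z)) (nrm (y - z) * max 1 (nrm x))"
proof (cases "nrm y \<le> 1")
  case True
  have "nrm (x - z) \<le> max (nrm (x - y)) (nrm (y - z))"
    using nrm_add[of "x - y" "y - z"] by simp
  moreover have "nrm (x - y) * 1 \<le> nrm (x - y) * max 1 (nrm z)"
    "nrm (y - z) * 1 \<le> nrm (y - z) * max 1 (nrm x)"
    by (intro mult_left_mono; simp add: nrm_nonneg)+
  ultimately show ?thesis
    using True by (auto simp: max_def split: if_splits)
next
  case False
  have "(x - z) * y = (x - y) * z + (y - z) * x"
    by (simp add: algebra_simps)
  then have "nrm (x - z) * nrm y \<le> max (nrm (x - y) * nrm z) (nrm (y - z) * nrm x)"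
    using nrm_add[of "(x - y) * z" "(y - z) * x"] by (metis nrm_mult)
  moreover have "nrm (x - y) * nrm z \<le> nrm (x - y) * max 1 (nrm z)"
    "nrm (y - z) * nrm x \<le> nrm (y - z) * max 1 (nrm x)"
    by (intro mult_left_mono; simp add: nrm_nonneg)+
  ultimately show ?thesis
    using False by (auto simp: max_def split: if_splits)
qed

lemma chordal_ultrametric: "chordal x z \<le> max (chordal x y) (chordal y z)"
proof -
  have pos: "0 < max 1 (nrm a)" for a :: 'a
    by linarith
  have cross: "a / (A * C) \<le> max (b / (A * B)) (c / (B * C))"
    if "0 < A" "0 < B" "0 < C" "a * B \<le> max (b * C) (c * A)" for a b c A B C :: real
  proof (cases "a * B \<le> b * C")
    case True
    then have "a / (A * C) \<le> b / (A * B)"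
      using that by (simp add: field_simps)
    then show ?thesis by simp
  next
    case False
    then have "a * B \<le> c * A"
      using that by auto
    then have "a / (A * C) \<le> c / (B * C)"
      using that by (simp add: field_simps)
    then show ?thesis by simp
  qed
  have le: "max 1 (nrm a) \<le> max (max 1 (nrm b)) (nrm (a - b))" for a b :: 'a
    using nrm_add[of b "a - b"] by (auto simp: max_def split: if_splits)
  show ?thesis
  proof (cases x; cases y; cases z)
    fix a b c assume "x = Fin a" "y = Fin b" "z = Fin c"
    then show ?thesis
      using cross[OF pos pos pos chordal_ultrametric_Fin_aux[of a c b]] by simp
  next
    fix a b assume "x = Fin a" "y = Fin b" "z = Infty"
    then show ?thesis
      using cross[of "max 1 (nrm a)" "max 1 (nrm b)" 1 1 "nrm (a - b)" 1]
        le[of b a] pos nrm_minus_commute[of a b] by (simp add: max.commute)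
  next
    fix a c assume "x = Fin a" "y = Infty" "z = Fin c"
    moreover have "nrm (a - c) \<le> max (max 1 (nrm c)) (max 1 (nrm a))"
      using nrm_diff[of a c] by (auto simp: max_def split: if_splits)
    ultimately show ?thesis
      using cross[of "max 1 (nrm a)" 1 "max 1 (nrm c)" "nrm (a - c)" 1 1] pos by simp
  next
    fix b c assume "x = Infty" "y = Fin b" "z = Fin c"
    then show ?thesis
      using cross[of 1 "max 1 (nrm b)" "max 1 (nrm c)" 1 1 "nrm (b - c)"]
        le[of b c] pos by simp
  qed (auto simp: chordal_nonneg)
qed

instantiation proj_line :: (nonarch_normed_field) metric_space
begin

definition "dist_proj_line = (chordal :: 'a proj_line \<Rightarrow> 'a proj_line \<Rightarrow> real)"

definition "(uniformity :: ('a proj_line \<times> 'a proj_line) filter) =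
  (INF e\<in>{0<..}. principal {(x, y). dist x y < e})"

definition "open (U :: 'a proj_line set) \<longleftrightarrow>
  (\<forall>x\<in>U. eventually (\<lambda>(x', y). x' = x \<longrightarrow> y \<in> U) uniformity)"

instance
proof
  fix x y z :: "'a proj_line"
  show "dist x y = 0 \<longleftrightarrow> x = y"
    by (simp add: dist_proj_line_def chordal_eq_0_iff)
  show "dist x y \<le> dist x z + dist y z"
    using chordal_ultrametric[of x y z] chordal_nonneg[of x z] chordal_nonneg[of z y]
      chordal_commute[of z y] by (simp add: dist_proj_line_def)
qed (simp_all add: uniformity_proj_line_def open_proj_line_def)

end


section \<open>Projective space over a topological field\<close>

text \<open>Points of projective $n$-space are the classes \<open>proj_point n v\<close> of nonzero vectors indexed by
  $\{0,\dots,n\}$; the topology is the quotient of the product topology.\<close>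

definition nonzero_vectors :: "nat \<Rightarrow> (nat \<Rightarrow> 'k::zero) set" where
  "nonzero_vectors n = {v \<in> extensional {..n}. \<exists>i\<le>n. v i \<noteq> 0}"

definition nonzero_vector_topology :: "nat \<Rightarrow> (nat \<Rightarrow> 'k::{zero,topological_space}) topology" where
  "nonzero_vector_topology n =
     subtopology (product_topology (\<lambda>_. euclidean) {..n}) (nonzero_vectors n)"

definition proj_point :: "nat \<Rightarrow> (nat \<Rightarrow> 'k::field) \<Rightarrow> (nat \<Rightarrow> 'k) set" where
  "proj_point n v = {\<lambda>i\<in>{..n}. c * v i | c. c \<noteq> 0}"

definition proj_space :: "nat \<Rightarrow> (nat \<Rightarrow> 'k::field) set set" where
  "proj_space n = proj_point n ` nonzero_vectors n"

definition proj_space_topology :: "nat \<Rightarrow> (nat \<Rightarrow> 'k::{field,topological_space}) set topology" where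
  "proj_space_topology n = topology (\<lambda>U. U \<subseteq> proj_space n \<and>
     openin (nonzero_vector_topology n) {v \<in> nonzero_vectors n. proj_point n v \<in> U})"

lemma topspace_nonzero_vector_topology:
  "topspace (nonzero_vector_topology n) = nonzero_vectors n"
  by (auto simp: nonzero_vector_topology_def nonzero_vectors_def PiE_def)

lemma openin_proj_space_topology:
  fixes U :: "(nat \<Rightarrow> 'k::{field,topological_space}) set set"
  shows "openin (proj_space_topology n) U \<longleftrightarrow> U \<subseteq> proj_space n \<and>
     openin (nonzero_vector_topology n) {v \<in> nonzero_vectors n. proj_point n v \<in> U}"
proof -
  let ?P = "\<lambda>U :: (nat \<Rightarrow> 'k) set set. U \<subseteq> proj_space n \<and>
     openin (nonzero_vector_topology n) {v \<in> nonzero_vectors n. proj_point n v \<in> U}"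
  have "istopology ?P"
    unfolding istopology_def
  proof (intro conjI allI impI)
    fix S T :: "(nat \<Rightarrow> 'k) set set" assume "?P S" "?P T"
    then have "openin (nonzero_vector_topology n)
      ({v \<in> nonzero_vectors n. proj_point n v \<in> S} \<inter> {v \<in> nonzero_vectors n. proj_point n v \<in> T})"
      by blast
    moreover have "{v \<in> nonzero_vectors n. proj_point n v \<in> S \<inter> T} =
      {v \<in> nonzero_vectors n. proj_point n v \<in> S} \<inter> {v \<in> nonzero_vectors n. proj_point n v \<in> T}"
      by blast
    ultimately show "openin (nonzero_vector_topology n)
      {v \<in> nonzero_vectors n. proj_point n v \<in> S \<inter> T}"
      by simp
    show "S \<inter> T \<subseteq> proj_space n"
      using \<open>?P S\<close> by blast
  next
    fix \<K> :: "(nat \<Rightarrow> 'k) set set set" assume K: "\<forall>S\<in>\<K>. ?P S"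
    then have "openin (nonzero_vector_topology n)
      (\<Union>S\<in>\<K>. {v \<in> nonzero_vectors n. proj_point n v \<in> S})"
      by blast
    moreover have "{v \<in> nonzero_vectors n. proj_point n v \<in> \<Union>\<K>} =
      (\<Union>S\<in>\<K>. {v \<in> nonzero_vectors n. proj_point n v \<in> S})"
      by blast
    ultimately show "openin (nonzero_vector_topology n)
      {v \<in> nonzero_vectors n. proj_point n v \<in> \<Union>\<K>}"
      by simp
    show "\<Union>\<K> \<subseteq> proj_space n"
      using K by blast
  qed
  then show ?thesis
    by (simp add: proj_space_topology_def)
qed


section \<open>Rational maps\<close>

text \<open>The value at infinity is that of the homogenisations of degree
  \<open>max (degree p) (degree q)\<close> at $[1:0]$.\<close>

definition rat_map :: "'k::field poly \<Rightarrow> 'k poly \<Rightarrow> 'k proj_line \<Rightarrow> 'k proj_line" where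
  "rat_map p q x = (case x of
     Fin z \<Rightarrow> if poly q z = 0 then Infty else Fin (poly p z / poly q z)
   | Infty \<Rightarrow> let d = max (degree p) (degree q) in
       if coeff q d = 0 then Infty else Fin (coeff p d / coeff q d))"

definition represents :: "nat \<Rightarrow> ('k::field proj_line \<Rightarrow> 'k proj_line) \<Rightarrow> 'k poly \<Rightarrow> 'k poly \<Rightarrow> bool" where
  "represents d f p q \<longleftrightarrow> coprime p q \<and> max (degree p) (degree q) = d \<and> f = rat_map p q"

definition rational_maps :: "nat \<Rightarrow> ('k::field proj_line \<Rightarrow> 'k proj_line) set" where
  "rational_maps d = {f. \<exists>p q. represents d f p q}"

definition coeff_vector :: "nat \<Rightarrow> 'k::field poly \<Rightarrow> 'k poly \<Rightarrow> nat \<Rightarrow> 'k" where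
  "coeff_vector d p q = (\<lambda>i\<in>{..2*d+1}. if i \<le> d then coeff p i else coeff q (i - (d + 1)))"

text \<open>The set of all coefficient vectors of \<open>f\<close>; for \<open>f \<in> rational_maps d\<close> it is a point of
  \<open>proj_space (2*d+1)\<close>, see \<open>coeff_point_in_proj_space\<close> below.\<close>

definition coeff_point :: "nat \<Rightarrow> ('k::field proj_line \<Rightarrow> 'k proj_line) \<Rightarrow> (nat \<Rightarrow> 'k) set" where
  "coeff_point d f = {coeff_vector d p q | p q. represents d f p q}"

text \<open>Polynomials over a bare \<^class>\<open>field\<close> are not an instance of \<^class>\<open>semiring_gcd\<close> in the
  library, so its facts on coprimality do not apply.\<close>

lemma coprime_poly_bezout:
  fixes a b :: "'k::field poly"
  assumes "coprime a b"
  shows "\<exists>s t. s * a + t * b = 1"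
  using assms
proof (induction "euclidean_size b" arbitrary: a b rule: less_induct)
  case less
  show ?case
  proof (cases "b = 0")
    case True
    then have "a dvd 1"
      using less.prems by simp
    then obtain s where "1 = a * s"
      by (rule dvdE)
    then have "s * a + 0 * b = 1"
      by (simp add: mult.commute)
    then show ?thesis
      by blast
  next
    case False
    have "is_unit c" if "c dvd b" "c dvd a mod b" for c
    proof -
      have "c dvd a div b * b + a mod b"
        using that by (intro dvd_add dvd_mult)
      then have "c dvd a"
        by simp
      from less.prems this that(1) show ?thesis
        by (rule coprime_common_divisor)
    qed
    then have "coprime b (a mod b)"
      by (rule coprimeI)
    then obtain s t where "s * b + t * (a mod b) = 1"
      using less.hyps[OF mod_size_less[OF False]] by blast
    moreover have "a mod b = a - a div b * b"
      by (rule minus_div_mult_eq_mod[symmetric])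
    ultimately have "t * a + (s - t * (a div b)) * b = 1"
      by (simp only: algebra_simps)
    then show ?thesis
      by blast
  qed
qed

lemma coprime_poly_dvd_mult:
  fixes a b c :: "'k::field poly"
  assumes "a dvd c * b" "coprime a c"
  shows "a dvd b"
proof -
  obtain s t where st: "s * a + t * c = 1"
    using coprime_poly_bezout[OF assms(2)] by blast
  have "b = (s * a + t * c) * b"
    by (simp only: st mult_1_left)
  also have "\<dots> = a * (s * b) + c * b * t"
    by (simp only: algebra_simps)
  finally show ?thesis
    using dvd_add[OF dvd_triv_left dvd_mult2[OF assms(1)]] by metis
qed

lemma represents_unique:
  fixes p q :: "'k::field_char_0 poly"
  assumes "represents d f p q" "represents d f p' q'"
  obtains c where "c \<noteq> 0" "p' = smult c p" "q' = smult c q"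
proof -
  have cop: "coprime p q" "coprime p' q'" and eq: "rat_map p q = rat_map p' q'"
    using assms by (auto simp: represents_def)
  have "poly (p * q') z = poly (p' * q) z" for z
    using fun_cong[OF eq, of "Fin z"] by (auto simp: rat_map_def field_simps split: if_splits)
  then have pq: "p * q' = p' * q"
    unfolding poly_eq_poly_eq_iff[symmetric] by (rule HOL.ext)
  have key: "\<exists>c. c \<noteq> 0 \<and> a' = smult c a \<and> b' = smult c b"
    if "coprime a b" "coprime a' b'" "a * b' = a' * b" "b \<noteq> 0" for a b a' b' :: "'k poly"
  proof -
    have "b dvd a * b'"
      unfolding that(3) by (rule dvd_triv_right)
    then have "b dvd b'"
      by (rule coprime_poly_dvd_mult) (use that(1) in \<open>simp add: coprime_commute\<close>)
    then obtain u where u: "b' = b * u" by (rule dvdE)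
    have "b' dvd a' * b"
      unfolding that(3)[symmetric] by (rule dvd_triv_right)
    then have "b' dvd b"
      by (rule coprime_poly_dvd_mult) (use that(2) in \<open>simp add: coprime_commute\<close>)
    then have "b * u dvd b * 1"
      by (simp add: u)
    then have "is_unit u"
      using that(4) by (simp only: dvd_mult_cancel_left) simp
    then obtain c where c: "u = [:c:]" "c dvd 1"
      by (auto simp: is_unit_poly_iff)
    then have "c \<noteq> 0"
      by auto
    have "b * a' = b * (a * u)"
      using that(3) unfolding u by (simp only: ac_simps)
    then have "a' = a * u"
      using that(4) by (simp only: mult_cancel_left) simp
    with u c have "a' = smult c a" "b' = smult c b"
      by simp_all
    with \<open>c \<noteq> 0\<close> show ?thesis by blast
  qed
  show thesis
  proof (cases "q = 0")
    case False
    then show thesis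
      using key[OF cop pq] that by blast
  next
    case True
    then have "p \<noteq> 0" using cop by auto
    moreover have "q * p' = q' * p"
      using pq by (simp only: mult.commute)
    ultimately show thesis
      using key[of q p q' p'] cop[THEN coprime_commute[THEN iffD1]] that by blast
  qed
qed

lemma represents_smult:
  assumes "represents d f p q" "c \<noteq> 0"
  shows "represents d f (smult c p) (smult c q)"
proof -
  have "rat_map (smult c p) (smult c q) = rat_map p q"
    using assms(2) by (auto simp: rat_map_def fun_eq_iff Let_def split: proj_line.split)
  moreover have "coprime (smult c p) (smult c q)"
    using assms
    by (metis represents_def coprimeI coprime_common_divisor dvd_smult_cancel)
  ultimately show ?thesis
    using assms by (simp add: represents_def)
qed

lemma coeff_point_eq:
  fixes p q :: "'k::field_char_0 poly"
  assumes "represents d f p q"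
  shows "coeff_point d f = proj_point (2*d+1) (coeff_vector d p q)"
proof -
  have vec: "coeff_vector d (smult c p) (smult c q) = (\<lambda>i\<in>{..2*d+1}. c * coeff_vector d p q i)" for c
    by (auto simp: coeff_vector_def fun_eq_iff)
  show ?thesis
  proof (intro equalityI subsetI)
    fix v assume "v \<in> coeff_point d f"
    then obtain p' q' where "represents d f p' q'" "v = coeff_vector d p' q'"
      unfolding coeff_point_def by blast
    then obtain c where "c \<noteq> 0" "v = coeff_vector d (smult c p) (smult c q)"
      using represents_unique[OF assms] by metis
    then show "v \<in> proj_point (2*d+1) (coeff_vector d p q)"
      unfolding vec proj_point_def by blast
  next
    fix v assume "v \<in> proj_point (2*d+1) (coeff_vector d p q)"
    then obtain c where "c \<noteq> 0" "v = coeff_vector d (smult c p) (smult c q)"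
      unfolding vec proj_point_def by blast
    then show "v \<in> coeff_point d f"
      using represents_smult[OF assms] unfolding coeff_point_def by blast
  qed
qed

lemma coeff_vector_nonzero:
  assumes "represents d f p q"
  shows "coeff_vector d p q \<in> nonzero_vectors (2*d+1)"
proof -
  have deg: "max (degree p) (degree q) = d" and nz: "p \<noteq> 0 \<or> q \<noteq> 0"
    using assms by (auto simp: represents_def)
  have ext: "coeff_vector d p q \<in> extensional {..2*d+1}"
    by (simp add: coeff_vector_def)
  have nonzero: ?thesis if "coeff_vector d p q i \<noteq> 0" "i \<le> 2*d+1" for i
    unfolding nonzero_vectors_def using ext that by (intro CollectI conjI exI)
  show ?thesis
  proof (cases "p = 0")
    case False
    then have "coeff_vector d p q (degree p) \<noteq> 0" "degree p \<le> 2*d+1"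
      using deg by (auto simp: coeff_vector_def)
    then show ?thesis
      by (rule nonzero)
  next
    case True
    then have "coeff_vector d p q (degree q + (d + 1)) \<noteq> 0" "degree q + (d + 1) \<le> 2*d+1"
      using deg nz by (auto simp: coeff_vector_def)
    then show ?thesis
      by (rule nonzero)
  qed
qed

lemma coeff_point_in_proj_space:
  fixes f :: "'k::field_char_0 proj_line \<Rightarrow> 'k proj_line"
  assumes "f \<in> rational_maps d"
  shows "coeff_point d f \<in> proj_space (2*d+1)"
proof -
  obtain p q where pq: "represents d f p q"
    using assms unfolding rational_maps_def by blast
  show ?thesis
    unfolding coeff_point_eq[OF pq] proj_space_def by (intro imageI coeff_vector_nonzero[OF pq])
qed

definition rational_maps_topology ::
    "nat \<Rightarrow> ('k::{field,topological_space} proj_line \<Rightarrow> 'k proj_line) topology" where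
  "rational_maps_topology d =
     pullback_topology (rational_maps d) (coeff_point d) (proj_space_topology (2*d+1))"


section \<open>Fatou and Julia sets, immediately expanding maps\<close>

definition equicontinuous_iterates_on ::
    "'a::metric_space set \<Rightarrow> ('a \<Rightarrow> 'a) \<Rightarrow> bool" where
  "equicontinuous_iterates_on U f \<longleftrightarrow>
     (\<forall>x\<in>U. \<forall>e>0. \<exists>r>0. \<forall>y\<in>U. dist y x < r \<longrightarrow> (\<forall>k. dist ((f ^^ k) y) ((f ^^ k) x) < e))"

definition fatou :: "('k::nonarch_normed_field proj_line \<Rightarrow> 'k proj_line) \<Rightarrow> 'k proj_line set" where
  "fatou f = \<Union>{U. open U \<and> equicontinuous_iterates_on U f}"

text \<open>The union is the largest element of the family:\<close>

lemma open_fatou: "open (fatou f)"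
  unfolding fatou_def by (intro open_Union) simp

lemma equicontinuous_iterates_on_fatou: "equicontinuous_iterates_on (fatou f) f"
  unfolding equicontinuous_iterates_on_def
proof (intro ballI allI impI)
  fix x and e :: real assume "x \<in> fatou f" "0 < e"
  then obtain U where U: "open U" "equicontinuous_iterates_on U f" "x \<in> U"
    unfolding fatou_def by blast
  then obtain r where r: "r > 0"
      "\<forall>y\<in>U. dist y x < r \<longrightarrow> (\<forall>k. dist ((f ^^ k) y) ((f ^^ k) x) < e)"
    using \<open>0 < e\<close> unfolding equicontinuous_iterates_on_def by meson
  obtain s where s: "s > 0" "\<forall>y. dist y x < s \<longrightarrow> y \<in> U"
    using U(1,3) unfolding open_dist by blast
  have "\<forall>k. dist ((f ^^ k) y) ((f ^^ k) x) < e" if "dist y x < min r s" for y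
    using r(2) s(2) that by (metis min_less_iff_conj)
  moreover have "min r s > 0"
    using r(1) s(1) by simp
  ultimately show "\<exists>r>0. \<forall>y\<in>fatou f. dist y x < r \<longrightarrow> (\<forall>k. dist ((f ^^ k) y) ((f ^^ k) x) < e)"
    by blast
qed

definition julia :: "('k::nonarch_normed_field proj_line \<Rightarrow> 'k proj_line) \<Rightarrow> 'k proj_line set" where
  "julia f = UNIV - fatou f"

text \<open>\<open>has_derivative_at f z D\<close>: near the finite point \<open>z\<close> the map \<open>f\<close> takes finite values, and its difference
  quotients at \<open>z\<close> converge to \<open>D\<close>.\<close>

definition has_derivative_at ::
    "('k::nonarch_normed_field proj_line \<Rightarrow> 'k proj_line) \<Rightarrow> 'k \<Rightarrow> 'k \<Rightarrow> bool" where
  "has_derivative_at f z D \<longleftrightarrow>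
     (\<exists>\<phi>. (\<forall>\<^sub>F w in nhds z. f (Fin w) = Fin (\<phi> w)) \<and>
          ((\<lambda>w. (\<phi> w - \<phi> z) / (w - z)) \<longlongrightarrow> D) (at z))"

text \<open>The derivative is only defined at finite points with finite value, so a map satisfying the
  following has no poles in its Julia set, and infinity does not lie in it.\<close>

definition immediately_expanding ::
    "('k::nonarch_normed_field proj_line \<Rightarrow> 'k proj_line) \<Rightarrow> bool" where
  "immediately_expanding f \<longleftrightarrow> julia f \<noteq> {} \<and>
     (\<exists>L>1. \<forall>x\<in>julia f. \<exists>z D. x = Fin z \<and> has_derivative_at f z D \<and> nrm D \<ge> L)"

end

theory Submission
  imports Defs
begin

text \<open>
  Since \<open>\<infinity>\<close> lies in the Fatou set, the Julia set \<open>J\<close> of \<open>f = p/q\<close> is bounded and totally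
  invariant, \<open>|q|\<close> is bounded below on it, and Taylor expansion shows that there is one radius
  \<open>\<delta>\<close> such that \<open>f\<close> multiplies all distances in the ball of radius \<open>\<delta>\<close> around any \<open>x \<in> J\<close> by the
  same factor \<open>|f'(x)| \<ge> L > 1\<close>. By the ultrametric inequality every \<open>g\<close> with coefficients close to
  those of \<open>f\<close> has the same factors on these balls, and it pulls the \<open>\<delta>\<close>-neighbourhood \<open>V\<close> of
  \<open>J\<close> back into itself. No compactness of \<open>J\<close> is needed.

  Shadowing \<open>f\<close>-orbits in \<open>J\<close> by \<open>g\<close>-orbits in \<open>V\<close> conjugates \<open>f\<close> on \<open>J\<close> to \<open>g\<close> on the set
  \<open>\<Lambda>\<close> of points whose \<open>g\<close>-orbit stays in \<open>V\<close>. The conjugacy is an isometry: distances that differ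
  would be multiplied by the same factors and hence differ forever, but two orbits that stay close
  forever coincide by expansion. Expansion also puts \<open>\<Lambda>\<close> in the Julia set of \<open>g\<close>. A point outside
  \<open>\<Lambda>\<close> has a neighbourhood whose forward images omit a common disc, so it lies in the Fatou set by
  the Schwarz lemma.
\<close>

section \<open>Ultrametric norms and roots of polynomials\<close>

text \<open>Without compactness the uniform constants must come from algebra. A Bezout identity of
  \<open>p\<close> and \<open>q\<close> bounds \<open>|q|\<close> below on \<open>J\<close>.
  Preimages of \<open>J\<close> stay away from infinity because \<open>f\<close> sends the Fatou
  point infinity to a Fatou point, so the coefficient of degree \<open>d\<close> of
  \<open>p - y q\<close> is bounded below for \<open>y\<close> in \<open>J\<close>. Openness of
  \<open>f\<close>, surjectivity onto discs and the position of preimages all concern roots of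
  polynomials; as the field is algebraically closed, they follow from comparing coefficients. The
  constants are nested. On balls of radius \<open>\<delta>0\<close> every map near \<open>f\<close>
  has the factors of \<open>f\<close>; \<open>\<delta>\<close> is so small that
  \<open>g\<close>-preimages of points of \<open>V\<close> lie within \<open>\<delta>0\<close> of
  \<open>f\<close>-preimages of points of \<open>J\<close>, and expansion then improves
  \<open>\<delta>0\<close> to \<open>\<delta>\<close>; \<open>\<eta>\<close> is chosen last.
  Expansion also provides nonzero elements of arbitrarily small norm, needed for the Schwarz lemma
  and for the Julia set of \<open>g\<close>. The conjugacy is an isometry for the affine metric and
  moves points by at most \<open>\<delta> \<le> 1\<close>, so it is an isometry for the chordal
  metric too.\<close>

lemma funpow_mem:
  assumes "\<And>x. x \<in> A \<Longrightarrow> f x \<in> A" "x \<in> A"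
  shows "(f ^^ n) x \<in> A"
  using assms by (induction n) auto

lemma nrm_1 [simp]: "nrm (1::'k::nonarch_normed_field) = 1"
  using nrm_mult[of "1::'k" 1] nrm_eq_zero_iff[of "1::'k"] by simp

lemma nrm_0 [simp]: "nrm (0::'k::nonarch_normed_field) = 0"
  by (simp add: nrm_eq_zero_iff)

lemma nrm_minus [simp]: "nrm (- x) = nrm (x::'k::nonarch_normed_field)"
  using nrm_minus_commute[of 0 x] by simp

lemma nrm_pos: "x \<noteq> 0 \<Longrightarrow> 0 < nrm (x::'k::nonarch_normed_field)"
  using nrm_nonneg[of x] nrm_eq_zero_iff[of x] by linarith

lemma nrm_power: "nrm (x ^ n) = nrm (x::'k::nonarch_normed_field) ^ n"
  by (induction n) (simp_all add: nrm_mult)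

lemma nrm_divide: "nrm (x / y) = nrm x / nrm (y::'k::nonarch_normed_field)"
proof (cases "y = 0")
  case False
  then have "nrm (x / y) * nrm y = nrm x"
    by (simp flip: nrm_mult)
  then show ?thesis
    using False by (simp add: nrm_eq_zero_iff field_simps)
qed simp

lemma nrm_add_le: "nrm x \<le> B \<Longrightarrow> nrm y \<le> B \<Longrightarrow> nrm (x + y) \<le> B"
  for x :: "'k::nonarch_normed_field"
  using nrm_add[of x y] by linarith

lemma nrm_diff_le: "nrm x \<le> B \<Longrightarrow> nrm y \<le> B \<Longrightarrow> nrm (x - y) \<le> B"
  for x :: "'k::nonarch_normed_field"
  using nrm_diff[of x y] by linarith

lemma nrm_eqI: "nrm (x - y) < nrm y \<Longrightarrow> nrm x = nrm y"
  for x :: "'k::nonarch_normed_field"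
  using nrm_add[of "x - y" y] nrm_diff[of x "x - y"] by simp

lemma nrm_sum_le:
  fixes f :: "'i \<Rightarrow> 'k::nonarch_normed_field"
  assumes "\<And>i. i \<in> I \<Longrightarrow> nrm (f i) \<le> B" "0 \<le> B"
  shows "nrm (sum f I) \<le> B"
  using assms by (induction I rule: infinite_finite_induct) (auto intro: nrm_add_le)

lemma nrm_prod_mset: "nrm (prod_mset A) = (\<Prod>x\<in>#A. nrm (x::'k::nonarch_normed_field))"
  by (induction A) (simp_all add: nrm_mult)

lemma nrm_poly_le:
  fixes P :: "'k::nonarch_normed_field poly"
  assumes "\<And>i. nrm (coeff P i) \<le> M" "nrm z \<le> r" "1 \<le> r" "degree P \<le> d"
  shows "nrm (poly P z) \<le> M * r ^ d"
  unfolding poly_altdef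
proof (rule nrm_sum_le)
  have M: "0 \<le> M"
    using assms(1)[of 0] nrm_nonneg[of "coeff P 0"] by linarith
  then show "0 \<le> M * r ^ d"
    using assms(3) by simp
  fix i assume "i \<in> {..degree P}"
  then have "nrm z ^ i \<le> r ^ d"
    using assms(2-4) power_mono[of "nrm z" r i] power_increasing[of i d r] nrm_nonneg[of z]
    by force
  then show "nrm (coeff P i * z ^ i) \<le> M * r ^ d"
    using assms(1) M by (simp add: nrm_mult nrm_power mult_mono nrm_nonneg)
qed

section \<open>Position of roots, maximum principle and Schwarz lemma for polynomials\<close>

lemma poly_factorization:
  fixes P :: "'k::alg_closed_field poly"
  assumes "P \<noteq> 0"
  obtains A where "size A = degree P" "\<And>z. poly P z = lead_coeff P * (\<Prod>x\<in>#A. z - x)"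
    "\<And>x. x \<in># A \<Longrightarrow> poly P x = 0"
proof -
  obtain A where A: "size A = degree P" "P = smult (lead_coeff P) (\<Prod>x\<in>#A. [:-x, 1:])"
    using alg_closed_imp_factorization[OF assms] by blast
  have "poly P z = lead_coeff P * (\<Prod>x\<in>#A. z - x)" for z
    by (subst A(2)) (simp add: poly_prod_mset)
  then show thesis
    using A(1) that by fastforce
qed

lemma prod_mset_mono_real:
  fixes f g :: "'a \<Rightarrow> real"
  assumes "\<And>x. x \<in># A \<Longrightarrow> 0 \<le> f x \<and> f x \<le> g x"
  shows "0 \<le> (\<Prod>x\<in>#A. f x) \<and> (\<Prod>x\<in>#A. f x) \<le> (\<Prod>x\<in>#A. g x)"
  using assms
proof (induction A)
  case (add a A)
  then have "0 \<le> f a" "f a \<le> g a" "0 \<le> (\<Prod>x\<in>#A. f x)" "(\<Prod>x\<in>#A. f x) \<le> (\<Prod>x\<in>#A. g x)"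
    by auto
  then show ?case
    using mult_mono[of "f a" "g a" "\<Prod>x\<in>#A. f x" "\<Prod>x\<in>#A. g x"] by simp
qed simp

text \<open>If all roots were farther than \<open>r\<close> from \<open>z\<close>, the factorization
  would make the value at \<open>z\<close> too large.\<close>

lemma root_near:
  fixes P :: "'k::{nonarch_normed_field,alg_closed_field} poly"
  assumes "nrm (poly P z) \<le> nrm (lead_coeff P) * r ^ degree P" "0 < r" "degree P > 0"
  shows "\<exists>x. poly P x = 0 \<and> nrm (z - x) \<le> r"
proof (rule ccontr)
  assume none: "\<not> ?thesis"
  have "P \<noteq> 0"
    using assms(3) by auto
  then obtain A where A: "size A = degree P" "\<And>z. poly P z = lead_coeff P * (\<Prod>x\<in>#A. z - x)"
    "\<And>x. x \<in># A \<Longrightarrow> poly P x = 0"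
    by (rule poly_factorization) blast
  have far: "r < nrm (z - x)" if "x \<in># A" for x
    using none A(3)[OF that] by force
  from A(1) assms(3) obtain a A' where "A = add_mset a A'"
    by (metis size_eq_Suc_imp_eq_union Suc_pred)
  moreover from this have "r ^ size A' \<le> (\<Prod>x\<in>#A'. nrm (z - x))"
    using prod_mset_mono_real[of A' "\<lambda>_. r" "\<lambda>x. nrm (z - x)"] far assms(2)
    by (auto intro: less_imp_le)
  ultimately have "r ^ degree P < (\<Prod>x\<in>#A. nrm (z - x))"
    using far[of a] assms(2) unfolding A(1)[symmetric] by (auto intro!: mult_less_le_imp_less)
  moreover have "nrm (poly P z) = nrm (lead_coeff P) * (\<Prod>x\<in>#A. nrm (z - x))"
    by (simp add: A(2) nrm_mult nrm_prod_mset image_mset.compositionality o_def)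
  moreover have "0 < nrm (lead_coeff P)"
    using \<open>P \<noteq> 0\<close> by (simp add: nrm_pos)
  ultimately show False
    using assms(1) by simp
qed

text \<open>Induction by splitting off a root \<open>x\<close>: since \<open>r < nrm x\<close>,
  multiplication by \<open>X - x\<close> preserves strict dominance of the constant term on the disc
  of radius \<open>r\<close>.\<close>

lemma coeff_less_if_no_root:
  fixes P :: "'k::{nonarch_normed_field,alg_closed_field} poly"
  assumes "P \<noteq> 0" "0 < r" "\<And>x. nrm x \<le> r \<Longrightarrow> poly P x \<noteq> 0"
  shows "nrm (coeff P (Suc j)) * r ^ Suc j < nrm (coeff P 0)"
  using assms
proof (induction "degree P" arbitrary: P j)
  case 0
  then have "coeff P (Suc j) = 0" "coeff P 0 \<noteq> 0"
    using coeff_eq_0[of P "Suc j"] leading_coeff_0_iff[of P] by auto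
  then show ?case
    by (simp add: nrm_pos)
next
  case (Suc n)
  then obtain x where x: "poly P x = 0"
    using alg_closed_imp_poly_has_root[of P] by auto
  then obtain Q where Q: "P = [:-x, 1:] * Q"
    by (auto simp: poly_eq_0_iff_dvd elim: dvdE)
  have rx: "r < nrm x"
    using Suc.prems(3)[of x] x by force
  have "Q \<noteq> 0"
    using Q Suc.prems(1) by auto
  then have Q0: "Q \<noteq> 0" "degree Q = n"
    using Suc.hyps(2) by (simp_all add: Q degree_mult_eq del: mult_pCons_left)
  have IH: "nrm (coeff Q (Suc i)) * r ^ Suc i < nrm (coeff Q 0)" for i
    using Suc.hyps(1)[of Q i] Q0 Suc.prems(2,3) by (auto simp: Q)
  have Q00: "0 < nrm (coeff Q 0)"
    using IH[of 0] nrm_nonneg[of "coeff Q 1"] Suc.prems(2)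
    by (smt (verit, best) mult_nonneg_nonneg zero_less_power nrm_nonneg)
  have c: "coeff P (Suc j) = coeff Q j - x * coeff Q (Suc j)" "nrm (coeff P 0) = nrm x * nrm (coeff Q 0)"
    by (simp_all add: Q nrm_mult)
  have le: "nrm (coeff Q j) * r ^ j \<le> nrm (coeff Q 0)"
    using IH by (cases j) (auto intro: less_imp_le)
  have 1: "nrm (coeff Q j) * r ^ Suc j < nrm x * nrm (coeff Q 0)"
  proof -
    have "nrm (coeff Q j) * r ^ Suc j \<le> r * nrm (coeff Q 0)"
      using mult_left_mono[OF le, of r] Suc.prems(2) by (simp add: ac_simps)
    also have "\<dots> < nrm x * nrm (coeff Q 0)"
      using rx Q00 by simp
    finally show ?thesis .
  qed
  have 2: "nrm (x * coeff Q (Suc j)) * r ^ Suc j < nrm x * nrm (coeff Q 0)"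
    using mult_strict_left_mono[OF IH[of j], of "nrm x"] rx Suc.prems(2)
    by (simp only: nrm_mult mult.assoc)
  have "nrm (coeff P (Suc j)) \<le> max (nrm (coeff Q j)) (nrm (x * coeff Q (Suc j)))"
    unfolding c by (rule nrm_diff)
  then have "nrm (coeff P (Suc j)) * r ^ Suc j
      \<le> max (nrm (coeff Q j)) (nrm (x * coeff Q (Suc j))) * r ^ Suc j"
    using Suc.prems(2) by (intro mult_right_mono) auto
  also have "\<dots> < nrm x * nrm (coeff Q 0)"
    using 1 2 by (simp only: max_def split: if_splits) simp
  finally show ?case
    unfolding c .
qed

text \<open>The part of the Newton polygon theorem behind openness of rational maps and
  \<open>quotient_onto\<close>.\<close>

corollary root_in_disc:
  fixes P :: "'k::{nonarch_normed_field,alg_closed_field} poly"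
  assumes "P \<noteq> 0" "0 < r" "nrm (coeff P 0) \<le> nrm (coeff P (Suc j)) * r ^ Suc j"
  shows "\<exists>x. nrm x \<le> r \<and> poly P x = 0"
  using coeff_less_if_no_root[OF assms(1,2), of j] assms(3) by force

text \<open>A root \<open>u\<close> of \<open>X * \<Prod>(X - b) - 1\<close> avoids the residue classes of all \<open>b\<close>.\<close>

lemma exists_far_unit:
  fixes A :: "'k::{nonarch_normed_field,alg_closed_field} multiset"
  shows "\<exists>u. nrm u = 1 \<and> (\<forall>a\<in>#A. max 1 (nrm a) \<le> nrm (u - a))"
proof -
  \<comment> \<open>The element \<open>0\<close> supplies the factor \<open>X\<close> and later
    gives \<open>nrm u = 1\<close>. Elements of norm above 1 are left out: they have distance
    \<open>nrm a\<close> from any \<open>u\<close> of norm 1.\<close>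
  define B where "B = add_mset 0 (filter_mset (\<lambda>a. nrm a \<le> 1) A)"
  have B: "b \<in># B \<Longrightarrow> nrm b \<le> 1" for b
    by (auto simp: B_def)
  define F where "F = (\<Prod>b\<in>#B. [:-b, 1:])"
  have "degree F = size B" "F \<noteq> 0"
    unfolding F_def by (induction B) (auto simp: degree_mult_eq simp del: mult_pCons_left)
  then have "degree (F - 1) > 0"
    using degree_add_eq_left[of "-1" F] by (simp add: B_def)
  then obtain u where "poly (F - 1) u = 0"
    using alg_closed_imp_poly_has_root by blast
  then have "nrm (\<Prod>b\<in>#B. u - b) = 1"
    by (simp add: F_def poly_prod_mset)
  then have prod1: "(\<Prod>b\<in>#B. nrm (u - b)) = 1"
    by (simp only: nrm_prod_mset image_mset.compositionality o_def)
  have u: "nrm u \<le> 1"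
  proof (rule ccontr)
    assume u: "\<not> nrm u \<le> 1"
    have "nrm (u - b) = nrm u" if "b \<in># B" for b
      using B[OF that] u nrm_eqI[of "u - b" u] by simp
    then have "(\<Prod>b\<in>#B. nrm (u - b)) = (\<Prod>b\<in>#B. nrm u)"
      by (intro arg_cong[of _ _ prod_mset] image_mset_cong)
    then have "nrm u ^ size B = 1"
      using prod1 by simp
    then show False
      using u one_less_power[of "nrm u" "size B"] by (simp add: B_def)
  qed
  have le1: "nrm (u - b) \<le> 1" if "b \<in># B" for b
    using B[OF that] u by (rule nrm_diff_le[rotated])
  \<comment> \<open>All factors are at most 1 and their product is 1.\<close>
  have ge1: "1 \<le> nrm (u - b)" if "b \<in># B" for b
  proof -
    obtain B' where B': "B = add_mset b B'"
      using \<open>b \<in># B\<close> by (metis mset_add)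
    have "(\<Prod>b\<in>#B'. nrm (u - b)) \<le> 1"
      using prod_mset_mono_real[of B' "\<lambda>b. nrm (u - b)" "\<lambda>_. 1"] le1 by (simp add: B' nrm_nonneg)
    then have "nrm (u - b) * (\<Prod>b\<in>#B'. nrm (u - b)) \<le> nrm (u - b) * 1"
      by (intro mult_left_mono nrm_nonneg)
    then show ?thesis
      using prod1 by (simp add: B')
  qed
  show ?thesis
  proof (intro exI conjI ballI)
    show u1: "nrm u = 1"
      using u ge1[of 0] by (simp add: B_def)
    fix a assume "a \<in># A"
    show "max 1 (nrm a) \<le> nrm (u - a)"
    proof (cases "nrm a \<le> 1")
      case True
      then show ?thesis
        using ge1[of a] \<open>a \<in># A\<close> by (simp add: B_def)
    next
      case False
      then show ?thesis
        using nrm_eqI[of "u - a" "- a"] u1 by simp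
    qed
  qed
qed

text \<open>After rescaling by \<open>c\<close>, \<open>exists_far_unit\<close> gives one point
  \<open>u * c\<close> of the circle whose distance to every root \<open>a\<close> is at least
  \<open>max (nrm c) (nrm a)\<close>, which no point of the disc exceeds.\<close>

lemma poly_max_principle:
  fixes P :: "'k::{nonarch_normed_field,alg_closed_field} poly" and c z :: 'k
  assumes bound: "\<And>u. nrm u = nrm c \<Longrightarrow> nrm (poly P u) \<le> B" and "nrm z \<le> nrm c" "c \<noteq> 0"
  shows "nrm (poly P z) \<le> B"
proof (cases "P = 0")
  case True
  then show ?thesis
    using bound[of c] by simp
next
  case False
  then obtain A where A: "\<And>z. poly P z = lead_coeff P * (\<Prod>x\<in>#A. z - x)"
    by (rule poly_factorization) blast
  obtain u where u: "nrm u = 1" "\<And>a. a \<in># A \<Longrightarrow> max 1 (nrm (a / c)) \<le> nrm (u - a / c)"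
    using exists_far_unit[of "image_mset (\<lambda>a. a / c) A"] by auto
  have c: "0 < nrm c"
    using assms(3) by (rule nrm_pos)
  have le: "nrm (z - a) \<le> nrm (u * c - a)" if "a \<in># A" for a
  proof -
    have "nrm (u * c - a) = nrm (u - a / c) * nrm c"
      using assms(3) by (simp add: nrm_mult[symmetric] algebra_simps)
    moreover have "max 1 (nrm a / nrm c) * nrm c \<le> nrm (u - a / c) * nrm c"
      using u(2)[OF that] c by (intro mult_right_mono) (auto simp: nrm_divide)
    moreover have "max 1 (nrm a / nrm c) * nrm c = max (nrm c) (nrm a)"
      using c by (simp add: max_mult_distrib_right)
    moreover have "nrm (z - a) \<le> max (nrm c) (nrm a)"
      using nrm_diff[of z a] assms(2) by linarith
    ultimately show ?thesis
      by linarith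
  qed
  have "(\<Prod>a\<in>#A. nrm (z - a)) \<le> (\<Prod>a\<in>#A. nrm (u * c - a))"
    using prod_mset_mono_real[of A "\<lambda>a. nrm (z - a)" "\<lambda>a. nrm (u * c - a)"] le by (simp add: nrm_nonneg)
  then have "nrm (poly P z) \<le> nrm (poly P (u * c))"
    unfolding A nrm_mult nrm_prod_mset image_mset.compositionality o_def
    by (intro mult_left_mono nrm_nonneg)
  also have "\<dots> \<le> B"
    using u(1) by (intro bound) (simp add: nrm_mult)
  finally show ?thesis .
qed

text \<open>The maximum principle is applied to the quotient of \<open>P\<close> by
  \<open>X\<close>. Writing the radius as \<open>nrm c\<close> ensures that the circle contains
  points.\<close>

lemma poly_schwarz:
  fixes P :: "'k::{nonarch_normed_field,alg_closed_field} poly" and c z :: 'k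
  assumes bound: "\<And>u. nrm u \<le> nrm c \<Longrightarrow> nrm (poly P u) \<le> B" and "poly P 0 = 0"
    and z: "nrm z \<le> nrm c" "c \<noteq> 0"
  shows "nrm (poly P z) \<le> B / nrm c * nrm z"
proof -
  obtain Q where Q: "P = [:0, 1:] * Q"
    using assms(2) poly_eq_0_iff_dvd[of P 0] by (auto elim: dvdE)
  have "nrm (poly Q z) \<le> B / nrm c"
  proof (rule poly_max_principle[OF _ z])
    fix u :: 'k assume u: "nrm u = nrm c"
    then have "nrm c * nrm (poly Q u) \<le> B"
      using bound[of u] by (simp add: Q nrm_mult)
    then show "nrm (poly Q u) \<le> B / nrm c"
      using nrm_pos[OF z(2)] by (simp add: field_simps)
  qed
  then have "nrm z * nrm (poly Q z) \<le> nrm z * (B / nrm c)"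
    by (intro mult_left_mono nrm_nonneg)
  then show ?thesis
    by (simp add: Q nrm_mult ac_simps)
qed

text \<open>Every root \<open>x\<close> lies outside the disc, so \<open>nrm (z - x) = nrm x\<close>
  there.\<close>

lemma nrm_poly_constant_if_no_root:
  fixes P :: "'k::{nonarch_normed_field,alg_closed_field} poly"
  assumes "\<And>u. nrm u \<le> r \<Longrightarrow> poly P u \<noteq> 0" "nrm z \<le> r"
  shows "nrm (poly P z) = nrm (poly P 0)"
proof -
  have "0 \<le> r"
    using assms(2) nrm_nonneg[of z] by linarith
  then have "P \<noteq> 0"
    using assms(1)[of 0] by auto
  then obtain A where A: "\<And>z. poly P z = lead_coeff P * (\<Prod>x\<in>#A. z - x)"
    "\<And>x. x \<in># A \<Longrightarrow> poly P x = 0"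
    by (rule poly_factorization) blast
  have "nrm (z - x) = nrm (0 - x)" if "x \<in># A" for x
  proof (rule nrm_eqI)
    have "\<not> nrm x \<le> r"
      using assms(1)[of x] A(2)[OF that] by blast
    then show "nrm (z - x - (0 - x)) < nrm (0 - x)"
      using assms(2) by simp
  qed
  then have "(\<Prod>x\<in>#A. nrm (z - x)) = (\<Prod>x\<in>#A. nrm (0 - x))"
    by (intro arg_cong[of _ _ prod_mset] image_mset_cong)
  then show ?thesis
    unfolding A(1) nrm_mult nrm_prod_mset image_mset.compositionality o_def by simp
qed

section \<open>Homogeneous coordinates and charts\<close>

text \<open>The pair (0, 0), which is no point of the projective line, gets the default value
  \<open>Infty\<close>; users exclude it by hypothesis.\<close>

definition hom_point :: "'k::field \<Rightarrow> 'k \<Rightarrow> 'k proj_line" where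
  "hom_point x y = (if y = 0 then Infty else Fin (x / y))"

text \<open>In these coordinates poles need no special treatment, so distances between values of
  rational maps are estimated through polynomials.\<close>

lemma chordal_hom_point:
  fixes x y x' y' :: "'k::nonarch_normed_field"
  assumes "x \<noteq> 0 \<or> y \<noteq> 0" "x' \<noteq> 0 \<or> y' \<noteq> 0"
  shows "chordal (hom_point x y) (hom_point x' y') =
    nrm (x * y' - x' * y) / (max (nrm x) (nrm y) * max (nrm x') (nrm y'))"
proof -
  have mx: "max 1 (nrm a / nrm b) = max (nrm a) (nrm b) / nrm b" if "b \<noteq> 0" for a b :: 'k
    using nrm_pos[OF that] by (simp add: max_def field_simps)
  have inf: "chordal (hom_point a b) Infty = nrm b / max (nrm a) (nrm b)" if "b \<noteq> 0" for a b :: 'k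
    using that by (simp add: hom_point_def mx nrm_divide)
  have pos: "0 < max (nrm a) (nrm b)" if "b \<noteq> 0" for a b :: 'k
    using nrm_pos[OF that] by simp
  show ?thesis
  proof (cases "y = 0"; cases "y' = 0")
    assume y: "y \<noteq> 0" "y' \<noteq> 0"
    then have "x / y - x' / y' = (x * y' - x' * y) / (y * y')"
      by (simp add: field_simps)
    then show ?thesis
      using y nrm_pos[OF y(1)] nrm_pos[OF y(2)] pos[OF y(1), of x] pos[OF y(2), of x']
      by (simp add: hom_point_def mx nrm_divide nrm_mult del: max_less_iff_conj less_max_iff_disj)
  next
    assume y: "y \<noteq> 0" "y' = 0"
    then show ?thesis
      using inf[OF y(1), of x] assms nrm_pos[of x'] nrm_nonneg[of x']
      by (simp add: hom_point_def[of x'] nrm_mult max_absorb1)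
  next
    assume y: "y = 0" "y' \<noteq> 0"
    then show ?thesis
      using inf[OF y(2), of x'] assms nrm_pos[of x] nrm_nonneg[of x]
      by (simp add: hom_point_def[of x] nrm_mult max_absorb1 chordal_commute[of Infty])
  qed (simp add: hom_point_def)
qed

definition hom_eval :: "nat \<Rightarrow> 'k::field poly \<Rightarrow> 'k \<Rightarrow> 'k \<Rightarrow> 'k" where
  "hom_eval d p x y = (\<Sum>i\<le>d. coeff p i * x ^ i * y ^ (d - i))"

lemma hom_eval_eq_poly:
  assumes "y \<noteq> 0" "degree p \<le> d"
  shows "hom_eval d p x y = y ^ d * poly p (x / y)"
proof -
  have "poly p (x / y) = (\<Sum>i\<le>d. coeff p i * (x / y) ^ i)"
    unfolding poly_altdef using assms(2)
    by (intro sum.mono_neutral_left) (auto simp: coeff_eq_0)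
  then show ?thesis
    using assms(1) unfolding hom_eval_def
    by (auto simp: sum_distrib_left power_divide power_diff intro!: sum.cong)
qed

lemma hom_eval_0: "hom_eval d p x 0 = coeff p d * x ^ d"
proof -
  have "hom_eval d p x 0 = (\<Sum>i\<le>d. if i = d then coeff p d * x ^ d else 0)"
    unfolding hom_eval_def by (intro sum.cong) auto
  then show ?thesis by simp
qed

lemma coprime_no_common_root:
  fixes p q :: "'k::field poly"
  assumes "coprime p q"
  shows "poly p z \<noteq> 0 \<or> poly q z \<noteq> 0"
proof (rule ccontr)
  assume "\<not> ?thesis"
  moreover obtain s t where "s * p + t * q = 1"
    using coprime_poly_bezout[OF assms] by blast
  then have "poly (s * p + t * q) z = 1" by simp
  ultimately show False by simp
qed

lemma represents_degree_coeff:
  assumes "represents d f p q"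
  shows "coeff p d \<noteq> 0 \<or> coeff q d \<noteq> 0" "degree p \<le> d" "degree q \<le> d"
proof -
  have "max (degree p) (degree q) = d" and "p \<noteq> 0 \<or> q \<noteq> 0"
    using assms by (auto simp: represents_def)
  then show "coeff p d \<noteq> 0 \<or> coeff q d \<noteq> 0" "degree p \<le> d" "degree q \<le> d"
    by (auto simp: max_def split: if_splits) (metis degree_0 le_0_eq leading_coeff_0_iff)+
qed

lemma represents_Fin:
  "represents d f p q \<Longrightarrow> f (Fin z) = (if poly q z = 0 then Infty else Fin (poly p z / poly q z))"
  by (simp add: represents_def rat_map_def)

lemma represents_Infty:
  "represents d f p q \<Longrightarrow> f Infty = (if coeff q d = 0 then Infty else Fin (coeff p d / coeff q d))"
  by (auto simp: represents_def rat_map_def Let_def)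

lemma represents_hom_point:
  assumes "represents d f p q" "x \<noteq> 0 \<or> y \<noteq> 0"
  shows "hom_eval d p x y \<noteq> 0 \<or> hom_eval d q x y \<noteq> 0"
    and "f (hom_point x y) = hom_point (hom_eval d p x y) (hom_eval d q x y)"
proof -
  note deg = represents_degree_coeff[OF assms(1)]
  have cop: "poly p z \<noteq> 0 \<or> poly q z \<noteq> 0" for z
    using assms(1) coprime_no_common_root by (auto simp: represents_def)
  show "hom_eval d p x y \<noteq> 0 \<or> hom_eval d q x y \<noteq> 0"
    using deg assms(2) cop[of "x / y"] by (cases "y = 0") (auto simp: hom_eval_eq_poly hom_eval_0)
  show "f (hom_point x y) = hom_point (hom_eval d p x y) (hom_eval d q x y)"
    using deg assms(2)
    by (cases "y = 0")
      (auto simp: hom_eval_eq_poly hom_eval_0 hom_point_def represents_Fin[OF assms(1)]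
        represents_Infty[OF assms(1)])
qed

section \<open>Polynomial lifts of iterates, and charts\<close>

definition lifts_to :: "('k::field \<Rightarrow> 'k proj_line) \<Rightarrow> 'k poly \<Rightarrow> 'k poly \<Rightarrow> bool" where
  "lifts_to F P Q \<longleftrightarrow> (\<forall>z. (poly P z \<noteq> 0 \<or> poly Q z \<noteq> 0) \<and> F z = hom_point (poly P z) (poly Q z))"

text \<open>Substituting \<open>P\<close> and \<open>Q\<close> into the homogenisations of
  \<open>p\<close> and \<open>q\<close> creates no common zero, so every iterate has a polynomial
  lift in a chart.\<close>

lemma lifts_to_rational_map:
  assumes "represents d f p q" "lifts_to F P Q"
  shows "\<exists>P' Q'. lifts_to (\<lambda>z. f (F z)) P' Q'"
proof -
  define H where "H r = (\<Sum>i\<le>d. smult (coeff r i) (P ^ i * Q ^ (d - i)))" for r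
  have "poly (H r) z = hom_eval d r (poly P z) (poly Q z)" for r z
    by (simp add: H_def hom_eval_def poly_sum mult.assoc)
  then have "lifts_to (\<lambda>z. f (F z)) (H p) (H q)"
    using represents_hom_point[OF assms(1)] assms(2) by (auto simp: lifts_to_def)
  then show ?thesis by blast
qed

lemma lifts_to_iterate:
  assumes "represents d f p q" "\<exists>P Q. lifts_to F P Q"
  shows "\<exists>P Q. lifts_to (\<lambda>z. (f ^^ n) (F z)) P Q"
  using assms(2) by (induction n) (auto dest: lifts_to_rational_map[OF assms(1)])

text \<open>An affine coordinate centred at \<open>x\<close>. Its range misses one point:
  \<open>Infty\<close> for a finite centre, \<open>Fin 0\<close> for the centre
  \<open>Infty\<close>.\<close>

definition chart :: "'k::field proj_line \<Rightarrow> 'k \<Rightarrow> 'k proj_line" where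
  "chart x z = (case x of Fin a \<Rightarrow> Fin (a + z) | Infty \<Rightarrow> hom_point 1 z)"

lemma chart_0 [simp]: "chart x 0 = x"
  by (simp add: chart_def hom_point_def split: proj_line.split)

lemma lifts_to_chart: "\<exists>P Q. lifts_to (chart x) P Q"
proof (cases x)
  case (Fin a)
  then have "lifts_to (chart x) [:a, 1:] 1"
    by (simp add: lifts_to_def chart_def hom_point_def add.commute)
  then show ?thesis by blast
next
  case Infty
  then have "lifts_to (chart x) 1 [:0, 1:]"
    by (simp add: lifts_to_def chart_def)
  then show ?thesis by blast
qed

lemma chordal_chart_le:
  fixes x :: "'k::nonarch_normed_field proj_line"
  shows "chordal (chart x z) x \<le> nrm z"
proof (cases x)
  case (Fin a)
  have "1 \<le> max 1 (nrm (a + z)) * max 1 (nrm a)"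
    using mult_mono[of 1 "max 1 (nrm (a + z))" 1 "max 1 (nrm a)"] by simp
  then have "nrm z / (max 1 (nrm (a + z)) * max 1 (nrm a)) \<le> nrm z / 1"
    by (intro divide_left_mono nrm_nonneg) auto
  then show ?thesis
    by (simp add: Fin chart_def)
next
  case Infty
  have "1 / max 1 (1 / nrm z) \<le> nrm z" if "z \<noteq> 0"
    using nrm_pos[OF that] by (auto simp: max_def field_simps)
  then show ?thesis
    by (simp add: Infty chart_def hom_point_def nrm_divide)
qed

text \<open>A point of norm above \<open>R\<close> has chordal distance
  \<open>1 / max 1 (nrm a)\<close>, hence at least \<open>e\<close>, from \<open>Fin a\<close>; for
  the others the chordal denominator is at most \<open>R\<^sup>2\<close>.\<close>

lemma chordal_FinD:
  fixes a :: "'k::nonarch_normed_field"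
  assumes "nrm a \<le> R" "1 \<le> R" "chordal (Fin a) y < e" "e * R \<le> 1"
  obtains b where "y = Fin b" "nrm b \<le> R" "nrm (b - a) < e * R\<^sup>2"
proof -
  have R: "0 < max 1 (nrm a)" "max 1 (nrm a) \<le> R"
    using assms(1,2) by simp_all
  have eR: "e \<le> 1 / R"
    using assms(2,4) by (simp add: field_simps)
  have aR: "1 / R \<le> 1 / max 1 (nrm a)"
    using R by (simp add: divide_left_mono)
  show thesis
  proof (cases y)
    case Infty
    then show thesis
      using assms(3) eR aR by simp
  next
    case (Fin b)
    have bR: "nrm b \<le> R"
    proof (rule ccontr)
      assume b: "\<not> nrm b \<le> R"
      then have "nrm (a - b) = nrm b"
        using assms(1) nrm_eqI[of "a - b" "- b"] by simp
      then have "chordal (Fin a) y = 1 / max 1 (nrm a)"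
        using b assms(2) by (simp add: Fin max_absorb2)
      then show False
        using assms(3) eR aR by linarith
    qed
    have "nrm (a - b) < e * (max 1 (nrm a) * max 1 (nrm b))"
      using assms(3) R(1) by (simp add: Fin divide_less_eq)
    also have "\<dots> \<le> e * (R * R)"
      using assms bR R chordal_nonneg[of "Fin a" y] by (intro mult_left_mono mult_mono) auto
    finally show thesis
      using that Fin bR by (simp add: nrm_minus_commute power2_eq_square)
  qed
qed

lemma chordal_chartE:
  fixes x :: "'k::nonarch_normed_field proj_line"
  assumes "0 < r"
  obtains e where "0 < e" "\<And>y. chordal y x < e \<Longrightarrow> \<exists>z. nrm z < r \<and> y = chart x z"
proof (cases x)
  case (Fin a)
  define R where "R = max 1 (nrm a)"
  define e where "e = min (1 / R) (r / R\<^sup>2)"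
  have R: "1 \<le> R" "nrm a \<le> R"
    by (simp_all add: R_def)
  show thesis
  proof
    show "0 < e"
      using R assms by (simp add: e_def)
    fix y assume y: "chordal y x < e"
    have "e * R \<le> 1" "e * R\<^sup>2 \<le> r"
      using R by (simp_all add: e_def min_def field_simps)
    with y obtain b where "y = Fin b" "nrm (b - a) < e * R\<^sup>2"
      using chordal_FinD[OF R(2,1), of y e] by (auto simp: Fin chordal_commute[of y])
    then show "\<exists>z. nrm z < r \<and> y = chart x z"
      using \<open>e * R\<^sup>2 \<le> r\<close> by (intro exI[of _ "b - a"]) (simp add: Fin chart_def)
  qed
next
  case Infty
  show thesis
  proof
    show "0 < min r 1"
      using assms by simp
    fix y assume y: "chordal y x < min r 1"
    show "\<exists>z. nrm z < r \<and> y = chart x z"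
    proof (cases y)
      case (Fin b)
      then have b: "1 / nrm b < r" "1 < nrm b"
        using y Infty by (auto simp: max_def split: if_splits)
      then have "b \<noteq> 0"
        using nrm_0[where 'k='k] by force
      then show ?thesis
        using b by (intro exI[of _ "1 / b"]) (simp add: Infty Fin chart_def hom_point_def nrm_divide)
    qed (use Infty assms in \<open>auto simp: chart_def hom_point_def intro: exI[of _ 0]\<close>)
  qed
qed

lemma open_chartE:
  fixes x :: "'k::nonarch_normed_field proj_line"
  assumes "open U" "x \<in> U"
  obtains r where "0 < r" "\<And>z. nrm z < r \<Longrightarrow> chart x z \<in> U"
proof -
  obtain e where "0 < e" "\<forall>y. dist y x < e \<longrightarrow> y \<in> U"
    using assms unfolding open_dist by blast
  then show thesis
    using that[of e] chordal_chart_le[of x] unfolding dist_proj_line_def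
    by (meson le_less_trans)
qed

section \<open>Continuity, openness and invariance of the Fatou set\<close>

lemma coeff_bound:
  fixes P :: "'k::nonarch_normed_field poly"
  obtains M where "1 \<le> M" "\<And>i. nrm (coeff P i) \<le> M"
proof -
  define M where "M = Max (insert 1 ((\<lambda>i. nrm (coeff P i)) ` {..degree P}))"
  have M: "x \<le> M" if "x \<in> insert 1 ((\<lambda>i. nrm (coeff P i)) ` {..degree P})" for x
    using that unfolding M_def by (intro Max_ge) auto
  moreover have "nrm (coeff P i) \<le> M" for i
  proof (cases "i \<le> degree P")
    case True
    then show ?thesis
      by (intro M) auto
  next
    case False
    then show ?thesis
      using M[of 1] by (simp add: coeff_eq_0)
  qed
  ultimately show thesis
    using that[of M] by simp
qed

lemma poly_bounded_difference:
  fixes P :: "'k::nonarch_normed_field poly"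
  obtains M where "1 \<le> M" "\<And>z. nrm z \<le> 1 \<Longrightarrow> nrm (poly P z - poly P 0) \<le> M * nrm z"
proof -
  obtain Q where Q: "P = pCons (poly P 0) Q"
    by (cases P) auto
  obtain M where M: "1 \<le> M" "\<And>i. nrm (coeff Q i) \<le> M"
    using coeff_bound by blast
  have "nrm (poly P z - poly P 0) \<le> M * nrm z" if "nrm z \<le> 1" for z
  proof -
    have "poly P z - poly P 0 = z * poly Q z"
      by (subst Q) simp
    moreover have "nrm z * nrm (poly Q z) \<le> nrm z * M"
      using nrm_poly_le[OF M(2) that order_refl order_refl] by (intro mult_left_mono nrm_nonneg) simp
    ultimately show ?thesis
      by (simp add: nrm_mult mult.commute)
  qed
  then show thesis
    using that M(1) by blast
qed

text \<open>In a chart \<open>f\<close> has a polynomial lift. Near the centre its sup norm is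
  constant by the ultrametric inequality, so only the numerator in \<open>chordal_hom_point\<close>
  has to be estimated.\<close>

lemma isCont_rational_map:
  fixes f :: "'k::nonarch_normed_field proj_line \<Rightarrow> 'k proj_line"
  assumes "represents d f p q"
  shows "isCont f x"
  unfolding continuous_at_eps_delta dist_proj_line_def
proof (intro allI impI)
  fix e :: real assume e: "0 < e"
  obtain P Q where PQ: "lifts_to (\<lambda>z. f (chart x z)) P Q"
    using lifts_to_rational_map[OF assms] lifts_to_chart[of x] by blast
  define P0 Q0 c where "P0 = poly P 0" and "Q0 = poly Q 0" and "c = max (nrm P0) (nrm Q0)"
  have c: "0 < c" and P0Q0: "P0 \<noteq> 0 \<or> Q0 \<noteq> 0"
    using PQ nrm_pos[of P0] nrm_pos[of Q0] by (auto simp: lifts_to_def P0_def Q0_def c_def less_max_iff_disj)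
  obtain M1 where M1: "1 \<le> M1" "\<And>z. nrm z \<le> 1 \<Longrightarrow> nrm (poly P z - P0) \<le> M1 * nrm z"
    using poly_bounded_difference[of P] unfolding P0_def by blast
  obtain M2 where M2: "1 \<le> M2" "\<And>z. nrm z \<le> 1 \<Longrightarrow> nrm (poly Q z - Q0) \<le> M2 * nrm z"
    using poly_bounded_difference[of Q] unfolding Q0_def by blast
  define M where "M = max M1 M2"
  have M: "1 \<le> M" "nrm (poly P z - P0) \<le> M * nrm z" "nrm (poly Q z - Q0) \<le> M * nrm z"
    if "nrm z \<le> 1" for z
    using M1 M2(1) M1(2)[OF that] M2(2)[OF that] nrm_nonneg[of z]
      mult_right_mono[of M1 M "nrm z"] mult_right_mono[of M2 M "nrm z"]
    by (auto simp: M_def)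
  \<comment> \<open>The bound \<open>c / M\<close> keeps the sup norm of the lift equal to
    \<open>c\<close>; the bound \<open>e * c / M\<close> makes the chordal distance less than
    \<open>e\<close>.\<close>
  define r where "r = min 1 (min (c / M) (e * c / M))"
  have M1': "1 \<le> M"
    using M(1)[of 0] by simp
  have r: "0 < r"
    using c e M1' by (simp add: r_def)
  obtain s where s: "0 < s" "\<And>y. chordal y x < s \<Longrightarrow> \<exists>z. nrm z < r \<and> y = chart x z"
    using chordal_chartE[OF r] by blast
  have "chordal (f y) (f x) < e" if y: "chordal y x < s" for y
  proof -
    obtain z where z: "nrm z < r" "y = chart x z"
      using s(2)[OF y] by blast
    have z1: "nrm z \<le> 1" and "nrm z < c / M" "nrm z < e * c / M"
      using z(1) by (auto simp: r_def)
    then have Mz: "M * nrm z < c" "M * nrm z < e * c"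
      using M1' by (simp_all add: field_simps)
    define P1 Q1 where "P1 = poly P z" and "Q1 = poly Q z"
    have d: "nrm (P1 - P0) < c" "nrm (Q1 - Q0) < c"
      using M(2,3)[OF z1] Mz(1) by (auto simp: P1_def Q1_def)
    have max1: "max (nrm P1) (nrm Q1) = c"
    proof (rule antisym)
      show "max (nrm P1) (nrm Q1) \<le> c"
        using nrm_add[of "P1 - P0" P0] nrm_add[of "Q1 - Q0" Q0] d by (auto simp: c_def)
      have "nrm P1 = c \<or> nrm Q1 = c"
        using nrm_eqI[of P1 P0] nrm_eqI[of Q1 Q0] d unfolding c_def by (metis max_def)
      then show "c \<le> max (nrm P1) (nrm Q1)"
        by auto
    qed
    have "P1 * Q0 - P0 * Q1 = (P1 - P0) * Q0 - P0 * (Q1 - Q0)"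
      by (simp add: algebra_simps)
    then have "nrm (P1 * Q0 - P0 * Q1) \<le> max (nrm (P1 - P0) * nrm Q0) (nrm P0 * nrm (Q1 - Q0))"
      using nrm_diff[of "(P1 - P0) * Q0" "P0 * (Q1 - Q0)"] by (simp add: nrm_mult)
    also have "\<dots> \<le> (M * nrm z) * c"
      using mult_mono[of "nrm (P1 - P0)" "M * nrm z" "nrm Q0" c] mult_mono[of "nrm (Q1 - Q0)" "M * nrm z" "nrm P0" c]
        M(2,3)[OF z1] c nrm_nonneg[of z] M1' nrm_nonneg[of Q0] nrm_nonneg[of P0]
      by (simp add: P1_def Q1_def c_def mult.commute)
    also have "\<dots> < e * c * c"
      using Mz(2) c by simp
    finally have "nrm (P1 * Q0 - P0 * Q1) < e * c * c" .
    moreover have "f y = hom_point P1 Q1" "P1 \<noteq> 0 \<or> Q1 \<noteq> 0"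
      using PQ by (auto simp: lifts_to_def z P1_def Q1_def)
    moreover have "f x = hom_point P0 Q0"
      using PQ[unfolded lifts_to_def, THEN spec, of 0] by (simp add: P0_def Q0_def)
    ultimately show ?thesis
      using P0Q0 c by (simp add: chordal_hom_point max1 flip: c_def) (simp add: field_simps)
  qed
  then show "\<exists>s>0. \<forall>y. chordal y x < s \<longrightarrow> chordal (f y) (f x) < e"
    using s(1) by blast
qed

lemma continuous_on_iterate:
  fixes f :: "'k::nonarch_normed_field proj_line \<Rightarrow> 'k proj_line"
  assumes "represents d f p q"
  shows "continuous_on UNIV (f ^^ n)"
proof (induction n)
  case (Suc n)
  have "continuous_on UNIV f"
    using isCont_rational_map[OF assms] by (simp add: continuous_on_eq_continuous_at)
  then show ?case
    using Suc continuous_on_compose[of UNIV "f ^^ n" f] by (simp add: continuous_on_subset o_def)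
qed simp

lemma finite_fibre:
  fixes f :: "'k::field_char_0 proj_line \<Rightarrow> 'k proj_line"
  assumes "represents d f p q" "0 < d"
  shows "finite {t. f (Fin t) = Fin b}"
proof -
  have "p - smult b q \<noteq> 0"
  proof
    assume "p - smult b q = 0"
    then have p: "p = smult b q" by simp
    have "q dvd 1"
    proof (rule coprime_common_divisor)
      show "coprime p q"
        using assms by (simp add: represents_def)
    qed (simp_all add: p dvd_smult)
    then have "degree q = 0"
      by (auto simp: is_unit_poly_iff)
    then show False
      using assms p by (simp add: represents_def split: if_splits)
  qed
  then have "finite {t. poly (p - smult b q) t = 0}"
    by (rule poly_roots_finite)
  moreover have "{t. f (Fin t) = Fin b} \<subseteq> {t. poly (p - smult b q) t = 0}"
    by (auto simp: represents_Fin[OF assms(1)] field_simps split: if_splits)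
  ultimately show ?thesis
    by (rule rev_finite_subset)
qed

lemma infinite_range_chart:
  "infinite {t. Fin t \<in> range (chart (x :: 'k::field_char_0 proj_line))}"
proof -
  have "UNIV - {0} \<subseteq> {t. Fin t \<in> range (chart x)}"
  proof
    fix t :: 'k assume "t \<in> UNIV - {0}"
    then have "Fin t = chart x (case x of Fin a \<Rightarrow> t - a | Infty \<Rightarrow> 1 / t)"
      by (auto simp: chart_def hom_point_def split: proj_line.split)
    then show "t \<in> {t. Fin t \<in> range (chart x)}"
      by blast
  qed
  moreover have "infinite (UNIV - {0::'k})"
    by (simp add: infinite_UNIV_char_0)
  ultimately show ?thesis
    using finite_subset by blast
qed

text \<open>In a chart, \<open>P - b Q\<close> vanishes at 0 but not identically, so some
  coefficient of positive degree is nonzero. For \<open>w\<close> near \<open>b\<close> this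
  coefficient of \<open>P - w Q\<close> keeps its norm while the constant one is small, which forces
  a root near 0.\<close>

lemma open_at_finite_value:
  fixes f :: "'k::{nonarch_normed_field,alg_closed_field,field_char_0} proj_line \<Rightarrow> 'k proj_line"
  assumes f: "represents d f p q" "0 < d" and b: "f x = Fin b" and N: "open N" "x \<in> N"
  obtains s where "0 < s" "\<And>w. nrm (w - b) < s \<Longrightarrow> \<exists>x'\<in>N. f x' = Fin w"
proof -
  obtain P Q where PQ: "lifts_to (\<lambda>z. f (chart x z)) P Q"
    using lifts_to_rational_map[OF f(1)] lifts_to_chart[of x] by blast
  obtain r0 where r0: "0 < r0" "\<And>z. nrm z < r0 \<Longrightarrow> chart x z \<in> N"
    using open_chartE[OF N] by blast
  define r where "r = r0 / 2"
  have r: "0 < r" "r < r0"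
    using r0 by (simp_all add: r_def)
  have Q0: "poly Q 0 \<noteq> 0" and P0: "poly P 0 = b * poly Q 0"
    using PQ[unfolded lifts_to_def, THEN spec, of 0] b
    by (auto simp: hom_point_def field_simps split: if_splits)
  have "P - smult b Q \<noteq> 0"
  proof
    assume eq: "P - smult b Q = 0"
    have "f (chart x z) = Fin b" for z
    proof -
      have "poly P z = b * poly Q z"
        using arg_cong[OF eq, of "\<lambda>R. poly R z"] by simp
      then show ?thesis
        using PQ[unfolded lifts_to_def, THEN spec, of z] by (auto simp: hom_point_def)
    qed
    \<comment> \<open>A constant value on the chart would give an infinite fibre.\<close>
    then have "{t. Fin t \<in> range (chart x)} \<subseteq> {t. f (Fin t) = Fin b}"
      by auto
    then show False
      using finite_fibre[OF f, of b] infinite_range_chart finite_subset by blast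
  qed
  then obtain j where j: "coeff (P - smult b Q) j \<noteq> 0"
    by (auto simp: poly_eq_iff)
  have "j \<noteq> 0"
  proof
    assume "j = 0"
    then show False
      using j P0 by (simp flip: poly_0_coeff_0)
  qed
  then obtain i where i: "j = Suc i"
    using not0_implies_Suc by blast
  define C where "C = coeff (P - smult b Q) (Suc i)"
  have C: "0 < nrm C"
    using j unfolding C_def i by (rule nrm_pos)
  define K where "K = max 1 (nrm (coeff Q (Suc i)))"
  \<comment> \<open>The first bound preserves the norm of the coefficient of degree
    \<open>Suc i\<close>; the second makes the constant coefficient small enough for a root in the
    disc of radius \<open>r\<close>.\<close>
  define s where "s = min (nrm C / K) (nrm C * r ^ Suc i / nrm (poly Q 0))"
  have K: "1 \<le> K" "nrm (coeff Q (Suc i)) \<le> K"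
    by (simp_all add: K_def)
  have Q0': "0 < nrm (poly Q 0)"
    using Q0 by (rule nrm_pos)
  show thesis
  proof
    show "0 < s"
      using C K r Q0' by (simp add: s_def)
    fix w assume w: "nrm (w - b) < s"
    define T where "T = P - smult w Q"
    have TSuc: "coeff T (Suc i) - C = - ((w - b) * coeff Q (Suc i))"
      by (simp add: T_def C_def algebra_simps)
    have "nrm (coeff T (Suc i) - C) \<le> nrm (w - b) * K"
      unfolding TSuc nrm_minus nrm_mult using K by (intro mult_left_mono nrm_nonneg) simp
    also have "\<dots> < nrm C"
      using w K by (simp add: s_def field_simps)
    finally have T: "nrm (coeff T (Suc i)) = nrm C"
      by (rule nrm_eqI)
    have "coeff T 0 = - ((w - b) * poly Q 0)"
      using P0 by (simp add: T_def poly_0_coeff_0[symmetric] algebra_simps)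
    then have "nrm (coeff T 0) = nrm (w - b) * nrm (poly Q 0)"
      by (simp add: nrm_mult)
    also have "\<dots> \<le> nrm C * r ^ Suc i"
      using w Q0' by (simp add: s_def field_simps)
    finally have "nrm (coeff T 0) \<le> nrm (coeff T (Suc i)) * r ^ Suc i"
      by (simp only: T)
    moreover have "T \<noteq> 0"
      using T C by auto
    ultimately obtain z where z: "nrm z \<le> r" "poly T z = 0"
      using root_in_disc r(1) by blast
    have "poly P z = w * poly Q z"
      using z(2) by (simp add: T_def)
    then have "f (chart x z) = Fin w"
      using PQ[unfolded lifts_to_def, THEN spec, of z] by (auto simp: hom_point_def)
    then show "\<exists>x'\<in>N. f x' = Fin w"
      using r0(2)[of z] z(1) r(2) by force
  qed
qed

lemma fatouI: "open U \<Longrightarrow> equicontinuous_iterates_on U f \<Longrightarrow> x \<in> U \<Longrightarrow> x \<in> fatou f"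
  unfolding fatou_def by blast

lemma fatou_if_image_in_fatou:
  fixes f :: "'k::nonarch_normed_field proj_line \<Rightarrow> 'k proj_line"
  assumes f: "represents d f p q" and "f x \<in> fatou f"
  shows "x \<in> fatou f"
proof (rule fatouI)
  show "open (f -` fatou f)"
    using continuous_on_iterate[OF f, of 1] by (simp add: open_fatou open_vimage)
  show "equicontinuous_iterates_on (f -` fatou f) f"
    unfolding equicontinuous_iterates_on_def
  proof (intro ballI allI impI)
    fix y and e :: real assume y: "y \<in> f -` fatou f" and e: "0 < e"
    obtain r where r: "0 < r"
      "\<And>z k. z \<in> fatou f \<Longrightarrow> dist z (f y) < r \<Longrightarrow> dist ((f ^^ k) z) ((f ^^ k) (f y)) < e"
      using equicontinuous_iterates_on_fatou[of f] y e
      unfolding equicontinuous_iterates_on_def by (metis vimage_eq)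
    obtain s where s: "0 < s" "\<And>z. dist z y < s \<Longrightarrow> dist (f z) (f y) < r"
      using isCont_rational_map[OF f, of y] r(1) unfolding continuous_at_eps_delta by blast
    \<comment> \<open>The bound \<open>e\<close> serves the iterate with \<open>k = 0\<close>, which
      does not factor through \<open>f\<close>.\<close>
    have "dist ((f ^^ k) z) ((f ^^ k) y) < e" if "z \<in> f -` fatou f" "dist z y < min s e" for z k
      using that r(2)[of "f z"] s(2)[of z] by (cases k) (auto simp: funpow_Suc_right simp del: funpow.simps(2))
    then show "\<exists>r>0. \<forall>z\<in>f -` fatou f. dist z y < r \<longrightarrow> (\<forall>k. dist ((f ^^ k) z) ((f ^^ k) y) < e)"
      using s(1) e by (intro exI[of _ "min s e"]) auto
  qed
qed (use assms in simp)

text \<open>Openness is used twice: to lift each point of a disc around \<open>b\<close> to some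
  \<open>x'\<close> in the Fatou set, and then to lift points near \<open>f x'\<close> to points
  near \<open>x'\<close>, where iterate \<open>Suc k\<close> is controlled.\<close>

lemma image_in_fatou:
  fixes f :: "'k::{nonarch_normed_field,alg_closed_field,field_char_0} proj_line \<Rightarrow> 'k proj_line"
  assumes f: "represents d f p q" "0 < d" and x: "x \<in> fatou f" "f x = Fin b"
  shows "Fin b \<in> fatou f"
proof -
  obtain s where s: "0 < s" "\<And>w. nrm (w - b) < s \<Longrightarrow> \<exists>x'\<in>fatou f. f x' = Fin w"
    using open_at_finite_value[OF f x(2) open_fatou x(1)] by blast
  obtain r where r: "0 < r" "\<And>y. chordal y (Fin b) < r \<Longrightarrow> \<exists>z. nrm z < s \<and> y = chart (Fin b) z"
    using chordal_chartE[OF s(1)] by blast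
  let ?U = "ball (Fin b) r"
  have UD: "\<exists>w. y = Fin w \<and> nrm (w - b) < s" if "y \<in> ?U" for y
    using that r(2)[of y] by (force simp: chordal_commute dist_proj_line_def chart_def)
  have "equicontinuous_iterates_on ?U f"
    unfolding equicontinuous_iterates_on_def
  proof (intro ballI allI impI)
    fix y and e :: real assume "y \<in> ?U" and e: "0 < e"
    then obtain w where w: "y = Fin w" "nrm (w - b) < s"
      using UD by blast
    obtain x' where x': "x' \<in> fatou f" "f x' = y"
      using s(2) w by blast
    obtain t where t: "0 < t" "\<And>z k. z \<in> fatou f \<Longrightarrow> dist z x' < t \<Longrightarrow> dist ((f ^^ k) z) ((f ^^ k) x') < e"
      using equicontinuous_iterates_on_fatou[of f] x'(1) e
      unfolding equicontinuous_iterates_on_def by metis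
    have "open (fatou f \<inter> ball x' t)" "x' \<in> fatou f \<inter> ball x' t"
      using open_fatou x'(1) t(1) by auto
    with open_at_finite_value[OF f x'(2)[unfolded w(1)]] obtain u where u: "0 < u"
      "\<And>v. nrm (v - w) < u \<Longrightarrow> \<exists>z\<in>fatou f \<inter> ball x' t. f z = Fin v"
      by metis
    obtain l where l: "0 < l" "\<And>v. chordal v y < l \<Longrightarrow> \<exists>z. nrm z < u \<and> v = chart y z"
      using chordal_chartE[OF u(1)] by blast
    have "dist ((f ^^ k) v) ((f ^^ k) y) < e" if v: "dist v y < l" for v k
    proof -
      obtain v' where "v = Fin v'" "nrm (v' - w) < u"
        using l(2)[of v] v by (auto simp: dist_proj_line_def chart_def w(1))
      then obtain z where z: "z \<in> fatou f" "dist z x' < t" "f z = v"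
        using u(2)[of v'] by (auto simp: dist_commute)
      show ?thesis
        using t(2)[OF z(1,2), of "Suc k"] z(3) x'(2) by (simp add: funpow_swap1)
    qed
    then show "\<exists>r>0. \<forall>z\<in>?U. dist z y < r \<longrightarrow> (\<forall>k. dist ((f ^^ k) z) ((f ^^ k) y) < e)"
      using l(1) by blast
  qed
  then show ?thesis
    using fatouI[of ?U f] r(1) by simp
qed

text \<open>A Montel theorem for families omitting a whole disc: after moving a point of the omitted disc
  to infinity the iterates are bounded without poles, so the Schwarz lemma makes them uniformly
  Lipschitz.\<close>

lemma subset_fatou_if_omits_disc:
  fixes g :: "'k::{nonarch_normed_field,alg_closed_field} proj_line \<Rightarrow> 'k proj_line"
  assumes g: "represents d g p q" and nontrivial: "\<And>e::real. 0 < e \<Longrightarrow> \<exists>c::'k. c \<noteq> 0 \<and> nrm c < e"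
    and W: "open W" "\<And>x. x \<in> W \<Longrightarrow> g x \<in> W"
    and s: "0 < s" "\<And>b. nrm (b - a) < s \<Longrightarrow> Fin b \<notin> W"
  shows "W \<subseteq> fatou g"
proof -
  have "equicontinuous_iterates_on W g"
    unfolding equicontinuous_iterates_on_def
  proof (intro ballI allI impI)
    fix x and e :: real assume x: "x \<in> W" and e: "0 < e"
    obtain r0 where r0: "0 < r0" "\<And>z. nrm z < r0 \<Longrightarrow> chart x z \<in> W"
      using open_chartE[OF W(1) x] by blast
    \<comment> \<open>The Schwarz lemma needs a radius that is the norm of an element.\<close>
    obtain c :: 'k where c: "c \<noteq> 0" "nrm c < r0"
      using nontrivial[OF r0(1)] by blast
    define A where "A = max 1 (nrm a)"
    have c0: "0 < nrm c" and A: "1 \<le> A" "nrm a \<le> A"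
      using c by (auto simp: nrm_pos A_def)
    have lip: "chordal ((g ^^ n) (chart x z)) ((g ^^ n) x) \<le> A\<^sup>2 / (s * nrm c) * nrm z"
      if z: "nrm z \<le> nrm c" for n z
    proof -
      obtain P Q where "lifts_to (\<lambda>z. (g ^^ n) (chart x z)) P Q"
        using lifts_to_iterate[OF g lifts_to_chart, of n x] by blast
      then have PQ: "poly P u \<noteq> 0 \<or> poly Q u \<noteq> 0" "(g ^^ n) (chart x u) = hom_point (poly P u) (poly Q u)" for u
        by (auto simp: lifts_to_def)
      \<comment> \<open>\<open>Q / T\<close> is the iterate after the coordinate change
        \<open>X \<mapsto> 1 / (X - a)\<close>. Omitting the disc means that \<open>T\<close> has no
        zero and \<open>Q / T\<close> is bounded by \<open>1 / s\<close>.\<close>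
      define T where "T = P - smult a Q"
      have far: "poly T u \<noteq> 0 \<and> s * nrm (poly Q u) \<le> nrm (poly T u)" if "nrm u \<le> nrm c" for u
      proof (cases "poly Q u = 0")
        case True
        then show ?thesis
          using PQ(1)[of u] by (simp add: T_def nrm_nonneg)
      next
        case False
        have "(g ^^ n) (chart x u) \<in> W"
          using r0(2)[of u] that c(2) by (intro funpow_mem[OF W(2)]) auto
        then have "\<not> nrm (poly P u / poly Q u - a) < s"
          using s(2) False by (auto simp: PQ hom_point_def)
        moreover have "poly P u / poly Q u - a = poly T u / poly Q u"
          using False by (simp add: T_def field_simps)
        ultimately have "s \<le> nrm (poly T u) / nrm (poly Q u)"
          by (simp add: nrm_divide)
        then have "s * nrm (poly Q u) \<le> nrm (poly T u)"
          using nrm_pos[OF False] by (simp add: field_simps)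
        moreover have "0 < s * nrm (poly Q u)"
          using s(1) nrm_pos[OF False] by simp
        ultimately show ?thesis
          using nrm_0[where 'k='k] by force
      qed
      define t where "t = nrm (poly T 0)"
      have T: "nrm (poly T u) = t" if "nrm u \<le> nrm c" for u
        unfolding t_def using far that by (intro nrm_poly_constant_if_no_root[of "nrm c"]) blast+
      have t: "0 < t"
        unfolding t_def using far[of 0] c0 by (intro nrm_pos) simp
      have Q: "nrm (poly Q u) \<le> t / s" if "nrm u \<le> nrm c" for u
        using far[OF that] T[OF that] s(1) by (simp add: field_simps)
      \<comment> \<open>The numerator of the difference of \<open>Q / T\<close> at \<open>z\<close>
        and 0. The terms with \<open>a\<close> cancel, leaving up to sign the numerator of the
        chordal distance.\<close>
      define N where "N = smult (poly T 0) Q - smult (poly Q 0) T"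
      have "nrm (poly N z) \<le> (t * (t / s)) / nrm c * nrm z"
      proof (rule poly_schwarz[OF _ _ z c(1)])
        fix u :: 'k assume u: "nrm u \<le> nrm c"
        have "nrm (poly T 0 * poly Q u) \<le> t * (t / s)" "nrm (poly Q 0 * poly T u) \<le> t * (t / s)"
          using mult_left_mono[OF Q[OF u], of t] mult_left_mono[OF Q[of 0], of t] t c0 T[OF u]
          by (simp_all add: nrm_mult t_def[symmetric] mult.commute)
        then show "nrm (poly N u) \<le> t * (t / s)"
          by (simp add: N_def nrm_diff_le)
      qed (simp add: N_def)
      also have "\<dots> = t\<^sup>2 / (s * nrm c) * nrm z"
        by (simp add: power2_eq_square)
      finally have num: "nrm (poly P z * poly Q 0 - poly P 0 * poly Q z) \<le> t\<^sup>2 / (s * nrm c) * nrm z"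
        using nrm_minus_commute[of "poly P z * poly Q 0" "poly P 0 * poly Q z"]
        by (simp add: N_def T_def algebra_simps)
      \<comment> \<open>\<open>T\<close> combines \<open>P\<close> and \<open>Q\<close> with
        coefficients of norm at most \<open>A\<close>, so \<open>P\<close> and \<open>Q\<close>
        cannot both be small.\<close>
      have den: "t / A \<le> max (nrm (poly P u)) (nrm (poly Q u))" if "nrm u \<le> nrm c" for u
      proof -
        have "t \<le> max (nrm (poly P u)) (nrm a * nrm (poly Q u))"
          using nrm_diff[of "poly P u" "a * poly Q u"] T[OF that] by (simp add: T_def nrm_mult)
        also have "\<dots> \<le> max (A * nrm (poly P u)) (A * nrm (poly Q u))"
          using A mult_right_mono[of 1 A "nrm (poly P u)"] mult_right_mono[of "nrm a" A "nrm (poly Q u)"]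
          by (intro max.mono) (simp_all add: nrm_nonneg)
        also have "\<dots> = A * max (nrm (poly P u)) (nrm (poly Q u))"
          using A by (simp add: max_mult_distrib_left)
        finally show ?thesis
          using A by (simp add: field_simps)
      qed
      let ?D = "max (nrm (poly P z)) (nrm (poly Q z)) * max (nrm (poly P 0)) (nrm (poly Q 0))"
      have D: "t\<^sup>2 / A\<^sup>2 \<le> ?D"
        using mult_mono[OF den[OF z] den[of 0]] t A c0 by (simp add: power2_eq_square le_max_iff_disj nrm_nonneg)
      have "chordal ((g ^^ n) (chart x z)) ((g ^^ n) x) = nrm (poly P z * poly Q 0 - poly P 0 * poly Q z) / ?D"
        using PQ(2)[of z] PQ(2)[of 0] by (simp add: chordal_hom_point[OF PQ(1) PQ(1)])
      also have "\<dots> \<le> (t\<^sup>2 / (s * nrm c) * nrm z) / (t\<^sup>2 / A\<^sup>2)"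
        using num D t A by (intro frac_le order_trans[OF nrm_nonneg num]) auto
      also have "\<dots> = A\<^sup>2 / (s * nrm c) * nrm z"
        using t A by (simp add: field_simps)
      finally show ?thesis .
    qed
    define B where "B = A\<^sup>2 / (s * nrm c)"
    have B: "0 < B"
      using A s(1) c0 by (simp add: B_def)
    obtain r where r: "0 < r" "\<And>y. chordal y x < r \<Longrightarrow> \<exists>z. nrm z < min (nrm c) (e / B) \<and> y = chart x z"
      using chordal_chartE[of "min (nrm c) (e / B)" x] c0 e B by auto
    have "dist ((g ^^ k) y) ((g ^^ k) x) < e" if "dist y x < r" for y k
    proof -
      obtain z where z: "nrm z < min (nrm c) (e / B)" "y = chart x z"
        using r(2) \<open>dist y x < r\<close> by (auto simp: dist_proj_line_def)
      have "chordal ((g ^^ k) y) ((g ^^ k) x) \<le> B * nrm z"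
        unfolding z(2) B_def using z(1) by (intro lip) simp
      also have "\<dots> < e"
        using z(1) B by (simp add: field_simps)
      finally show ?thesis
        by (simp add: dist_proj_line_def)
    qed
    then show "\<exists>r>0. \<forall>y\<in>W. dist y x < r \<longrightarrow> (\<forall>k. dist ((g ^^ k) y) ((g ^^ k) x) < e)"
      using r(1) by blast
  qed
  then show ?thesis
    using fatouI[OF W(1)] by blast
qed

section \<open>Conjugacy of expanding maps on ultrametric spaces\<close>

lemma nonpos_if_powers_bounded:
  fixes t B L :: real
  assumes "1 < L" "\<And>n. L ^ n * t \<le> B"
  shows "t \<le> 0"
proof (rule ccontr)
  assume t: "\<not> t \<le> 0"
  obtain n where "B / t < L ^ n"
    using real_arch_pow[OF assms(1)] by blast
  then show False
    using assms(2)[of n] t by (simp add: field_simps)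
qed

text \<open>The factor depends on the centre alone and applies to all pairs in the closed ball, so
  it also governs orbits that merely stay near \<open>J\<close>.\<close>

definition scales_near :: "'a::metric_space set \<Rightarrow> real \<Rightarrow> ('a \<Rightarrow> real) \<Rightarrow> ('a \<Rightarrow> 'a) \<Rightarrow> bool" where
  "scales_near J \<delta> m \<psi> \<longleftrightarrow> (\<forall>x\<in>J. \<forall>v v'. dist v x \<le> \<delta> \<longrightarrow> dist v' x \<le> \<delta> \<longrightarrow>
     dist (\<psi> v) (\<psi> v') = m x * dist v v')"

lemma scales_nearD:
  "scales_near J \<delta> m \<psi> \<Longrightarrow> x \<in> J \<Longrightarrow> dist v x \<le> \<delta> \<Longrightarrow> dist v' x \<le> \<delta> \<Longrightarrow>
    dist (\<psi> v) (\<psi> v') = m x * dist v v'"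
  by (simp add: scales_near_def)

text \<open>The last two assumptions are dual pullbacks: \<open>gamma_onto\<close> produces points
  whose \<gamma>-orbit follows a given orbit in \<open>J\<close>, and \<open>gamma_back\<close>
  produces points of \<open>J\<close> whose \<phi>-orbit follows a given \<gamma>-orbit.\<close>

locale expanding_perturbation =
  fixes J :: "'a::complete_space set" and \<phi> \<gamma> :: "'a \<Rightarrow> 'a" and m :: "'a \<Rightarrow> real" and \<delta> L :: real
  assumes ultra: "\<And>x y z :: 'a. dist x z \<le> max (dist x y) (dist y z)"
    and closed_J: "closed J"
    and phi_J: "x \<in> J \<Longrightarrow> \<phi> x \<in> J"
    and delta_pos: "0 < \<delta>"
    and L_gt_1: "1 < L"
    and m_ge: "x \<in> J \<Longrightarrow> L \<le> m x"
    and phi_scales: "scales_near J \<delta> m \<phi>"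
    and gamma_scales: "scales_near J \<delta> m \<gamma>"
    and gamma_onto: "x \<in> J \<Longrightarrow> dist w (\<phi> x) \<le> \<delta> \<Longrightarrow> \<exists>v. dist v x \<le> \<delta> \<and> \<gamma> v = w"
    and gamma_back: "y \<in> J \<Longrightarrow> x \<in> J \<Longrightarrow> dist v x \<le> \<delta> \<Longrightarrow> dist (\<gamma> v) y \<le> \<delta> \<Longrightarrow>
      \<exists>x'\<in>J. \<phi> x' = y \<and> dist v x' \<le> \<delta>"
begin

definition V :: "'a set" where
  "V = {v. \<exists>x\<in>J. dist v x \<le> \<delta>}"

definition Lam :: "'a set" where
  "Lam = {w. \<forall>n. (\<gamma> ^^ n) w \<in> V}"

definition shadows :: "'a \<Rightarrow> 'a \<Rightarrow> bool" where
  "shadows z w \<longleftrightarrow> z \<in> J \<and> (\<forall>n. dist ((\<gamma> ^^ n) w) ((\<phi> ^^ n) z) \<le> \<delta>)"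

lemma dist_le_trans: "dist x y \<le> r \<Longrightarrow> dist y z \<le> r \<Longrightarrow> dist x z \<le> r" for x y z :: 'a
  using ultra[of x z y] by linarith

lemma orbit_in_J: "z \<in> J \<Longrightarrow> (\<phi> ^^ n) z \<in> J"
  by (rule funpow_mem[OF phi_J])

lemma expand_step:
  assumes "scales_near J \<delta> m \<psi>" "x \<in> J" "dist v x \<le> \<delta>" "dist v' x \<le> \<delta>"
  shows "L * dist v v' \<le> dist (\<psi> v) (\<psi> v')"
  using assms mult_right_mono[OF m_ge[OF assms(2)] zero_le_dist[of v v']]
  by (simp add: scales_near_def)

text \<open>The centres \<open>x k\<close> need not form an orbit: a \<gamma>-orbit in
  \<open>V\<close> is at first only known to be near some point of \<open>J\<close> at each
  time.\<close>

lemma expand_orbit: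
  assumes "scales_near J \<delta> m \<psi>" "\<And>k. x k \<in> J"
    and "\<And>k. k < n \<Longrightarrow> dist ((\<psi> ^^ k) v) (x k) \<le> \<delta>"
    and "\<And>k. k < n \<Longrightarrow> dist ((\<psi> ^^ k) v') (x k) \<le> \<delta>"
  shows "L ^ n * dist v v' \<le> dist ((\<psi> ^^ n) v) ((\<psi> ^^ n) v')"
  using assms(3,4)
proof (induction n)
  case (Suc n)
  have "L ^ Suc n * dist v v' \<le> L * dist ((\<psi> ^^ n) v) ((\<psi> ^^ n) v')"
    using Suc L_gt_1 by (simp add: mult_left_mono)
  also have "\<dots> \<le> dist ((\<psi> ^^ Suc n) v) ((\<psi> ^^ Suc n) v')"
    using expand_step[OF assms(1,2) Suc.prems] by simp
  finally show ?case .
qed simp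

lemma eq_if_orbits_close:
  assumes "scales_near J \<delta> m \<psi>" "\<And>k. x k \<in> J"
    and "\<And>k. dist ((\<psi> ^^ k) v) (x k) \<le> \<delta>" "\<And>k. dist ((\<psi> ^^ k) v') (x k) \<le> \<delta>"
  shows "v = v'"
proof -
  have "L ^ n * dist v v' \<le> \<delta>" for n
    using expand_orbit[where x = x and n = n and v = v and v' = v', OF assms(1,2)] assms(3,4)
      dist_le_trans[of "(\<psi> ^^ n) v" "x n" \<delta> "(\<psi> ^^ n) v'"]
    by (force simp: dist_commute)
  then have "dist v v' \<le> 0"
    by (rule nonpos_if_powers_bounded[OF L_gt_1])
  then show ?thesis by simp
qed

text \<open>\<open>W n\<close> and all later terms share \<open>n\<close> balls, so expansion bounds
  their distance by \<open>\<delta> / L ^ n\<close>. This turns approximations of finite length into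
  a point that follows the centres forever.\<close>

lemma limit_orbit:
  assumes sc: "scales_near J \<delta> m \<psi>" and x: "\<And>k. x k \<in> J"
    and W: "\<And>n k. k \<le> n \<Longrightarrow> dist ((\<psi> ^^ k) (W n)) (x k) \<le> \<delta>"
  shows "\<exists>w. W \<longlonglongrightarrow> w \<and> (\<forall>k. dist ((\<psi> ^^ k) w) (x k) \<le> \<delta>)"
proof -
  have close: "L ^ n * dist (W n) (W n') \<le> \<delta>" if "n \<le> n'" for n n'
    using expand_orbit[where x = x and n = n and v = "W n" and v' = "W n'", OF sc x] W that
      dist_le_trans[of "(\<psi> ^^ n) (W n)" "x n" \<delta> "(\<psi> ^^ n) (W n')"]
    by (force simp: dist_commute)
  have "Cauchy W"
  proof (rule metric_CauchyI)
    fix e :: real assume e: "0 < e"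
    obtain N where "\<delta> / e < L ^ N"
      using real_arch_pow[OF L_gt_1] by blast
    then have N: "\<delta> < L ^ N * e"
      using e by (simp add: field_simps)
    have near: "dist (W N) (W n) < e" if "N \<le> n" for n
    proof (rule ccontr)
      assume "\<not> ?thesis"
      then have "L ^ N * e \<le> L ^ N * dist (W N) (W n)"
        using L_gt_1 by (intro mult_left_mono) auto
      then show False
        using N close[OF that] by linarith
    qed
    then have "dist (W i) (W j) < e" if "N \<le> i" "N \<le> j" for i j
      using ultra[of "W i" "W j" "W N"] near[OF that(1)] near[OF that(2)]
      by (simp add: dist_commute)
    then show "\<exists>M. \<forall>i\<ge>M. \<forall>j\<ge>M. dist (W i) (W j) < e"
      by blast
  qed
  then obtain w where w: "W \<longlonglongrightarrow> w"
    using Cauchy_convergent_iff convergent_def by blast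
  have in_ball: "dist ((\<psi> ^^ k) w) (x k) \<le> \<delta>" if "(\<lambda>n. (\<psi> ^^ k) (W n)) \<longlonglongrightarrow> (\<psi> ^^ k) w" for k
  proof -
    have "\<forall>\<^sub>F n in sequentially. dist (x k) ((\<psi> ^^ k) (W n)) \<le> \<delta>"
      using W by (auto simp: eventually_sequentially dist_commute)
    then have "dist (x k) ((\<psi> ^^ k) w) \<le> \<delta>"
      by (intro Lim_dist_ubound[OF _ that]) simp_all
    then show ?thesis
      by (simp add: dist_commute)
  qed
  \<comment> \<open>Continuity of \<open>\<psi>\<close> is available only inside the balls:
    convergence at time \<open>k\<close> puts the limit into the ball at \<open>x k\<close>, where
    scaling gives convergence at time \<open>Suc k\<close>.\<close>
  have "(\<lambda>n. (\<psi> ^^ k) (W n)) \<longlonglongrightarrow> (\<psi> ^^ k) w" for k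
  proof (induction k)
    case (Suc k)
    have "dist ((\<psi> ^^ Suc k) (W n)) ((\<psi> ^^ Suc k) w) = m (x k) * dist ((\<psi> ^^ k) (W n)) ((\<psi> ^^ k) w)"
      if "k \<le> n" for n
      using scales_nearD[OF sc x[of k] W[OF that] in_ball[OF Suc]] by simp
    then have "eventually (\<lambda>n. m (x k) * dist ((\<psi> ^^ k) (W n)) ((\<psi> ^^ k) w)
        = dist ((\<psi> ^^ Suc k) (W n)) ((\<psi> ^^ Suc k) w)) sequentially"
      unfolding eventually_sequentially by metis
    moreover have "(\<lambda>n. m (x k) * dist ((\<psi> ^^ k) (W n)) ((\<psi> ^^ k) w)) \<longlonglongrightarrow> m (x k) * 0"
      using Suc by (intro tendsto_mult_left) (simp add: tendsto_dist_iff[of _ "(\<psi> ^^ k) w"])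
    ultimately show ?case
      unfolding tendsto_dist_iff[of _ "(\<psi> ^^ Suc k) w"] mult_zero_right
      by (rule Lim_transform_eventually[rotated])
  qed (use w in simp)
  then show ?thesis
    using w in_ball by blast
qed

lemma shadows_isometry:
  assumes "shadows z w" "shadows z' w'"
  shows "dist w w' = dist z z'"
proof (rule ccontr)
  let ?z = "\<lambda>n. (\<phi> ^^ n) z" and ?z' = "\<lambda>n. (\<phi> ^^ n) z'"
  let ?w = "\<lambda>n. (\<gamma> ^^ n) w" and ?w' = "\<lambda>n. (\<gamma> ^^ n) w'"
  assume ne: "dist w w' \<noteq> dist z z'"
  have J: "?z n \<in> J" for n
    using assms by (intro orbit_in_J) (simp add: shadows_def)
  have sh: "dist (?w n) (?z n) \<le> \<delta>" "dist (?z n) (?w n) \<le> \<delta>"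
      "dist (?w' n) (?z' n) \<le> \<delta>" "dist (?z' n) (?w' n) \<le> \<delta>" for n
    using assms by (auto simp: shadows_def dist_commute)
  \<comment> \<open>Moving endpoints by at most \<open>\<delta>\<close> cannot change a distance
    above \<open>\<delta>\<close>, so two distances that differ are both at most
    \<open>\<delta>\<close>.\<close>
  have small: "dist (?z n) (?z' n) \<le> \<delta> \<and> dist (?w n) (?w' n) \<le> \<delta>"
    if "dist (?w n) (?w' n) \<noteq> dist (?z n) (?z' n)" for n
  proof -
    have "dist (?w n) (?w' n) \<le> max \<delta> (dist (?z n) (?z' n))"
      "dist (?z n) (?z' n) \<le> max \<delta> (dist (?w n) (?w' n))"
      using ultra[of "?w n" "?w' n" "?z n"] ultra[of "?z n" "?w' n" "?z' n"]
        ultra[of "?z n" "?z' n" "?w n"] ultra[of "?w n" "?z' n" "?w' n"] sh[of n]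
      by linarith+
    then show ?thesis
      using that by linarith
  qed
  have nea: "dist (?w n) (?w' n) \<noteq> dist (?z n) (?z' n)" for n
  proof (induction n)
    case (Suc n)
    have le: "dist (?z' n) (?z n) \<le> \<delta>" "dist (?w' n) (?w n) \<le> \<delta>" "dist (?z n) (?z n) \<le> \<delta>"
      using small[OF Suc] delta_pos by (auto simp: dist_commute)
    have "dist (?z (Suc n)) (?z' (Suc n)) = m (?z n) * dist (?z n) (?z' n)"
      using phi_scales J[of n] le by (simp add: scales_near_def)
    moreover have "dist (?w (Suc n)) (?w' (Suc n)) = m (?z n) * dist (?w n) (?w' n)"
      using gamma_scales J[of n] sh(1)[of n] dist_le_trans[OF le(2) sh(1)]
      by (simp add: scales_near_def)
    ultimately show ?case
      using Suc m_ge[OF J[of n]] L_gt_1 by simp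
  qed (use ne in simp)
  have le: "dist (?z' n) (?z n) \<le> \<delta>" "dist (?w' n) (?z n) \<le> \<delta>" for n
    using small[OF nea[of n]] dist_le_trans[of "?w' n" "?w n" \<delta> "?z n"] sh(1)[of n]
    by (auto simp: dist_commute)
  have "z = z'"
    by (rule eq_if_orbits_close[OF phi_scales J]) (use le delta_pos in auto)
  moreover have "w = w'"
    by (rule eq_if_orbits_close[OF gamma_scales J]) (use le sh in auto)
  ultimately show False
    using ne by simp
qed

text \<open>A point following \<open>\<phi> z\<close> for \<open>n\<close> steps is pulled back by
  \<open>gamma_onto\<close> to one following \<open>z\<close> for one step more; then a limit is
  taken.\<close>

lemma exists_shadow:
  assumes "z \<in> J"
  shows "\<exists>w. shadows z w"
proof -
  have "\<exists>w. \<forall>k\<le>n. dist ((\<gamma> ^^ k) w) ((\<phi> ^^ k) z) \<le> \<delta>" if "z \<in> J" for n z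
    using that
  proof (induction n arbitrary: z)
    case 0
    then show ?case
      using delta_pos by (intro exI[of _ z]) simp
  next
    case (Suc n)
    obtain w where w: "\<forall>k\<le>n. dist ((\<gamma> ^^ k) w) ((\<phi> ^^ k) (\<phi> z)) \<le> \<delta>"
      using Suc.IH[OF phi_J[OF Suc.prems]] by blast
    obtain v where v: "dist v z \<le> \<delta>" "\<gamma> v = w"
      using gamma_onto[OF Suc.prems, of w] w by fastforce
    have "dist ((\<gamma> ^^ k) v) ((\<phi> ^^ k) z) \<le> \<delta>" if "k \<le> Suc n" for k
    proof (cases k)
      case (Suc j)
      then have "(\<gamma> ^^ k) v = (\<gamma> ^^ j) w" "(\<phi> ^^ k) z = (\<phi> ^^ j) (\<phi> z)"
        by (simp_all only: funpow_Suc_right o_apply v)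
      then show ?thesis
        using w that Suc by simp
    qed (use v in simp)
    then show ?case by blast
  qed
  then obtain W where "\<And>n k. k \<le> n \<Longrightarrow> dist ((\<gamma> ^^ k) (W n)) ((\<phi> ^^ k) z) \<le> \<delta>"
    using assms by metis
  then have "\<exists>w. W \<longlonglongrightarrow> w \<and> (\<forall>k. dist ((\<gamma> ^^ k) w) ((\<phi> ^^ k) z) \<le> \<delta>)"
    by (intro limit_orbit[OF gamma_scales orbit_in_J[OF assms]])
  then show ?thesis
    using assms by (auto simp: shadows_def)
qed

text \<open>The same pullback in the other direction, by \<open>gamma_back\<close>; closedness of
  \<open>J\<close> keeps the limit in \<open>J\<close>.\<close>

lemma exists_shadowed:
  assumes "w \<in> Lam"
  shows "\<exists>z. shadows z w"
proof -
  have "\<exists>z\<in>J. \<forall>k\<le>n. dist ((\<phi> ^^ k) z) ((\<gamma> ^^ k) w) \<le> \<delta>" if "\<forall>k\<le>n. (\<gamma> ^^ k) w \<in> V" for n w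
    using that
  proof (induction n arbitrary: w)
    case 0
    then show ?case
      by (auto simp: V_def dist_commute)
  next
    case (Suc n)
    have "(\<gamma> ^^ k) (\<gamma> w) \<in> V" if "k \<le> n" for k
      using Suc.prems[rule_format, of "Suc k"] that by (simp only: funpow_Suc_right o_apply Suc_le_mono)
    then obtain y where y: "y \<in> J" "\<And>k. k \<le> n \<Longrightarrow> dist ((\<phi> ^^ k) y) ((\<gamma> ^^ k) (\<gamma> w)) \<le> \<delta>"
      using Suc.IH by blast
    obtain x where "x \<in> J" "dist w x \<le> \<delta>"
      using Suc.prems[rule_format, of 0] by (auto simp: V_def)
    then obtain z where z: "z \<in> J" "\<phi> z = y" "dist w z \<le> \<delta>"
      using gamma_back[OF y(1), of x w] y(2)[of 0] by (auto simp: dist_commute)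
    have "dist ((\<phi> ^^ k) z) ((\<gamma> ^^ k) w) \<le> \<delta>" if "k \<le> Suc n" for k
    proof (cases k)
      case (Suc j)
      then have "(\<gamma> ^^ k) w = (\<gamma> ^^ j) (\<gamma> w)" "(\<phi> ^^ k) z = (\<phi> ^^ j) y"
        by (simp_all only: funpow_Suc_right o_apply z)
      then show ?thesis
        using y(2) that Suc by simp
    qed (use z in \<open>simp add: dist_commute\<close>)
    then show ?case
      using z(1) by blast
  qed
  then have "\<forall>n. \<exists>z\<in>J. \<forall>k\<le>n. dist ((\<phi> ^^ k) z) ((\<gamma> ^^ k) w) \<le> \<delta>"
    using assms by (simp add: Lam_def)
  then obtain Z where Z: "\<And>n. Z n \<in> J"
      "\<And>n k. k \<le> n \<Longrightarrow> dist ((\<phi> ^^ k) (Z n)) ((\<gamma> ^^ k) w) \<le> \<delta>"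
    by metis
  \<comment> \<open>The point of \<open>J\<close> being sought has no orbit yet, so arbitrary points
    of \<open>J\<close> near the orbit of \<open>w\<close> serve as centres.\<close>
  obtain x where x: "\<And>k. x k \<in> J" "\<And>k. dist ((\<gamma> ^^ k) w) (x k) \<le> \<delta>"
    using assms unfolding Lam_def V_def mem_Collect_eq by metis
  obtain z where z: "Z \<longlonglongrightarrow> z" "\<And>k. dist ((\<phi> ^^ k) z) (x k) \<le> \<delta>"
    using limit_orbit[where x = x and W = Z, OF phi_scales x(1)] dist_le_trans[OF Z(2) x(2)] by blast
  have "z \<in> J"
    using closed_sequentially[OF closed_J] Z(1) z(1) by blast
  moreover have "dist ((\<gamma> ^^ k) w) ((\<phi> ^^ k) z) \<le> \<delta>" for k
    using dist_le_trans[OF x(2)[of k], of "(\<phi> ^^ k) z"] z(2)[of k] by (simp add: dist_commute)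
  ultimately show ?thesis
    by (auto simp: shadows_def)
qed

text \<open>\<open>shadows_isometry\<close> applied to one point twice makes shadows unique, and
  \<gamma> maps shadows of \<open>z\<close> to shadows of \<open>\<phi> z\<close>. The bound on
  \<open>dist (h z) z\<close> later transfers the isometry to the chordal metric.\<close>

theorem conjugacy:
  obtains h where "h ` J = Lam" "\<And>z z'. z \<in> J \<Longrightarrow> z' \<in> J \<Longrightarrow> dist (h z) (h z') = dist z z'"
    "\<And>z. z \<in> J \<Longrightarrow> dist (h z) z \<le> \<delta>" "\<And>z. z \<in> J \<Longrightarrow> h (\<phi> z) = \<gamma> (h z)"
proof -
  obtain h where h: "\<And>z. z \<in> J \<Longrightarrow> shadows z (h z)"
    using exists_shadow by metis
  have unique: "w = h z" if "shadows z w" for z w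
    using shadows_isometry[OF that h[of z]] that by (simp add: shadows_def)
  have shift: "shadows (\<phi> z) (\<gamma> w)" if "shadows z w" for z w
    unfolding shadows_def
  proof (intro conjI allI)
    show "\<phi> z \<in> J"
      using that phi_J by (simp add: shadows_def)
    fix n
    have "dist ((\<gamma> ^^ Suc n) w) ((\<phi> ^^ Suc n) z) \<le> \<delta>"
      using that unfolding shadows_def by blast
    then show "dist ((\<gamma> ^^ n) (\<gamma> w)) ((\<phi> ^^ n) (\<phi> z)) \<le> \<delta>"
      by (simp only: funpow_Suc_right o_apply)
  qed
  show thesis
  proof
    show "h ` J = Lam"
    proof (intro equalityI subsetI)
      fix w assume "w \<in> h ` J"
      then obtain z where z: "w = h z" "z \<in> J" by blast
      then have "dist ((\<gamma> ^^ n) w) ((\<phi> ^^ n) z) \<le> \<delta>" for n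
        using h[of z] by (simp add: shadows_def)
      then show "w \<in> Lam"
        using orbit_in_J[OF z(2)] unfolding Lam_def V_def by blast
    next
      fix w assume "w \<in> Lam"
      then obtain z where "shadows z w"
        using exists_shadowed by blast
      then show "w \<in> h ` J"
        using unique by (auto simp: shadows_def)
    qed
    fix z assume z: "z \<in> J"
    show "dist (h z) z \<le> \<delta>"
      using h[OF z] unfolding shadows_def by (metis funpow_0)
    show "h (\<phi> z) = \<gamma> (h z)"
      using unique[OF shift[OF h[OF z]]] by simp
    show "dist (h z) (h z') = dist z z'" if "z' \<in> J" for z'
      using shadows_isometry h z that by blast
  qed
qed

end

section \<open>Uniform local estimates\<close>

lemma nrm_mult_le: "nrm x \<le> A \<Longrightarrow> nrm y \<le> B \<Longrightarrow> nrm (x * y) \<le> A * B"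
  for x :: "'k::nonarch_normed_field"
  using mult_mono[of "nrm x" A "nrm y" B] nrm_nonneg[of x] nrm_nonneg[of y]
  by (simp add: nrm_mult)

definition taylor :: "'k::comm_ring_1 \<Rightarrow> 'k poly \<Rightarrow> 'k poly" where
  "taylor z P = pcompose P [:z, 1:]"

lemma poly_taylor [simp]: "poly (taylor z P) u = poly P (z + u)"
  by (simp add: taylor_def poly_pcompose add.commute)

lemma coeff_taylor_0 [simp]: "coeff (taylor z P) 0 = poly P z"
  by (simp flip: poly_0_coeff_0)

lemma taylor_diff: "taylor z (P - Q) = taylor z P - taylor z Q"
  by (simp add: taylor_def pcompose_diff)

text \<open>Recentring at a point of norm at most \<open>R\<close> costs one factor \<open>R\<close>
  per degree, by Horner's scheme, uniformly in the centre.\<close>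

lemma coeff_taylor_le:
  fixes P :: "'k::nonarch_normed_field poly"
  assumes "\<And>i. nrm (coeff P i) \<le> M" "nrm z \<le> R" "1 \<le> R" "degree P \<le> d"
  shows "nrm (coeff (taylor z P) j) \<le> M * R ^ d"
  using assms(1,4)
proof (induction P arbitrary: d j)
  case 0
  then show ?case
    using assms(3) by (simp add: taylor_def)
next
  case (pCons a P)
  have M: "0 \<le> M" "nrm a \<le> M" "\<And>i. nrm (coeff P i) \<le> M"
    using pCons.prems(1)[of 0] pCons.prems(1)[of "Suc i" for i] nrm_nonneg[of a]
    by (auto intro: order_trans)
  have Rd: "M \<le> M * R ^ d"
    using M(1) assms(3) mult_left_mono[of 1 "R ^ d" M] by simp
  show ?case
  proof (cases "P = 0")
    case True
    then show ?thesis
      using M Rd assms(3) by (cases j) (auto simp: taylor_def pcompose_pCons)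
  next
    case False
    then obtain d' where d': "d = Suc d'" "degree P \<le> d'"
      using pCons.prems(2) by (cases d) auto
    have IH: "nrm (coeff (taylor z P) i) \<le> M * R ^ d'" for i
      using pCons.IH M(3) d'(2) by blast
    have "1 * (M * R ^ d') \<le> R * (M * R ^ d')"
      using M(1) assms(3) by (intro mult_right_mono) auto
    then have le: "nrm (coeff (taylor z P) i) \<le> M * R ^ d" "nrm (z * coeff (taylor z P) i) \<le> M * R ^ d" for i
      using IH[of i] nrm_mult_le[OF assms(2) IH[of i]] by (simp_all add: d'(1) ac_simps)
    have "taylor z (pCons a P) = [:a:] + smult z (taylor z P) + pCons 0 (taylor z P)"
      by (simp add: taylor_def pcompose_pCons)
    then show ?thesis
      using le M(1,2) Rd by (cases j) (auto intro!: nrm_add_le simp del: coeff_taylor_0)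
  qed
qed

text \<open>This is the Lipschitz bound for \<open>X P\<close>, hence for any polynomial after its
  constant term is dropped.\<close>

lemma poly_two_point_aux:
  fixes P :: "'k::nonarch_normed_field poly"
  assumes "\<And>i. nrm (coeff P i) \<le> M" "nrm u \<le> 1" "nrm v \<le> 1"
  shows "nrm (u * poly P u - v * poly P v) \<le> M * nrm (u - v)"
  using assms(1)
proof (induction P)
  case 0
  then show ?case by (simp add: nrm_nonneg)
next
  case (pCons a P)
  have M: "nrm a \<le> M" "nrm (coeff P i) \<le> M" for i
    using pCons.prems[of 0] pCons.prems[of "Suc i"] by simp_all
  have M0: "0 \<le> M"
    using M(1) nrm_nonneg[of a] by linarith
  have Pu: "nrm (poly P u) \<le> M"
    using nrm_poly_le[OF M(2) assms(2) order_refl order_refl] by simp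
  have eq: "u * poly (pCons a P) u - v * poly (pCons a P) v
    = a * (u - v) + (u * poly P u) * (u - v) + v * (u * poly P u - v * poly P v)"
    by (simp add: algebra_simps)
  show ?case
    unfolding eq
    using nrm_mult_le[OF M(1), of "u - v"] nrm_mult_le[OF nrm_mult_le[OF assms(2) Pu], of "u - v"]
      nrm_mult_le[OF assms(3) pCons.IH[OF M(2)]] M0
    by (intro nrm_add_le) auto
qed

text \<open>The Taylor remainder is compared with \<open>nrm (u - v)\<close>; its factor
  \<open>\<delta>\<close> comes from the terms of degree at least 2.\<close>

lemma poly_two_point:
  fixes P :: "'k::nonarch_normed_field poly"
  assumes "\<And>i. nrm (coeff P i) \<le> M" "nrm u \<le> \<delta>" "nrm v \<le> \<delta>" "\<delta> \<le> 1"
  shows "nrm (poly P u - poly P v) \<le> M * nrm (u - v)"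
    and "nrm (poly P u - poly P v - coeff P 1 * (u - v)) \<le> M * \<delta> * nrm (u - v)"
proof -
  obtain a b Q where P: "P = pCons a (pCons b Q)"
    by (metis pCons_cases)
  have M: "nrm (coeff (pCons b Q) i) \<le> M" "nrm (coeff Q i) \<le> M" for i
    using assms(1)[of "Suc i"] assms(1)[of "Suc (Suc i)"] by (simp_all add: P)
  have uv: "nrm u \<le> 1" "nrm v \<le> 1"
    using assms(2-4) by auto
  show "nrm (poly P u - poly P v) \<le> M * nrm (u - v)"
    using poly_two_point_aux[OF M(1) uv] by (simp add: P)
  have Qu: "nrm (poly Q u) \<le> M"
    using nrm_poly_le[OF M(2) uv(1) order_refl order_refl] by simp
  have eq: "poly P u - poly P v - coeff P 1 * (u - v)
    = (u * poly Q u) * (u - v) + v * (u * poly Q u - v * poly Q v)"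
    by (simp add: P algebra_simps)
  show "nrm (poly P u - poly P v - coeff P 1 * (u - v)) \<le> M * \<delta> * nrm (u - v)"
    unfolding eq
    using nrm_mult_le[OF nrm_mult_le[OF assms(2) Qu] order_refl, of "u - v"]
      nrm_mult_le[OF assms(3) poly_two_point_aux[OF M(2) uv]]
    by (intro nrm_add_le) (simp_all add: ac_simps)
qed

text \<open>The numerator of the derivative of \<open>A / B\<close> at 0. For Taylor polynomials at
  \<open>x\<close>, dividing by the square of the denominator at \<open>x\<close> gives the
  derivative of the rational map at \<open>x\<close>.\<close>

definition wronskian0 :: "'k::comm_ring_1 poly \<Rightarrow> 'k poly \<Rightarrow> 'k" where
  "wronskian0 A B = coeff A 1 * coeff B 0 - coeff A 0 * coeff B 1"

text \<open>The non-constant part of \<open>B\<close> is too small to change its norm. In the cross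
  difference, the remainders \<open>E1\<close>, \<open>E2\<close> and the replacement of values at
  \<open>v\<close> by constant terms each cost a factor \<open>\<delta>\<close>.\<close>

lemma quotient_two_point:
  fixes A B :: "'k::nonarch_normed_field poly"
  assumes M: "\<And>i. nrm (coeff A i) \<le> M" "\<And>i. nrm (coeff B i) \<le> M"
    and B0: "M * \<delta> < nrm (coeff B 0)" and \<delta>: "\<delta> \<le> 1" and uv: "nrm u \<le> \<delta>" "nrm v \<le> \<delta>"
  shows "nrm (poly B u) = nrm (coeff B 0)"
    and "nrm ((poly A u * poly B v - poly A v * poly B u) - wronskian0 A B * (u - v))
      \<le> M\<^sup>2 * \<delta> * nrm (u - v)"
proof -
  have d0: "0 \<le> \<delta>" and M0: "0 \<le> M"
    using uv(1) nrm_nonneg[of u] M(1)[of 0] nrm_nonneg[of "coeff A 0"] by linarith+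
  have uv1: "nrm u \<le> 1" "nrm v \<le> 1"
    using uv \<delta> by auto
  have diff0: "nrm (poly P w - coeff P 0) \<le> M * \<delta>"
    if "\<And>i. nrm (coeff P i) \<le> M" "nrm w \<le> \<delta>" for P :: "'k poly" and w
  proof -
    have "nrm (poly P w - coeff P 0) \<le> M * nrm w"
      using poly_two_point(1)[of P M w \<delta> 0] that d0 \<delta> by (simp add: poly_0_coeff_0)
    also have "\<dots> \<le> M * \<delta>"
      using that(2) M0 by (intro mult_left_mono)
    finally show ?thesis .
  qed
  show "nrm (poly B u) = nrm (coeff B 0)"
    using diff0[OF M(2) uv(1)] B0 by (intro nrm_eqI) linarith
  define E1 E2 where "E1 = poly A u - poly A v - coeff A 1 * (u - v)"
    and "E2 = poly B u - poly B v - coeff B 1 * (u - v)"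
  have E: "nrm E1 \<le> M * \<delta> * nrm (u - v)" "nrm E2 \<le> M * \<delta> * nrm (u - v)"
    unfolding E1_def E2_def by (intro poly_two_point(2) M uv \<delta>)+
  have v: "nrm (poly A v) \<le> M" "nrm (poly B v) \<le> M"
    using nrm_poly_le[OF M(1) uv1(2) order_refl order_refl] nrm_poly_le[OF M(2) uv1(2) order_refl order_refl]
    by simp_all
  have eq: "(poly A u * poly B v - poly A v * poly B u) - wronskian0 A B * (u - v)
    = (E1 * poly B v + (coeff A 1 * (poly B v - coeff B 0)) * (u - v))
      - (E2 * poly A v + (coeff B 1 * (poly A v - coeff A 0)) * (u - v))"
    by (simp add: E1_def E2_def wronskian0_def algebra_simps)
  show "nrm ((poly A u * poly B v - poly A v * poly B u) - wronskian0 A B * (u - v))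
      \<le> M\<^sup>2 * \<delta> * nrm (u - v)"
    unfolding eq
    using nrm_mult_le[OF E(1) v(2)] nrm_mult_le[OF E(2) v(1)]
      nrm_mult_le[OF nrm_mult_le[OF M(1) diff0[OF M(2) uv(2)]] order_refl, of 1 "u - v"]
      nrm_mult_le[OF nrm_mult_le[OF M(2) diff0[OF M(1) uv(2)]] order_refl, of 1 "u - v"]
    by (intro nrm_add_le nrm_diff_le) (simp_all add: power2_eq_square ac_simps)
qed

lemma quotient_scaling:
  fixes A B :: "'k::nonarch_normed_field poly"
  assumes M: "\<And>i. nrm (coeff A i) \<le> M" "\<And>i. nrm (coeff B i) \<le> M"
    and B0: "M * \<delta> < nrm (coeff B 0)" and D: "M\<^sup>2 * \<delta> < nrm (wronskian0 A B)"
    and \<delta>: "\<delta> \<le> 1" and uv: "nrm u \<le> \<delta>" "nrm v \<le> \<delta>"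
  shows "nrm (poly A u / poly B u - poly A v / poly B v)
    = nrm (wronskian0 A B) / (nrm (coeff B 0))\<^sup>2 * nrm (u - v)"
proof -
  note qtp = quotient_two_point[OF M B0 \<delta>]
  have "0 \<le> \<delta>" "0 \<le> M"
    using uv(1) nrm_nonneg[of u] M(1)[of 0] nrm_nonneg[of "coeff A 0"] by linarith+
  then have "0 < nrm (coeff B 0)"
    using B0 mult_nonneg_nonneg[of M \<delta>] by linarith
  then have B: "poly B u \<noteq> 0" "poly B v \<noteq> 0"
    using qtp(1)[OF uv] qtp(1)[OF uv(2,1)] by auto
  have "nrm (poly A u * poly B v - poly A v * poly B u) = nrm (wronskian0 A B * (u - v))"
  proof (cases "u = v")
    case False
    then have "M\<^sup>2 * \<delta> * nrm (u - v) < nrm (wronskian0 A B * (u - v))"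
      using D nrm_pos[of "u - v"] by (simp add: nrm_mult)
    then show ?thesis
      using qtp(2)[OF uv] by (intro nrm_eqI) linarith
  qed simp
  moreover have "poly A u / poly B u - poly A v / poly B v
      = (poly A u * poly B v - poly A v * poly B u) / (poly B u * poly B v)"
    using B by (simp add: field_simps)
  ultimately show ?thesis
    using qtp(1)[OF uv] qtp(1)[OF uv(2,1)] by (simp add: nrm_divide nrm_mult power2_eq_square)
qed

text \<open>The linear coefficient of \<open>A - w B\<close> dominates, so its Newton polygon forces a small root.\<close>

lemma quotient_onto:
  fixes A B :: "'k::{nonarch_normed_field,alg_closed_field} poly"
  assumes M: "\<And>i. nrm (coeff A i) \<le> M" "\<And>i. nrm (coeff B i) \<le> M"
    and B0: "M * \<delta> < nrm (coeff B 0)" and D: "(nrm (coeff B 0))\<^sup>2 \<le> nrm (wronskian0 A B)"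
    and \<delta>: "0 < \<delta>" "\<delta> \<le> 1" and w: "nrm (w - coeff A 0 / coeff B 0) \<le> \<delta>"
  shows "\<exists>u. nrm u \<le> \<delta> \<and> poly B u \<noteq> 0 \<and> poly A u / poly B u = w"
proof -
  have M0: "0 \<le> M"
    using M(1)[of 0] nrm_nonneg[of "coeff A 0"] by linarith
  then have B0': "0 < nrm (coeff B 0)"
    using B0 \<delta>(1) mult_nonneg_nonneg[of M \<delta>] by linarith
  then have Bne: "coeff B 0 \<noteq> 0"
    by auto
  define T where "T = A - smult w B"
  \<comment> \<open>The linear coefficient of \<open>A - w B\<close> when \<open>w\<close> is the
    central value \<open>A(0) / B(0)\<close>.\<close>
  define x where "x = wronskian0 A B / coeff B 0"
  have x: "nrm (coeff B 0) \<le> nrm x"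
    using D B0' by (simp add: x_def nrm_divide power2_eq_square field_simps)
  have "coeff T 1 - x = (coeff A 0 / coeff B 0 - w) * coeff B 1"
    using Bne by (simp add: T_def x_def wronskian0_def field_simps)
  then have "nrm (coeff T 1 - x) \<le> \<delta> * M"
    using nrm_mult_le[OF _ M(2)] w nrm_minus_commute by metis
  then have T1: "nrm (coeff T 1) = nrm x"
    using B0 x by (intro nrm_eqI) (simp add: mult.commute)
  have "coeff T 0 = - ((w - coeff A 0 / coeff B 0) * coeff B 0)"
    using Bne by (simp add: T_def field_simps)
  then have "nrm (coeff T 0) \<le> \<delta> * nrm (coeff B 0)"
    using nrm_mult_le[OF w order_refl] by simp
  also have "\<dots> \<le> nrm (coeff T 1) * \<delta>"
    unfolding T1 using x \<delta>(1) by simp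
  finally have "nrm (coeff T 0) \<le> nrm (coeff T (Suc 0)) * \<delta> ^ Suc 0"
    by simp
  moreover have "T \<noteq> 0"
    using T1 x B0' by auto
  ultimately obtain u where u: "nrm u \<le> \<delta>" "poly T u = 0"
    using root_in_disc \<delta>(1) by blast
  have "poly B u \<noteq> 0"
    using quotient_two_point(1)[OF M B0 \<delta>(2) u(1) u(1)] B0' by auto
  then show ?thesis
    using u by (intro exI[of _ u]) (auto simp: T_def field_simps)
qed

lemma quotient_perturbation:
  fixes A B A' B' :: "'k::nonarch_normed_field poly"
  assumes M: "\<And>i. nrm (coeff A i) \<le> M" "\<And>i. nrm (coeff B i) \<le> M"
    and \<eta>: "\<And>i. nrm (coeff A' i - coeff A i) \<le> \<eta>" "\<And>i. nrm (coeff B' i - coeff B i) \<le> \<eta>"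
    and "\<eta> \<le> M" and B0: "\<eta> < nrm (coeff B 0)" and D: "M * \<eta> < nrm (wronskian0 A B)"
  shows "nrm (coeff B' 0) = nrm (coeff B 0)" "nrm (wronskian0 A' B') = nrm (wronskian0 A B)"
    and "nrm (coeff A' 0 / coeff B' 0 - coeff A 0 / coeff B 0) \<le> M * \<eta> / (nrm (coeff B 0))\<^sup>2"
proof -
  show B0': "nrm (coeff B' 0) = nrm (coeff B 0)"
    using \<eta>(2)[of 0] B0 by (intro nrm_eqI) linarith
  have M': "nrm (coeff B' i) \<le> M" for i
    using nrm_add_le[of "coeff B' i - coeff B i" M "coeff B i"] M(2)[of i] \<eta>(2)[of i] \<open>\<eta> \<le> M\<close> by simp
  have "wronskian0 A' B' - wronskian0 A B
    = (coeff B' 0 * (coeff A' 1 - coeff A 1) + coeff A 1 * (coeff B' 0 - coeff B 0))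
      - (coeff B' 1 * (coeff A' 0 - coeff A 0) + coeff A 0 * (coeff B' 1 - coeff B 1))"
    by (simp add: wronskian0_def algebra_simps)
  then have "nrm (wronskian0 A' B' - wronskian0 A B) \<le> M * \<eta>"
    using nrm_mult_le[OF M' \<eta>(1)] nrm_mult_le[OF M(1) \<eta>(2)] by (auto intro!: nrm_add_le nrm_diff_le)
  then show "nrm (wronskian0 A' B') = nrm (wronskian0 A B)"
    using D by (intro nrm_eqI) linarith
  have "0 \<le> \<eta>"
    using \<eta>(1)[of 0] nrm_nonneg[of "coeff A' 0 - coeff A 0"] by linarith
  then have ne: "coeff B 0 \<noteq> 0" "coeff B' 0 \<noteq> 0"
    using B0 B0' by auto
  have "coeff A' 0 / coeff B' 0 - coeff A 0 / coeff B 0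
    = (coeff B 0 * (coeff A' 0 - coeff A 0) - coeff A 0 * (coeff B' 0 - coeff B 0)) / (coeff B' 0 * coeff B 0)"
    using ne by (simp add: field_simps)
  moreover have "nrm (coeff B 0 * (coeff A' 0 - coeff A 0) - coeff A 0 * (coeff B' 0 - coeff B 0)) \<le> M * \<eta>"
    by (intro nrm_diff_le nrm_mult_le M \<eta>)
  ultimately show "nrm (coeff A' 0 / coeff B' 0 - coeff A 0 / coeff B 0) \<le> M * \<eta> / (nrm (coeff B 0))\<^sup>2"
    by (simp add: nrm_divide nrm_mult B0' power2_eq_square divide_right_mono nrm_nonneg)
qed

section \<open>Stability of expansion under perturbation of the coefficients\<close>

text \<open>At a root of norm above 1 the term of degree \<open>d\<close> is balanced by lower ones,
  each at most \<open>K\<close> times the next lower power of \<open>nrm v\<close>.\<close>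

lemma root_bound:
  fixes P :: "'k::nonarch_normed_field poly"
  assumes "poly P v = 0" "degree P \<le> d" "0 < d" "\<And>i. nrm (coeff P i) \<le> K"
    and c: "0 < c" "c \<le> nrm (coeff P d)"
  shows "nrm v \<le> max 1 (K / c)"
proof (cases "nrm v \<le> 1")
  case False
  obtain e where e: "d = Suc e"
    using assms(3) not0_implies_Suc by blast
  have "P \<noteq> 0"
    using c by auto
  then have deg: "degree P = Suc e"
    using c assms(2) le_degree[of P d] e by force
  have K: "0 \<le> K"
    using assms(4)[of 0] nrm_nonneg[of "coeff P 0"] by linarith
  have "coeff P (Suc e) * v ^ Suc e = - (\<Sum>i\<le>e. coeff P i * v ^ i)"
    using assms(1) by (simp add: poly_altdef deg eq_neg_iff_add_eq_0 add.commute)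
  moreover have "nrm (\<Sum>i\<le>e. coeff P i * v ^ i) \<le> K * nrm v ^ e"
  proof (rule nrm_sum_le)
    fix i assume "i \<in> {..e}"
    then have "nrm (v ^ i) \<le> nrm v ^ e"
      using False by (simp add: nrm_power power_increasing)
    then show "nrm (coeff P i * v ^ i) \<le> K * nrm v ^ e"
      by (intro nrm_mult_le assms(4))
  qed (use K in \<open>simp add: nrm_nonneg\<close>)
  ultimately have "nrm (coeff P d) * nrm v * nrm v ^ e \<le> K * nrm v ^ e"
    by (metis e mult.assoc nrm_minus nrm_mult nrm_power power_Suc)
  then have "nrm (coeff P d) * nrm v \<le> K"
    using False by simp
  then have "c * nrm v \<le> K"
    using c(2) False mult_right_mono[of c "nrm (coeff P d)" "nrm v"] by linarith
  then have "nrm v \<le> K / c"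
    using c(1) by (simp add: field_simps)
  then show ?thesis
    by simp
qed simp

text \<open>All later radii depend only on these uniform data. \<open>\<kappa>\<close> keeps
  \<open>J\<close> away from poles, \<open>c\<close> keeps preimages of \<open>J\<close> away from
  infinity, and \<open>L\<close> bounds the derivative with denominators cleared.\<close>

locale expanding_rational_map =
  fixes f :: "'k::{nonarch_normed_field,complete_space,alg_closed_field,field_char_0} proj_line
      \<Rightarrow> 'k proj_line"
    and d :: nat and p q :: "'k poly" and J :: "'k set" and R \<kappa> c M0 L :: real
  assumes rep: "represents d f p q" and d_pos: "0 < d"
    and R: "1 \<le> R" "\<And>x. x \<in> J \<Longrightarrow> nrm x \<le> R"
    and closed: "closed J"
    and J_inv: "\<And>x. x \<in> J \<Longrightarrow> poly p x / poly q x \<in> J"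
    and J_back: "\<And>x y. f (Fin x) = Fin y \<Longrightarrow> y \<in> J \<Longrightarrow> x \<in> J"
    and \<kappa>: "0 < \<kappa>" "\<kappa> \<le> 1" "\<And>x. x \<in> J \<Longrightarrow> \<kappa> \<le> nrm (poly q x)"
    and L: "1 < L" "\<And>x. x \<in> J \<Longrightarrow> L * (nrm (poly q x))\<^sup>2 \<le> nrm (wronskian0 (taylor x p) (taylor x q))"
    and c: "0 < c" "c \<le> 1" "\<And>y. y \<in> J \<Longrightarrow> c \<le> nrm (coeff p d - y * coeff q d)"
    and M0: "1 \<le> M0" "\<And>i. nrm (coeff p i) \<le> M0" "\<And>i. nrm (coeff q i) \<le> M0"
begin

definition m :: "'k \<Rightarrow> real" where
  "m x = nrm (wronskian0 (taylor x p) (taylor x q)) / (nrm (poly q x))\<^sup>2"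

definition M :: real where
  "M = M0 * R ^ d"

text \<open>Chosen so that \<open>M\<^sup>2 * \<delta>0\<close> is half of
  \<open>\<kappa>\<^sup>2\<close>: second-order terms then stay strictly below the Jacobian and the
  denominator.\<close>

definition \<delta>0 :: real where
  "\<delta>0 = \<kappa>\<^sup>2 / (2 * M\<^sup>2)"

text \<open>The bound of \<open>root_bound\<close> for the roots of \<open>p' - w q'\<close>, whose
  coefficients are at most \<open>M0 * R\<close>.\<close>

definition R1 :: real where
  "R1 = M0 * R / c"

text \<open>The second bound makes \<open>p - y q\<close> so small at a \<open>g\<close>-preimage
  that \<open>root_near\<close> finds a root within \<open>\<delta>0\<close>; its factor 2 also
  yields the strict inequality \<open>\<delta> * M0 < c\<close>.\<close>

definition \<delta> :: real where
  "\<delta> = min (\<delta>0 / 2) (c * \<delta>0 ^ d / (2 * M0 * R1 ^ d))"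

text \<open>This absorbs a factor \<open>R ^ d\<close> from \<open>M\<close> and another from
  recentring the coefficient differences, so that values on \<open>J\<close> move by at most
  \<open>\<delta>\<close>.\<close>

definition \<eta> :: real where
  "\<eta> = \<delta> * \<kappa>\<^sup>2 / (M0 * R ^ (2 * d + 1))"

lemma M_ge_1: "1 \<le> M"
  unfolding M_def using mult_mono[of 1 M0 1 "R ^ d"] M0(1) R(1) by simp

lemma \<kappa>2: "0 < \<kappa>\<^sup>2" "\<kappa>\<^sup>2 \<le> \<kappa>"
  using \<kappa>(1,2) mult_left_mono[of \<kappa> 1 \<kappa>] by (simp_all add: power2_eq_square)

lemma \<delta>0: "0 < \<delta>0" "\<delta>0 \<le> 1" "M\<^sup>2 * \<delta>0 < \<kappa>\<^sup>2" "M * \<delta>0 < \<kappa>"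
proof -
  have M2: "1 \<le> M" "M \<le> M\<^sup>2"
    using M_ge_1 mult_left_mono[of 1 M M] by (simp_all add: power2_eq_square)
  show "0 < \<delta>0"
    using M2 \<kappa>2 by (simp add: \<delta>0_def)
  have eq: "M\<^sup>2 * \<delta>0 = \<kappa>\<^sup>2 / 2"
    using M2 by (simp add: \<delta>0_def)
  then show lt: "M\<^sup>2 * \<delta>0 < \<kappa>\<^sup>2"
    using \<kappa>2(1) by linarith
  have "M * \<delta>0 \<le> M\<^sup>2 * \<delta>0"
    using M2 \<open>0 < \<delta>0\<close> by (intro mult_right_mono) auto
  then show "M * \<delta>0 < \<kappa>"
    using lt \<kappa>2 by linarith
  have "1 * \<delta>0 \<le> M * \<delta>0"
    using M2 \<open>0 < \<delta>0\<close> by (intro mult_right_mono) auto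
  then show "\<delta>0 \<le> 1"
    using \<open>M * \<delta>0 < \<kappa>\<close> \<kappa>(2) by linarith
qed

lemma R1: "1 \<le> R1" "R \<le> R1"
proof -
  have "c * R \<le> 1 * R" "1 * R \<le> M0 * R"
    using c(1,2) M0(1) R(1) by (intro mult_right_mono; simp)+
  then show "R \<le> R1"
    using c(1) by (simp add: R1_def field_simps)
  then show "1 \<le> R1"
    using R(1) by simp
qed

lemma \<delta>: "0 < \<delta>" "\<delta> < \<delta>0" "\<delta> \<le> 1" "\<delta> * M0 < c" "\<delta> * M0 * R1 ^ d \<le> c * \<delta>0 ^ d"
proof -
  have R1d: "1 \<le> R1 ^ d"
    using R1 by simp
  show pos: "0 < \<delta>"
    using \<delta>0(1) c(1) M0(1) R1(1) by (simp add: \<delta>_def)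
  show "\<delta> < \<delta>0" "\<delta> \<le> 1"
    using \<delta>0 by (auto simp: \<delta>_def)
  have "\<delta> \<le> c * \<delta>0 ^ d / (2 * M0 * R1 ^ d)"
    by (simp add: \<delta>_def)
  then have le: "\<delta> * M0 * R1 ^ d \<le> c * \<delta>0 ^ d / 2"
    using M0(1) R1d by (simp add: field_simps)
  then show "\<delta> * M0 * R1 ^ d \<le> c * \<delta>0 ^ d"
    using c(1) zero_less_power[OF \<delta>0(1), of d] mult_pos_pos[of c "\<delta>0 ^ d"] by linarith
  have "\<delta> * M0 * 1 \<le> \<delta> * M0 * R1 ^ d"
    using pos M0(1) R1d by (intro mult_left_mono) auto
  moreover have "c * \<delta>0 ^ d \<le> c * 1"
    using c(1) \<delta>0 by (intro mult_left_mono power_le_one) auto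
  ultimately show "\<delta> * M0 < c"
    using le c(1) by linarith
qed

lemma \<eta>: "0 < \<eta>" "R * \<eta> \<le> \<delta>" "\<eta> \<le> \<delta>" "M * (\<eta> * R ^ d) \<le> \<delta> * \<kappa>\<^sup>2" "\<eta> * R ^ d \<le> \<delta> * \<kappa>\<^sup>2"
proof -
  have Rn: "1 \<le> R ^ n" for n
    using R(1) by simp
  show pos: "0 < \<eta>"
    using \<delta>(1) \<kappa>2(1) M0(1) R(1) by (simp add: \<eta>_def)
  have "M * (\<eta> * R ^ d) * R = \<delta> * \<kappa>\<^sup>2"
    using M0(1) R(1) by (simp add: \<eta>_def M_def power_add mult_2)
  moreover have "M * (\<eta> * R ^ d) * 1 \<le> M * (\<eta> * R ^ d) * R"
    using M_ge_1 pos R(1) by (intro mult_left_mono) auto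
  ultimately show M: "M * (\<eta> * R ^ d) \<le> \<delta> * \<kappa>\<^sup>2"
    by simp
  have "1 * (\<eta> * R ^ d) \<le> M * (\<eta> * R ^ d)"
    using M_ge_1 pos R(1) by (intro mult_right_mono) auto
  then show "\<eta> * R ^ d \<le> \<delta> * \<kappa>\<^sup>2"
    using M by simp
  then have "\<eta> * R ^ d \<le> \<delta> * 1"
    using \<kappa>2 \<kappa>(2) \<delta>(1) mult_left_mono[of "\<kappa>\<^sup>2" 1 \<delta>] by linarith
  moreover have "R ^ 1 \<le> R ^ d"
    using R(1) d_pos by (intro power_increasing) auto
  then have "\<eta> * R \<le> \<eta> * R ^ d"
    using pos by simp
  ultimately show "R * \<eta> \<le> \<delta>"
    by (simp add: mult.commute)
  moreover have "1 * \<eta> \<le> R * \<eta>"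
    using R(1) pos by (intro mult_right_mono) auto
  ultimately show "\<eta> \<le> \<delta>"
    by simp
qed

lemma m_ge: "x \<in> J \<Longrightarrow> L \<le> m x"
proof -
  assume x: "x \<in> J"
  have "0 < nrm (poly q x)"
    using \<kappa>(3)[OF x] \<kappa>(1) by linarith
  then show ?thesis
    using L(2)[OF x] by (simp add: m_def field_simps)
qed

lemma coeff_taylor_le_M:
  assumes "x \<in> J"
  shows "nrm (coeff (taylor x p) i) \<le> M" "nrm (coeff (taylor x q) i) \<le> M"
  unfolding M_def using M0 R assms represents_degree_coeff[OF rep] by (blast intro: coeff_taylor_le)+

lemma jacobian_gt: "x \<in> J \<Longrightarrow> (nrm (poly q x))\<^sup>2 < nrm (wronskian0 (taylor x p) (taylor x q))"
proof -
  assume x: "x \<in> J"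
  have "0 < nrm (poly q x)"
    using \<kappa>(3)[OF x] \<kappa>(1) by linarith
  then have "1 * (nrm (poly q x))\<^sup>2 < L * (nrm (poly q x))\<^sup>2"
    using L(1) by (intro mult_strict_right_mono) auto
  then show ?thesis
    using L(2)[OF x] by simp
qed

lemma jacobian_gt_\<kappa>: "x \<in> J \<Longrightarrow> \<kappa>\<^sup>2 < nrm (wronskian0 (taylor x p) (taylor x q))"
  using jacobian_gt[of x] power_mono[OF \<kappa>(3), of x 2] \<kappa>(1) by force

section \<open>Scaling and preimages for a map with coefficients close to those of
  \<open>f\<close>\<close>

context
  fixes g :: "'k proj_line \<Rightarrow> 'k proj_line" and p' q' :: "'k poly"
  assumes rep': "represents d g p' q'"
    and close: "\<And>i. nrm (coeff p' i - coeff p i) \<le> \<eta>" "\<And>i. nrm (coeff q' i - coeff q i) \<le> \<eta>"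
begin

lemma coeff_le_M0': "nrm (coeff p' i) \<le> M0" "nrm (coeff q' i) \<le> M0"
proof -
  have "\<eta> \<le> M0"
    using \<eta>(3) \<delta>(3) M0(1) by linarith
  then show "nrm (coeff p' i) \<le> M0" "nrm (coeff q' i) \<le> M0"
    using nrm_add_le[of "coeff p' i - coeff p i" M0 "coeff p i"] nrm_add_le[of "coeff q' i - coeff q i" M0 "coeff q i"]
      close[of i] M0(2,3)[of i] by force+
qed

lemma coeff_taylor_le_M':
  assumes "x \<in> J"
  shows "nrm (coeff (taylor x p') i) \<le> M" "nrm (coeff (taylor x q') i) \<le> M"
  unfolding M_def using coeff_le_M0' R assms represents_degree_coeff[OF rep'] by (blast intro: coeff_taylor_le)+

lemma taylor_close:
  assumes "x \<in> J"
  shows "nrm (coeff (taylor x p') i - coeff (taylor x p) i) \<le> \<eta> * R ^ d"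
    "nrm (coeff (taylor x q') i - coeff (taylor x q) i) \<le> \<eta> * R ^ d"
  unfolding coeff_diff[symmetric] taylor_diff[symmetric]
  using close R assms represents_degree_coeff[OF rep] represents_degree_coeff[OF rep']
  by (intro coeff_taylor_le; simp add: degree_diff_le)+

lemma perturbation:
  assumes x: "x \<in> J"
  shows "nrm (poly q' x) = nrm (poly q x)"
    "nrm (wronskian0 (taylor x p') (taylor x q')) = nrm (wronskian0 (taylor x p) (taylor x q))"
    "nrm (poly p' x / poly q' x - poly p x / poly q x) \<le> \<delta>"
proof -
  have d\<kappa>: "\<delta> * \<kappa>\<^sup>2 \<le> \<kappa>\<^sup>2" "\<kappa>\<^sup>2 \<le> M"
    using \<delta>(1,3) \<kappa>2 \<kappa>(2) M_ge_1 mult_right_mono[of \<delta> 1 "\<kappa>\<^sup>2"] by auto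
  have lt: "\<delta> * \<kappa>\<^sup>2 < 1 * \<kappa>\<^sup>2"
    using \<delta>(2) \<delta>0(2) \<kappa>2(1) by (intro mult_strict_right_mono) auto
  then have le: "\<eta> * R ^ d \<le> M" "\<eta> * R ^ d < nrm (coeff (taylor x q) 0)"
      "M * (\<eta> * R ^ d) < nrm (wronskian0 (taylor x p) (taylor x q))"
    unfolding coeff_taylor_0 using lt \<eta>(4,5) d\<kappa> \<kappa>2 \<kappa>(3)[OF x] jacobian_gt_\<kappa>[OF x] by linarith+
  note qp = quotient_perturbation[OF coeff_taylor_le_M[OF x] taylor_close[OF x] le]
  show "nrm (poly q' x) = nrm (poly q x)"
    "nrm (wronskian0 (taylor x p') (taylor x q')) = nrm (wronskian0 (taylor x p) (taylor x q))"
    using qp(1,2) by simp_all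
  have "M * (\<eta> * R ^ d) / (nrm (poly q x))\<^sup>2 \<le> (\<delta> * \<kappa>\<^sup>2) / \<kappa>\<^sup>2"
    using \<eta>(4) \<kappa>(1) \<kappa>(3)[OF x] \<delta>(1) by (intro frac_le power_mono) auto
  then show "nrm (poly p' x / poly q' x - poly p x / poly q x) \<le> \<delta>"
    using qp(3) \<kappa>2(1) by simp
qed

text \<open>The larger radius \<open>\<delta>0\<close> matters: \<open>preimage_near\<close> applies
  this before the point is known to be within \<open>\<delta>\<close>.\<close>

lemma scaling:
  assumes x: "x \<in> J" and v: "dist v x \<le> \<delta>0" "dist v' x \<le> \<delta>0"
  shows "poly q' v \<noteq> 0"
    and "dist (poly p' v / poly q' v) (poly p' v' / poly q' v') = m x * dist v v'"
proof -
  have B0: "M * \<delta>0 < nrm (coeff (taylor x q') 0)"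
    using \<delta>0(4) \<kappa>(3)[OF x] perturbation(1)[OF x] by simp
  have D: "M\<^sup>2 * \<delta>0 < nrm (wronskian0 (taylor x p') (taylor x q'))"
    using \<delta>0(3) jacobian_gt_\<kappa>[OF x] perturbation(2)[OF x] by simp
  have uv: "nrm (v - x) \<le> \<delta>0" "nrm (v' - x) \<le> \<delta>0"
    using v by (simp_all add: dist_nrm)
  have "nrm (poly q' v) = nrm (poly q' x)"
    using quotient_two_point(1)[OF coeff_taylor_le_M'[OF x] B0 \<delta>0(2) uv] by simp
  then show "poly q' v \<noteq> 0"
    using perturbation(1)[OF x] \<kappa>(1) \<kappa>(3)[OF x] by auto
  show "dist (poly p' v / poly q' v) (poly p' v' / poly q' v') = m x * dist v v'"
    using quotient_scaling[OF coeff_taylor_le_M'[OF x] B0 D \<delta>0(2) uv]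
    by (simp add: dist_nrm m_def perturbation[OF x])
qed

lemma onto:
  assumes x: "x \<in> J" and w: "dist w (poly p x / poly q x) \<le> \<delta>"
  shows "\<exists>v. dist v x \<le> \<delta> \<and> poly p' v / poly q' v = w"
proof -
  have "M * \<delta> \<le> M * \<delta>0"
    using \<delta>(2) M_ge_1 by (intro mult_left_mono) auto
  then have B0: "M * \<delta> < nrm (coeff (taylor x q') 0)"
    using \<delta>0(4) \<kappa>(3)[OF x] perturbation(1)[OF x] by simp
  \<comment> \<open>The \<open>\<delta>\<close>-balls around the values of \<open>f\<close> and
    \<open>g\<close> at \<open>x\<close> coincide.\<close>
  have "nrm (w - poly p' x / poly q' x) \<le> \<delta>"
    using nrm_diff_le[OF w[unfolded dist_nrm] perturbation(3)[OF x]] by simp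
  then obtain u where "nrm u \<le> \<delta>" "poly p' (x + u) / poly q' (x + u) = w"
    using quotient_onto[OF coeff_taylor_le_M'[OF x] B0 _ \<delta>(1,3), of w] jacobian_gt[OF x] perturbation[OF x]
    by auto
  then show ?thesis
    by (intro exI[of _ "x + u"]) (simp add: dist_nrm)
qed

text \<open>Compares \<open>p' - w q'\<close>, which vanishes at the preimage, with
  \<open>p - y q\<close>: close coefficients and a bounded root force a root of the latter nearby.
  This gives both \<open>gamma_back\<close> and backward invariance of \<open>V\<close> on the whole
  projective line.\<close>

lemma preimage_near:
  assumes y: "y \<in> J" and X: "g X = Fin w" and w: "dist w y \<le> \<delta>"
  shows "\<exists>v. X = Fin v \<and> (\<exists>x\<in>J. poly p x / poly q x = y \<and> dist v x \<le> \<delta>)"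
proof -
  note deg = represents_degree_coeff[OF rep] and deg' = represents_degree_coeff[OF rep']
  have w': "nrm (w - y) \<le> \<delta>"
    using w by (simp add: dist_nrm)
  have wR: "nrm w \<le> R"
    using nrm_add_le[of "w - y" R y] w' \<delta>(3) R(1) R(2)[OF y] by simp
  define C C' where "C = p - smult y q" and "C' = p' - smult w q'"
  have lc: "c \<le> nrm (coeff C d)"
    using c(3)[OF y] by (simp add: C_def)
  have \<delta>M: "\<delta> \<le> \<delta> * M0"
    using mult_left_mono[of 1 M0 \<delta>] \<delta>(1) M0(1) by simp
  have diff: "nrm (coeff (C' - C) i) \<le> \<delta> * M0" for i
  proof -
    have eq: "coeff (C' - C) i = (coeff p' i - coeff p i) - (w * (coeff q' i - coeff q i) + (w - y) * coeff q i)"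
      by (simp add: C_def C'_def algebra_simps)
    have "nrm (w * (coeff q' i - coeff q i)) \<le> R * \<eta>" "nrm ((w - y) * coeff q i) \<le> \<delta> * M0"
      by (intro nrm_mult_le wR close(2) w' M0(3))+
    then show ?thesis
      unfolding eq using close(1)[of i] \<eta>(2,3) \<delta>M by (intro nrm_diff_le[OF _ nrm_add_le]) linarith+
  qed
  have lc': "nrm (coeff C' d) = nrm (coeff C d)"
    using diff[of d] \<delta>(4) lc by (intro nrm_eqI) simp
  \<comment> \<open>\<open>g Infty = Fin w\<close> would make the coefficient of degree
    \<open>d\<close> of \<open>p' - w q'\<close> vanish.\<close>
  have "X \<noteq> Infty"
  proof
    assume "X = Infty"
    then have "coeff C' d = 0"
      using X by (auto simp: represents_Infty[OF rep'] C'_def split: if_splits)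
    then show False
      using lc' lc c(1) by simp
  qed
  then obtain v where v: "X = Fin v"
    by (cases X) auto
  have w_eq: "poly q' v \<noteq> 0" "poly p' v / poly q' v = w"
    using X by (auto simp: v represents_Fin[OF rep'] split: if_splits)
  then have C'v: "poly C' v = 0"
    by (auto simp: C'_def field_simps)
  have degC: "degree C \<le> d" "degree C' \<le> d"
    unfolding C_def C'_def using deg deg' by (auto intro!: degree_diff_le order_trans[OF degree_smult_le])
  have "nrm (coeff C' i) \<le> M0 * R" for i
  proof -
    have "M0 * 1 \<le> M0 * R"
      using M0(1) R(1) by (intro mult_left_mono) auto
    then show ?thesis
      using coeff_le_M0'(1)[of i] nrm_mult_le[OF wR coeff_le_M0'(2)[of i]]
      by (auto simp: C'_def mult.commute intro!: nrm_diff_le)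
  qed
  then have "nrm v \<le> max 1 (M0 * R / c)"
    using root_bound[OF C'v degC(2) d_pos _ c(1)] lc lc' by simp
  then have vR1: "nrm v \<le> R1"
    using R1 by (simp add: R1_def max_def split: if_splits)
  have "nrm (poly (C' - C) v) \<le> (\<delta> * M0) * R1 ^ d"
    using diff vR1 R1(1) degC by (intro nrm_poly_le degree_diff_le)
  also have "\<dots> \<le> c * \<delta>0 ^ d"
    by (rule \<delta>(5))
  also have "\<dots> \<le> nrm (coeff C d) * \<delta>0 ^ d"
    using lc \<delta>0(1) by (intro mult_right_mono) auto
  finally have "nrm (poly C v) \<le> nrm (coeff C d) * \<delta>0 ^ d"
    using C'v by simp
  moreover have "degree C = d"
    using degC(1) le_degree[of C d] lc c(1) by force
  ultimately obtain x where x: "poly C x = 0" "nrm (v - x) \<le> \<delta>0"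
    using root_near[of C v \<delta>0] \<delta>0(1) d_pos by auto
  have "poly q x \<noteq> 0"
    using x(1) coprime_no_common_root[of p q x] rep by (auto simp: C_def represents_def)
  then have fx: "f (Fin x) = Fin y" and \<phi>x: "poly p x / poly q x = y"
    using x(1) by (auto simp: represents_Fin[OF rep] C_def field_simps)
  then have xJ: "x \<in> J"
    using J_back y by blast
  \<comment> \<open>\<open>g\<close> maps both \<open>v\<close> and \<open>x\<close> into the
    \<open>\<delta>\<close>-ball around \<open>y\<close>, so expansion improves the distance bound
    from \<open>\<delta>0\<close> to \<open>\<delta>\<close>.\<close>
  have "dist (poly p' v / poly q' v) (poly p' x / poly q' x) = m x * dist v x"
    using x(2) \<delta>0(1) by (intro scaling xJ) (simp_all add: dist_nrm)
  moreover have "nrm (w - poly p' x / poly q' x) \<le> \<delta>"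
    using nrm_diff_le[OF w' perturbation(3)[OF xJ]] by (simp add: \<phi>x)
  ultimately have "m x * dist v x \<le> \<delta>"
    by (simp add: w_eq dist_nrm)
  moreover have "1 * dist v x \<le> m x * dist v x"
    using m_ge[OF xJ] L(1) by (intro mult_right_mono) auto
  ultimately have "dist v x \<le> \<delta>"
    by simp
  then show ?thesis
    using v xJ \<phi>x by blast
qed

end

lemma expanding_perturbation:
  assumes g: "represents d g p' q'"
    and close: "\<And>i. nrm (coeff p' i - coeff p i) \<le> \<eta>" "\<And>i. nrm (coeff q' i - coeff q i) \<le> \<eta>"
  shows "expanding_perturbation J (\<lambda>x. poly p x / poly q x) (\<lambda>x. poly p' x / poly q' x) m \<delta> L"
proof
  show "dist x z \<le> max (dist x y) (dist y z)" for x y z :: 'k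
    using nrm_add[of "x - y" "y - z"] by (simp add: dist_nrm)
  \<comment> \<open>Stated for any close map so that it also covers \<open>f\<close>, as a
    perturbation of itself.\<close>
  have sc: "scales_near J \<delta> m (\<lambda>x. poly p' x / poly q' x)" if "represents d g p' q'"
    "\<And>i. nrm (coeff p' i - coeff p i) \<le> \<eta>" "\<And>i. nrm (coeff q' i - coeff q i) \<le> \<eta>" for g p' q'
    unfolding scales_near_def using scaling(2)[OF that] \<delta>(2) by auto
  show "scales_near J \<delta> m (\<lambda>x. poly p' x / poly q' x)"
    by (rule sc[OF g close])
  show "scales_near J \<delta> m (\<lambda>x. poly p x / poly q x)"
    using \<eta>(1) by (intro sc[OF rep]) auto
  show "\<exists>v. dist v x \<le> \<delta> \<and> poly p' v / poly q' v = w" if "x \<in> J" "dist w (poly p x / poly q x) \<le> \<delta>" for x w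
    using onto[OF g close that] .
  show "\<exists>x'\<in>J. poly p x' / poly q x' = y \<and> dist v x' \<le> \<delta>"
    if "y \<in> J" "x \<in> J" "dist v x \<le> \<delta>" "dist (poly p' v / poly q' v) y \<le> \<delta>" for x y v
  proof -
    have "g (Fin v) = Fin (poly p' v / poly q' v)"
      using scaling(1)[OF g close that(2), of v v] that(3) \<delta>(2) by (simp add: represents_Fin[OF g])
    then show ?thesis
      using preimage_near[OF g close that(1) _ that(4), of "Fin v"] by auto
  qed
qed (use closed J_inv \<delta> L m_ge in auto)

end

section \<open>The Julia set of a perturbation\<close>

lemma dist_Fin_le: "dist (Fin a) (Fin b) \<le> dist a b" for a b :: "'k::nonarch_normed_field"
  using chordal_chart_le[of "Fin b" "a - b"] by (simp add: dist_proj_line_def dist_nrm chart_def)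

lemma continuous_on_Fin: "continuous_on A (Fin :: 'k::nonarch_normed_field \<Rightarrow> 'k proj_line)"
  unfolding continuous_on_iff by (meson dist_Fin_le le_less_trans)

context expanding_rational_map
begin

context
  fixes g :: "'k proj_line \<Rightarrow> 'k proj_line" and p' q' :: "'k poly"
  assumes rep': "represents d g p' q'"
    and close: "\<And>i. nrm (coeff p' i - coeff p i) \<le> \<eta>" "\<And>i. nrm (coeff q' i - coeff q i) \<le> \<eta>"
    and J_nonempty: "J \<noteq> {}"
    and nontrivial: "\<And>e::real. 0 < e \<Longrightarrow> \<exists>c::'k. c \<noteq> 0 \<and> nrm c < e"
begin

abbreviation "\<phi> \<equiv> \<lambda>x. poly p x / poly q x"
abbreviation "\<gamma> \<equiv> \<lambda>x. poly p' x / poly q' x"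

interpretation ep: expanding_perturbation J \<phi> \<gamma> m \<delta> L
  by (rule expanding_perturbation[OF rep' close])

lemma g_on_V:
  assumes "v \<in> ep.V"
  shows "g (Fin v) = Fin (\<gamma> v)"
proof -
  obtain x where "x \<in> J" "dist v x \<le> \<delta>0"
    using assms \<delta>(2) by (fastforce simp: ep.V_def)
  then have "poly q' v \<noteq> 0"
    using scaling(1)[OF rep' close] by blast
  then show ?thesis
    by (simp add: represents_Fin[OF rep'])
qed

lemma in_V_if_image_in_V: "g X \<in> Fin ` ep.V \<Longrightarrow> X \<in> Fin ` ep.V"
  using preimage_near[OF rep' close] by (fastforce simp: ep.V_def)

lemma V_bounded: "v \<in> ep.V \<Longrightarrow> nrm v \<le> R"
proof -
  assume "v \<in> ep.V"
  then obtain x where x: "x \<in> J" "dist v x \<le> \<delta>"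
    by (auto simp: ep.V_def)
  have "nrm (v - x) \<le> R"
    using x(2) \<delta>(3) R(1) by (simp add: dist_nrm)
  then show ?thesis
    using nrm_add_le[of "v - x" R x] R(2)[OF x(1)] by simp
qed

text \<open>The factor \<open>R\<^sup>2\<close> converts chordal into affine distance;
  \<open>b\<close> then lies in exactly the \<open>\<delta>\<close>-balls needed to follow the same
  centres as \<open>v\<close>.\<close>

lemma near_V:
  assumes "v \<in> ep.V" "chordal (Fin v) y < \<delta> / R\<^sup>2"
  obtains b where "y = Fin b" "\<And>x. dist v x \<le> \<delta> \<Longrightarrow> dist b x \<le> \<delta>" "b \<in> ep.V"
proof -
  have "\<delta> / R\<^sup>2 * R \<le> 1" "\<delta> / R\<^sup>2 * R\<^sup>2 = \<delta>"
    using \<delta>(3) R(1) by (simp_all add: power2_eq_square divide_le_eq)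
  then obtain b where b: "y = Fin b" "nrm (b - v) < \<delta>"
    using chordal_FinD[OF V_bounded[OF assms(1)] R(1) assms(2)] by metis
  have near: "dist b x \<le> \<delta>" if "dist v x \<le> \<delta>" for x
    using ep.dist_le_trans[of b v \<delta> x] b(2) that by (simp add: dist_nrm)
  then have "b \<in> ep.V"
    using assms(1) by (auto simp: ep.V_def)
  with near show thesis
    using that b(1) by blast
qed

text \<open>One chordal radius works at every point of \<open>V\<close>, so by symmetry it works for
  the complement too.\<close>

lemma clopen_V: "open (Fin ` ep.V)" "open (- Fin ` ep.V)"
proof -
  have e: "0 < \<delta> / R\<^sup>2"
    using \<delta>(1) R(1) by simp
  have "y \<in> Fin ` ep.V" if xy: "x \<in> Fin ` ep.V" "dist x y < \<delta> / R\<^sup>2" for x y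
  proof -
    obtain v where v: "x = Fin v" "v \<in> ep.V"
      using xy(1) by blast
    show ?thesis
      by (rule near_V[OF v(2), of y]) (use xy(2) v(1) in \<open>auto simp: dist_proj_line_def\<close>)
  qed
  then show "open (Fin ` ep.V)" "open (- Fin ` ep.V)"
    using e unfolding open_dist by (metis dist_commute Compl_iff)+
qed

lemma iterate_g:
  assumes "\<And>k. k < n \<Longrightarrow> (\<gamma> ^^ k) w \<in> ep.V"
  shows "(g ^^ n) (Fin w) = Fin ((\<gamma> ^^ n) w)"
  using assms by (induction n) (auto simp: g_on_V)

lemma image_Lam: "Fin ` ep.Lam = {X. \<forall>n. (g ^^ n) X \<in> Fin ` ep.V}"
proof (intro equalityI subsetI)
  fix X assume "X \<in> Fin ` ep.Lam"
  then obtain w where w: "X = Fin w" "\<And>n. (\<gamma> ^^ n) w \<in> ep.V"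
    by (auto simp: ep.Lam_def)
  then have "(g ^^ n) X = Fin ((\<gamma> ^^ n) w)" for n
    unfolding w(1) by (intro iterate_g)
  then show "X \<in> {X. \<forall>n. (g ^^ n) X \<in> Fin ` ep.V}"
    using w(2) by blast
next
  fix X assume "X \<in> {X. \<forall>n. (g ^^ n) X \<in> Fin ` ep.V}"
  then have X: "(g ^^ n) X \<in> Fin ` ep.V" for n
    by blast
  obtain w where w: "X = Fin w"
    using X[of 0] by auto
  have "(\<gamma> ^^ n) w \<in> ep.V" for n
  proof (induction n rule: less_induct)
    case (less n)
    then have "(g ^^ n) X = Fin ((\<gamma> ^^ n) w)"
      unfolding w by (rule iterate_g)
    then show ?case
      using X[of n] by auto
  qed
  then show "X \<in> Fin ` ep.Lam"
    by (auto simp: w ep.Lam_def)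
qed

lemma julia_perturbation: "julia g = Fin ` ep.Lam"
proof -
  obtain a where a: "a \<in> ep.Lam"
    using ep.conjugacy J_nonempty by (metis image_is_empty ex_in_conv)
  have "X \<in> fatou g" if X: "X \<notin> Fin ` ep.Lam" for X
  proof -
    obtain n where n: "(g ^^ n) X \<notin> Fin ` ep.V"
      using X unfolding image_Lam by blast
    \<comment> \<open>\<open>W\<close> contains \<open>X\<close> and is forward invariant because
      \<open>V\<close> is backward invariant. It misses a disc around \<open>a\<close>, on which the
      iterate of order \<open>n\<close> stays in \<open>V\<close>.\<close>
    define W where "W = (g ^^ n) -` (- Fin ` ep.V)"
    have "open ((g ^^ n) -` (Fin ` ep.V))" and openW: "open W"
      unfolding W_def by (intro open_vimage clopen_V continuous_on_iterate[OF rep'])+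
    moreover have "Fin a \<in> (g ^^ n) -` (Fin ` ep.V)"
      using a image_Lam by blast
    ultimately obtain r where r: "0 < r" "\<And>z. nrm z < r \<Longrightarrow> chart (Fin a) z \<in> (g ^^ n) -` (Fin ` ep.V)"
      using open_chartE by blast
    have "W \<subseteq> fatou g"
    proof (rule subset_fatou_if_omits_disc[OF rep' nontrivial openW _ r(1)])
      show "g x \<in> W" if "x \<in> W" for x
        using that in_V_if_image_in_V[of "(g ^^ n) x"] unfolding W_def vimage_Compl Compl_iff vimage_eq
        by (metis funpow_swap1)
      show "Fin b \<notin> W" if "nrm (b - a) < r" for b
        using r(2)[OF that] by (simp add: W_def chart_def)
    qed
    then show ?thesis
      using n by (auto simp: W_def)
  qed
  \<comment> \<open>Equicontinuity would keep the orbit of a second point \<open>w'\<close> in the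
    same balls as that of \<open>w\<close>, and expansion would force \<open>w' = w\<close>.\<close>
  moreover have "Fin w \<notin> fatou g" if w: "w \<in> ep.Lam" for w
  proof
    assume fat: "Fin w \<in> fatou g"
    have e: "0 < \<delta> / R\<^sup>2"
      using \<delta>(1) R(1) by simp
    obtain r where r: "0 < r" "\<And>y k. y \<in> fatou g \<Longrightarrow> dist y (Fin w) < r \<Longrightarrow>
        dist ((g ^^ k) y) ((g ^^ k) (Fin w)) < \<delta> / R\<^sup>2"
      using equicontinuous_iterates_on_fatou[of g] fat e
      unfolding equicontinuous_iterates_on_def by metis
    have "open (fatou g \<inter> ball (Fin w) r)" "Fin w \<in> fatou g \<inter> ball (Fin w) r"
      using open_fatou fat r(1) by auto
    then obtain r' where r': "0 < r'" "\<And>z. nrm z < r' \<Longrightarrow> chart (Fin w) z \<in> fatou g \<inter> ball (Fin w) r"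
      by (rule open_chartE) blast
    obtain z :: 'k where z: "z \<noteq> 0" "nrm z < r'"
      using nontrivial[OF r'(1)] by blast
    define w' where "w' = w + z"
    have wV: "(\<gamma> ^^ k) w \<in> ep.V" for k
      using w by (simp add: ep.Lam_def)
    have w': "Fin w' \<in> fatou g" "dist (Fin w') (Fin w) < r"
      using r'(2)[OF z(2)] by (simp_all add: w'_def chart_def dist_commute)
    have d: "chordal (Fin ((\<gamma> ^^ k) w)) ((g ^^ k) (Fin w')) < \<delta> / R\<^sup>2" for k
      using r(2)[OF w', of k] iterate_g[OF wV, of k] by (simp add: dist_proj_line_def chordal_commute)
    have w'V: "(\<gamma> ^^ k) w' \<in> ep.V" for k
    proof (induction k rule: less_induct)
      case (less k)
      then have "(g ^^ k) (Fin w') = Fin ((\<gamma> ^^ k) w')"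
        by (rule iterate_g)
      then show ?case
        using near_V[OF wV d[of k]] by (metis proj_line.inject)
    qed
    obtain x where x: "\<And>k. x k \<in> J" "\<And>k. dist ((\<gamma> ^^ k) w) (x k) \<le> \<delta>"
      using wV unfolding ep.V_def mem_Collect_eq by metis
    have "dist ((\<gamma> ^^ k) w') (x k) \<le> \<delta>" for k
      using near_V[OF wV d[of k]] x(2)[of k] iterate_g[OF w'V, of k] by (metis proj_line.inject)
    then have "w = w'"
      using ep.eq_if_orbits_close[where x = x, OF ep.gamma_scales x] by blast
    then show False
      using z(1) by (simp add: w'_def)
  qed
  ultimately show ?thesis
    by (auto simp: julia_def)
qed

lemma conjugate_perturbation:
  "\<exists>h h'. homeomorphism (Fin ` J) (julia g) h h' \<and> (\<forall>z\<in>Fin ` J. h (f z) = g (h z))"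
proof -
  obtain h where h: "h ` J = ep.Lam" "\<And>z z'. z \<in> J \<Longrightarrow> z' \<in> J \<Longrightarrow> dist (h z) (h z') = dist z z'"
    "\<And>z. z \<in> J \<Longrightarrow> dist (h z) z \<le> \<delta>" "\<And>z. z \<in> J \<Longrightarrow> h (\<phi> z) = \<gamma> (h z)"
    by (rule ep.conjugacy) blast
  define H where "H X = (case X of Fin z \<Rightarrow> Fin (h z) | Infty \<Rightarrow> Infty)" for X
  \<comment> \<open>As \<open>h\<close> moves points by at most 1, it preserves the chordal
    denominators, so the affine isometry is a chordal one.\<close>
  have max_h: "max 1 (nrm (h z)) = max 1 (nrm z)" if "z \<in> J" for z
  proof -
    have "nrm (h z - z) \<le> 1" "nrm (z - h z) \<le> 1"
      using h(3)[OF that] \<delta>(3) nrm_minus_commute[of z "h z"] by (auto simp: dist_nrm)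
    then show ?thesis
      using nrm_add[of "h z - z" z] nrm_add[of "z - h z" "h z"] by (auto simp: max_def split: if_splits)
  qed
  have iso: "dist (H X) (H Y) = dist X Y" if "X \<in> Fin ` J" "Y \<in> Fin ` J" for X Y
    using that h(2) by (auto simp: H_def dist_proj_line_def max_h dist_nrm)
  then have inj: "inj_on H (Fin ` J)"
    by (intro inj_onI) (metis dist_eq_0_iff)
  have im: "H ` Fin ` J = julia g"
    unfolding julia_perturbation h(1)[symmetric] by (simp add: H_def image_image)
  let ?H' = "inv_into (Fin ` J) H"
  have iso': "dist (?H' X) (?H' Y) = dist X Y" if "X \<in> julia g" "Y \<in> julia g" for X Y
    using that iso[of "?H' X" "?H' Y"] unfolding im[symmetric] by (simp add: inv_into_into f_inv_into_f)
  have "homeomorphism (Fin ` J) (julia g) H ?H'"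
    unfolding homeomorphism_def
  proof (intro conjI ballI)
    show "continuous_on (Fin ` J) H"
      unfolding continuous_on_iff using iso by metis
    show "continuous_on (julia g) ?H'"
      unfolding continuous_on_iff using iso' by metis
    show "?H' ` julia g = Fin ` J"
      unfolding im[symmetric] using inj by (simp add: inv_into_image_cancel)
    show "H ` Fin ` J = julia g"
      by (rule im)
    show "?H' (H x) = x" if "x \<in> Fin ` J" for x
      using inj that by (rule inv_into_f_f)
    show "H (?H' y) = y" if "y \<in> julia g" for y
      using that unfolding im[symmetric] by (rule f_inv_into_f)
  qed
  moreover have "H (f z) = g (H z)" if z: "z \<in> Fin ` J" for z
  proof -
    obtain x where x: "z = Fin x" "x \<in> J"
      using z by blast
    have "poly q x \<noteq> 0"
      using \<kappa>(1) \<kappa>(3)[OF x(2)] by auto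
    then have "f z = Fin (\<phi> x)"
      by (simp add: x represents_Fin[OF rep])
    moreover have "h x \<in> ep.Lam"
      using h(1) x(2) by blast
    then have "h x \<in> ep.V"
      unfolding ep.Lam_def mem_Collect_eq by (metis funpow_0)
    ultimately show ?thesis
      using h(4)[OF x(2)] by (simp add: H_def x g_on_V)
  qed
  ultimately show ?thesis
    by blast
qed

end

end

section \<open>Immediately expanding maps\<close>

text \<open>Powers of \<open>1 / D\<close> tend to 0, so an expanding derivative excludes the
  trivial norm.\<close>

lemma nontrivial_norm_if_gt_1:
  fixes D :: "'k::nonarch_normed_field"
  assumes "1 < nrm D" "0 < e"
  shows "\<exists>c::'k. c \<noteq> 0 \<and> nrm c < e"
proof -
  have "1 / nrm D < 1"
    using assms(1) by simp
  then obtain n where "(1 / nrm D) ^ n < e"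
    using real_arch_pow_inv[OF assms(2)] by blast
  moreover have "D \<noteq> 0"
    using assms(1) by auto
  ultimately show ?thesis
    by (intro exI[of _ "(1 / D) ^ n"]) (simp add: nrm_power nrm_divide)
qed

lemma has_derivative_at_Fin: "has_derivative_at f z D \<Longrightarrow> \<exists>y. f (Fin z) = Fin y"
  unfolding has_derivative_at_def by (elim exE conjE) (drule eventually_nhds_x_imp_x, blast)

text \<open>A single small displacement \<open>u\<close> suffices: difference quotients near
  \<open>z\<close> have norm exactly \<open>nrm D\<close>, and the two-point estimate identifies
  their numerator with the Wronskian times \<open>u\<close> up to a smaller error.\<close>

lemma nrm_derivative_le:
  fixes f :: "'k::nonarch_normed_field proj_line \<Rightarrow> 'k proj_line"
  assumes rep: "represents d f p q" and der: "has_derivative_at f z D" and D: "1 < nrm D"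
  shows "nrm D * (nrm (poly q z))\<^sup>2 \<le> nrm (wronskian0 (taylor z p) (taylor z q))"
proof -
  obtain \<phi> where \<phi>: "\<forall>\<^sub>F w in nhds z. f (Fin w) = Fin (\<phi> w)"
      "((\<lambda>w. (\<phi> w - \<phi> z) / (w - z)) \<longlongrightarrow> D) (at z)"
    using der unfolding has_derivative_at_def by blast
  have \<phi>_eq: "poly q w \<noteq> 0 \<and> \<phi> w = poly p w / poly q w" if "f (Fin w) = Fin (\<phi> w)" for w
    using that represents_Fin[OF rep, of w] by (simp split: if_splits)
  have "f (Fin z) = Fin (\<phi> z)"
    using \<phi>(1) by (rule eventually_nhds_x_imp_x)
  then have q0: "poly q z \<noteq> 0" and \<phi>z: "\<phi> z = poly p z / poly q z"
    using \<phi>_eq by blast+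
  have "\<forall>\<^sub>F w in nhds z. \<phi> w = poly p w / poly q w"
    using \<phi>(1) by eventually_elim (use \<phi>_eq in blast)
  then obtain r1 where r1: "0 < r1" "\<And>w. dist w z < r1 \<Longrightarrow> \<phi> w = poly p w / poly q w"
    unfolding eventually_nhds_metric by blast
  have "\<forall>\<^sub>F w in at z. dist ((\<phi> w - \<phi> z) / (w - z)) D < nrm D"
    using \<phi>(2) D by (intro tendstoD) auto
  then have "\<forall>\<^sub>F w in at z. nrm ((\<phi> w - \<phi> z) / (w - z)) = nrm D"
    by eventually_elim (rule nrm_eqI, simp only: dist_nrm)
  then obtain r2 where r2: "0 < r2" "\<And>w. w \<noteq> z \<Longrightarrow> dist w z < r2 \<Longrightarrow> nrm ((\<phi> w - \<phi> z) / (w - z)) = nrm D"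
    unfolding eventually_at by blast
  obtain M1 M2 where M12: "1 \<le> M1" "1 \<le> M2" "\<And>i. nrm (coeff (taylor z p) i) \<le> M1" "\<And>i. nrm (coeff (taylor z q) i) \<le> M2"
    using coeff_bound by metis
  define M where "M = max M1 M2"
  have M: "1 \<le> M" "\<And>i. nrm (coeff (taylor z p) i) \<le> M" "\<And>i. nrm (coeff (taylor z q) i) \<le> M"
    unfolding M_def using M12 by (simp_all only: le_max_iff_disj) blast+
  define Q where "Q = nrm (poly q z)"
  have Q: "0 < Q"
    using q0 by (simp add: Q_def nrm_pos)
  \<comment> \<open>\<open>r1\<close> gives the quotient formula, \<open>r2\<close> the norm of the
    difference quotient, \<open>Q / M\<close> a constant norm of \<open>q\<close>, and the last
    bound makes the remainder smaller than the numerator.\<close>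
  define \<epsilon>0 where "\<epsilon>0 = min (min 1 (min r1 r2)) (min (Q / M) (nrm D * Q\<^sup>2 / M\<^sup>2))"
  define \<epsilon> where "\<epsilon> = \<epsilon>0 / 2"
  have "0 < \<epsilon>0"
    using r1(1) r2(1) Q M(1) D by (simp add: \<epsilon>0_def)
  moreover have "\<epsilon>0 \<le> 1" "\<epsilon>0 \<le> r1" "\<epsilon>0 \<le> r2" "\<epsilon>0 \<le> Q / M" "\<epsilon>0 \<le> nrm D * Q\<^sup>2 / M\<^sup>2"
    unfolding \<epsilon>0_def by (simp_all only: min_le_iff_disj order_refl simp_thms)
  ultimately have \<epsilon>: "0 < \<epsilon>" "\<epsilon> < 1" "\<epsilon> < r1" "\<epsilon> < r2" "\<epsilon> < Q / M" "\<epsilon> < nrm D * Q\<^sup>2 / M\<^sup>2"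
    unfolding \<epsilon>_def by linarith+
  have \<epsilon>M: "M * \<epsilon> < nrm (coeff (taylor z q) 0)" "M\<^sup>2 * \<epsilon> < nrm D * Q\<^sup>2"
  proof -
    have "0 < M" "0 < M\<^sup>2"
      using M(1) by simp_all
    then show "M * \<epsilon> < nrm (coeff (taylor z q) 0)" "M\<^sup>2 * \<epsilon> < nrm D * Q\<^sup>2"
      using \<epsilon>(5,6) unfolding coeff_taylor_0 Q_def[symmetric]
      by (simp_all only: pos_less_divide_eq mult.commute)
  qed
  obtain u :: 'k where u: "u \<noteq> 0" "nrm u < \<epsilon>"
    using nontrivial_norm_if_gt_1[OF D \<epsilon>(1)] by blast
  have le: "nrm u \<le> \<epsilon>" "nrm (0::'k) \<le> \<epsilon>" "\<epsilon> \<le> 1"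
    using u(2) \<epsilon>(1,2) unfolding nrm_0 by linarith+
  let ?N = "poly p (z + u) * poly q z - poly p z * poly q (z + u)"
  let ?W = "wronskian0 (taylor z p) (taylor z q)"
  have qu: "nrm (poly q (z + u)) = Q"
    using quotient_two_point(1)[OF M(2,3) \<epsilon>M(1) le(3,1,2)] by (simp add: Q_def)
  then have qu0: "poly q (z + u) \<noteq> 0"
    using Q by auto
  have "nrm (\<phi> (z + u) - \<phi> z) = nrm D * nrm u"
  proof -
    have "nrm (\<phi> (z + u) - \<phi> z) / nrm u = nrm D"
      using r2(2)[of "z + u"] u \<epsilon>(4) by (simp add: dist_nrm nrm_divide)
    then show ?thesis
      using nrm_pos[OF u(1)] by (simp add: divide_eq_eq)
  qed
  moreover have "\<phi> (z + u) - \<phi> z = ?N / (poly q (z + u) * poly q z)"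
    using r1(2)[of "z + u"] u \<epsilon>(3) qu0 q0 by (simp add: dist_nrm \<phi>z field_simps)
  ultimately have N: "nrm ?N = nrm D * Q\<^sup>2 * nrm u"
  proof -
    assume "nrm (\<phi> (z + u) - \<phi> z) = nrm D * nrm u"
      "\<phi> (z + u) - \<phi> z = ?N / (poly q (z + u) * poly q z)"
    then have "nrm ?N / (Q * Q) = nrm D * nrm u"
      by (simp only: nrm_divide nrm_mult qu Q_def[symmetric])
    then show ?thesis
      using Q by (simp add: divide_eq_eq power2_eq_square)
  qed
  have "nrm (?N - ?W * u) \<le> M\<^sup>2 * \<epsilon> * nrm u"
    using quotient_two_point(2)[OF M(2,3) \<epsilon>M(1) le(3,1,2)] by simp
  also have "\<dots> < nrm ?N"
    unfolding N using \<epsilon>M(2) nrm_pos[OF u(1)] by (intro mult_strict_right_mono)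
  finally have "nrm (?W * u) = nrm ?N"
    by (intro nrm_eqI) (simp only: nrm_minus_commute[of "?W * u"])
  then show ?thesis
    using N nrm_pos[OF u(1)] by (simp add: nrm_mult Q_def)
qed

lemma expanding_rational_map_julia:
  fixes f :: "'k::{nonarch_normed_field,complete_space,alg_closed_field,field_char_0} proj_line
      \<Rightarrow> 'k proj_line"
  assumes rep: "represents d f p q" and d: "0 < d" and exp: "immediately_expanding f"
    and inf: "Infty \<notin> julia f"
  shows "\<exists>R \<kappa> c M0 L. expanding_rational_map f d p q {z. Fin z \<in> julia f} R \<kappa> c M0 L"
proof -
  define J where "J = {z. Fin z \<in> julia f}"
  have J: "z \<in> J \<longleftrightarrow> Fin z \<notin> fatou f" for z
    by (simp add: J_def julia_def)
  have inf': "Infty \<in> fatou f"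
    using inf by (simp add: julia_def)
  obtain L where L: "1 < L" "\<And>x. x \<in> julia f \<Longrightarrow> \<exists>z D. x = Fin z \<and> has_derivative_at f z D \<and> L \<le> nrm D"
    using exp unfolding immediately_expanding_def by blast
  have der: "\<exists>D. has_derivative_at f z D \<and> L \<le> nrm D" if "z \<in> J" for z
    using L(2)[of "Fin z"] that by (auto simp: J_def)
  obtain r where r: "0 < r" "\<And>y. dist y Infty < r \<Longrightarrow> y \<in> fatou f"
    using open_fatou inf' unfolding open_dist by blast
  define R where "R = max 1 (1 / r)"
  have R1: "1 \<le> R"
    by (simp add: R_def)
  have R: "nrm x \<le> R" if "x \<in> J" for x
  proof -
    have "r \<le> 1 / max 1 (nrm x)"
      using r(2)[of "Fin x"] that by (force simp: J dist_proj_line_def)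
    moreover have "0 < max 1 (nrm x)"
      by simp
    ultimately have "max 1 (nrm x) \<le> 1 / r"
      using r(1) by (simp only: pos_le_divide_eq mult.commute)
    then show "nrm x \<le> R"
      by (simp add: R_def)
  qed
  have fJ: "\<exists>y\<in>J. f (Fin x) = Fin y" if x: "x \<in> J" for x
  proof -
    obtain y where y: "f (Fin x) = Fin y"
      using der[OF x] has_derivative_at_Fin by blast
    moreover have "y \<in> J"
      using fatou_if_image_in_fatou[OF rep, of "Fin x"] x by (auto simp: J y)
    ultimately show ?thesis by blast
  qed
  have qJ: "poly q x \<noteq> 0" "poly p x / poly q x \<in> J" if "x \<in> J" for x
    using fJ[OF that] by (auto simp: represents_Fin[OF rep] split: if_splits)
  \<comment> \<open>On \<open>J\<close> the quotient \<open>p / q\<close> is bounded by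
    \<open>R\<close>, so evaluating this identity bounds \<open>q\<close> below.\<close>
  obtain s t where st: "s * p + t * q = 1"
    using coprime_poly_bezout rep unfolding represents_def by blast
  obtain M1 M2 where M12: "1 \<le> M1" "1 \<le> M2" "\<And>i. nrm (coeff s i) \<le> M1" "\<And>i. nrm (coeff t i) \<le> M2"
    using coeff_bound by metis
  define C where "C = max (M1 * R ^ degree s) (M2 * R ^ degree t)"
  have C: "1 \<le> C"
    using mult_mono[of 1 M1 1 "R ^ degree s"] M12(1) R1 by (simp add: C_def le_max_iff_disj)
  have \<kappa>: "1 / (C * R) \<le> nrm (poly q x)" if x: "x \<in> J" for x
  proof -
    have "nrm (poly s x) \<le> C" "nrm (poly t x) \<le> C"
      using nrm_poly_le[OF M12(3) R[OF x] R1 order_refl] nrm_poly_le[OF M12(4) R[OF x] R1 order_refl]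
      by (auto simp: C_def le_max_iff_disj)
    moreover have "nrm (poly p x / poly q x) \<le> R"
      using qJ(2)[OF x] R by blast
    then have "nrm (poly p x) \<le> R * nrm (poly q x)"
      using nrm_pos[OF qJ(1)[OF x]] by (simp add: nrm_divide field_simps)
    moreover have "1 * nrm (poly q x) \<le> R * nrm (poly q x)"
      using R1 by (intro mult_right_mono nrm_nonneg)
    ultimately have "nrm (poly s x * poly p x + poly t x * poly q x) \<le> C * (R * nrm (poly q x))"
      by (intro nrm_add_le nrm_mult_le) simp_all
    moreover have "poly s x * poly p x + poly t x * poly q x = 1"
      using arg_cong[OF st, of "\<lambda>P. poly P x"] by simp
    ultimately show ?thesis
      using C R1 by (simp add: field_simps)
  qed
  \<comment> \<open>If \<open>coeff q d\<close> is zero, the quantity does not depend on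
    \<open>y\<close>. Otherwise it is \<open>(b - y) * coeff q d\<close> with \<open>Fin b\<close>
    the image of infinity, and a disc around the Fatou point \<open>b\<close> misses
    \<open>J\<close>.\<close>
  obtain c where c: "0 < c" "\<And>y. y \<in> J \<Longrightarrow> c \<le> nrm (coeff p d - y * coeff q d)"
  proof (cases "coeff q d = 0")
    case True
    then show thesis
      using that[of "nrm (coeff p d)"] represents_degree_coeff(1)[OF rep] by (simp add: nrm_pos)
  next
    case False
    define b where "b = coeff p d / coeff q d"
    have "f Infty = Fin b"
      using False by (simp add: represents_Infty[OF rep] b_def)
    then have "Fin b \<in> fatou f"
      using image_in_fatou[OF rep d inf'] by blast
    then obtain s where s: "0 < s" "\<And>z. nrm z < s \<Longrightarrow> chart (Fin b) z \<in> fatou f"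
      using open_chartE[OF open_fatou] by blast
    show thesis
    proof (rule that[of "s * nrm (coeff q d)"])
      show "0 < s * nrm (coeff q d)"
        using s(1) False by (simp add: nrm_pos)
      fix y assume "y \<in> J"
      then have "s \<le> nrm (y - b)"
        using s(2)[of "y - b"] by (force simp: J chart_def)
      then have "s * nrm (coeff q d) \<le> nrm ((b - y) * coeff q d)"
        by (simp add: nrm_mult nrm_minus_commute mult_right_mono nrm_nonneg)
      also have "(b - y) * coeff q d = coeff p d - y * coeff q d"
        using False by (simp add: b_def algebra_simps)
      finally show "s * nrm (coeff q d) \<le> nrm (coeff p d - y * coeff q d)" .
    qed
  qed
  obtain N1 N2 where N12: "1 \<le> N1" "1 \<le> N2" "\<And>i. nrm (coeff p i) \<le> N1" "\<And>i. nrm (coeff q i) \<le> N2"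
    using coeff_bound by metis
  have "expanding_rational_map f d p q J R (1 / (C * R)) (min 1 c) (max N1 N2) L"
  proof
    have "J = Fin -` julia f"
      by (auto simp: J_def)
    moreover have "closed (julia f)"
      using open_fatou[of f] by (simp add: julia_def closed_def Compl_eq_Diff_UNIV double_diff)
    ultimately show "closed J"
      using closed_vimage[OF _ continuous_on_Fin] by simp
    show "x \<in> J" if "f (Fin x) = Fin y" "y \<in> J" for x y
      using image_in_fatou[OF rep d _ that(1)] that(2) by (auto simp: J)
    have "1 \<le> C * R"
      using mult_mono[of 1 C 1 R] C R1 by simp
    then show "0 < 1 / (C * R)" "1 / (C * R) \<le> 1"
      by simp_all
    show "L * (nrm (poly q x))\<^sup>2 \<le> nrm (wronskian0 (taylor x p) (taylor x q))" if x: "x \<in> J" for x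
    proof -
      obtain D where D: "has_derivative_at f x D" "L \<le> nrm D"
        using der[OF x] by blast
      have "L * (nrm (poly q x))\<^sup>2 \<le> nrm D * (nrm (poly q x))\<^sup>2"
        using D(2) by (intro mult_right_mono) auto
      then show ?thesis
        using nrm_derivative_le[OF rep D(1)] D(2) L(1) by linarith
    qed
    show "nrm (coeff p i) \<le> max N1 N2" "nrm (coeff q i) \<le> max N1 N2" for i
      using N12(3,4)[of i] by linarith+
    show "1 \<le> max N1 N2" "0 < min 1 c" "min 1 c \<le> 1"
      using N12(1) c(1) by auto
    show "min 1 c \<le> nrm (coeff p d - y * coeff q d)" if "y \<in> J" for y
      using c(2)[OF that] by linarith
  qed (fact rep d R1 R \<kappa> qJ(2) L(1))+
  then show ?thesis
    unfolding J_def by blast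
qed

section \<open>Neighbourhoods in the space of rational maps\<close>

definition coeff_box :: "nat \<Rightarrow> (nat \<Rightarrow> 'k::nonarch_normed_field) \<Rightarrow> real \<Rightarrow> (nat \<Rightarrow> 'k) set" where
  "coeff_box n v0 \<eta> = {v \<in> nonzero_vectors n. \<forall>i\<le>n. nrm (v i - v0 i) < \<eta>}"

lemma mem_proj_point_self:
  fixes v :: "nat \<Rightarrow> 'k::field"
  assumes "v \<in> nonzero_vectors n"
  shows "v \<in> proj_point n v"
proof -
  have "v = (\<lambda>i\<in>{..n}. 1 * v i)"
    using assms by (auto simp: nonzero_vectors_def fun_eq_iff extensional_def)
  then have "v = (\<lambda>i\<in>{..n}. 1 * v i) \<and> 1 \<noteq> (0::'k)"
    by (rule conjI) (rule one_neq_zero)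
  then show ?thesis
    unfolding proj_point_def by blast
qed

lemma proj_point_scale:
  fixes v :: "nat \<Rightarrow> 'k::field"
  assumes "c \<noteq> 0"
  shows "proj_point n (\<lambda>i\<in>{..n}. c * v i) = proj_point n v"
proof (intro equalityI subsetI)
  fix x assume "x \<in> proj_point n (\<lambda>i\<in>{..n}. c * v i)"
  then obtain b where "b \<noteq> 0" "x = (\<lambda>i\<in>{..n}. b * (\<lambda>i\<in>{..n}. c * v i) i)"
    unfolding proj_point_def by blast
  then have "b * c \<noteq> 0" "x = (\<lambda>i\<in>{..n}. (b * c) * v i)"
    using assms by (auto simp: fun_eq_iff)
  then show "x \<in> proj_point n v"
    unfolding proj_point_def by blast
next
  fix x assume "x \<in> proj_point n v"
  then obtain b where "b \<noteq> 0" "x = (\<lambda>i\<in>{..n}. b * v i)"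
    unfolding proj_point_def by blast
  then have "b / c \<noteq> 0" "x = (\<lambda>i\<in>{..n}. (b / c) * (\<lambda>i\<in>{..n}. c * v i) i)"
    using assms by (auto simp: fun_eq_iff)
  then show "x \<in> proj_point n (\<lambda>i\<in>{..n}. c * v i)"
    unfolding proj_point_def by blast
qed

text \<open>The vectors whose class meets the box form the union, over nonzero scalars
  \<open>c\<close>, of boxes rescaled by \<open>c\<close>, and each of these is open in the
  product.\<close>

lemma openin_proj_coeff_box:
  fixes v0 :: "nat \<Rightarrow> 'k::nonarch_normed_field"
  shows "openin (proj_space_topology n) (proj_point n ` coeff_box n v0 \<eta>)"
  unfolding openin_proj_space_topology
proof
  show "proj_point n ` coeff_box n v0 \<eta> \<subseteq> proj_space n"
    by (auto simp: coeff_box_def proj_space_def)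
  define B where "B c = PiE {..n} (\<lambda>i. {x. nrm (c * x - v0 i) < \<eta>})" for c
  have op: "open {x. nrm (c * x - a) < \<eta>}" if "c \<noteq> 0" for c a :: 'k
    unfolding open_dist
  proof (intro ballI)
    fix x assume x: "x \<in> {x. nrm (c * x - a) < \<eta>}"
    have c: "0 < nrm c"
      using that by (rule nrm_pos)
    have \<eta>: "0 < \<eta>"
      using x nrm_nonneg[of "c * x - a"] by simp
    have "nrm (c * y - a) < \<eta>" if "dist y x < \<eta> / nrm c" for y
    proof -
      have "nrm (c * (y - x)) < \<eta>"
        using that c unfolding dist_nrm nrm_mult by (simp only: pos_less_divide_eq mult.commute)
      then have "nrm (c * (y - x) + (c * x - a)) < \<eta>"
        using nrm_add[of "c * (y - x)" "c * x - a"] x by simp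
      then show ?thesis
        by (simp add: algebra_simps)
    qed
    then show "\<exists>e>0. \<forall>y. dist y x < e \<longrightarrow> y \<in> {x. nrm (c * x - a) < \<eta>}"
      using c \<eta> by (intro exI[of _ "\<eta> / nrm c"]) simp
  qed
  have mem_B: "v \<in> B c \<longleftrightarrow> (\<lambda>i\<in>{..n}. c * v i) \<in> coeff_box n v0 \<eta>"
    if "v \<in> nonzero_vectors n" "c \<noteq> 0" for v c
    using that by (auto simp: B_def coeff_box_def nonzero_vectors_def PiE_iff)
  have iff: "proj_point n v \<in> proj_point n ` coeff_box n v0 \<eta> \<longleftrightarrow> (\<exists>c. c \<noteq> 0 \<and> v \<in> B c)"
    if v: "v \<in> nonzero_vectors n" for v
  proof
    assume "proj_point n v \<in> proj_point n ` coeff_box n v0 \<eta>"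
    then obtain w where w: "w \<in> coeff_box n v0 \<eta>" "proj_point n v = proj_point n w"
      by blast
    then have "w \<in> proj_point n v"
      using mem_proj_point_self[of w n] by (simp add: coeff_box_def)
    then obtain c where c: "c \<noteq> 0" "w = (\<lambda>i\<in>{..n}. c * v i)"
      unfolding proj_point_def by blast
    then show "\<exists>c. c \<noteq> 0 \<and> v \<in> B c"
      using w(1) mem_B[OF v c(1)] by blast
  next
    assume "\<exists>c. c \<noteq> 0 \<and> v \<in> B c"
    then show "proj_point n v \<in> proj_point n ` coeff_box n v0 \<eta>"
      using mem_B[OF v] proj_point_scale by (metis image_eqI)
  qed
  have "{v \<in> nonzero_vectors n. proj_point n v \<in> proj_point n ` coeff_box n v0 \<eta>}
      = (\<Union>c\<in>-{0}. B c) \<inter> nonzero_vectors n" (is "?A = ?B")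
  proof (rule set_eqI)
    show "v \<in> ?A \<longleftrightarrow> v \<in> ?B" for v
      using iff[of v] by (cases "v \<in> nonzero_vectors n") (simp_all add: Bex_def)
  qed
  moreover have "openin (product_topology (\<lambda>_. euclidean) {..n}) (\<Union>c\<in>-{0}. B c)"
    using op by (auto simp: B_def openin_PiE_gen intro!: openin_Union)
  ultimately show "openin (nonzero_vector_topology n)
      {v \<in> nonzero_vectors n. proj_point n v \<in> proj_point n ` coeff_box n v0 \<eta>}"
    unfolding nonzero_vector_topology_def openin_subtopology by blast
qed

lemma exists_coeff_neighbourhood:
  fixes f :: "'k::{nonarch_normed_field,field_char_0} proj_line \<Rightarrow> 'k proj_line"
  assumes rep: "represents d f p q" and \<eta>: "0 < \<eta>"
  shows "\<exists>U. openin (rational_maps_topology d) U \<and> f \<in> U \<and> (\<forall>g\<in>U. \<exists>p' q'. represents d g p' q' \<and>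
    (\<forall>i. nrm (coeff p' i - coeff p i) \<le> \<eta>) \<and> (\<forall>i. nrm (coeff q' i - coeff q i) \<le> \<eta>))"
proof -
  define n where "n = 2 * d + 1"
  define v0 where "v0 = coeff_vector d p q"
  define U where "U = coeff_point d -` (proj_point n ` coeff_box n v0 \<eta>) \<inter> rational_maps d"
  have "openin (rational_maps_topology d) U"
    unfolding rational_maps_topology_def openin_pullback_topology U_def n_def
    using openin_proj_coeff_box by blast
  moreover have "f \<in> U"
  proof -
    have "v0 \<in> coeff_box n v0 \<eta>"
      using coeff_vector_nonzero[OF rep] \<eta> by (simp add: coeff_box_def v0_def n_def)
    then show ?thesis
      using rep coeff_point_eq[OF rep] by (auto simp: U_def rational_maps_def v0_def n_def)
  qed
  moreover have "\<exists>p' q'. represents d g p' q' \<and>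
    (\<forall>i. nrm (coeff p' i - coeff p i) \<le> \<eta>) \<and> (\<forall>i. nrm (coeff q' i - coeff q i) \<le> \<eta>)"
    if g: "g \<in> U" for g
  proof -
    obtain v where v: "v \<in> coeff_box n v0 \<eta>" "coeff_point d g = proj_point n v"
      using g by (auto simp: U_def)
    \<comment> \<open>Every vector in the class of \<open>g\<close> is the coefficient vector of a
      pair representing \<open>g\<close>; this fixes the common scaling so that the pair is close to
      \<open>p\<close>, \<open>q\<close>.\<close>
    then have "v \<in> coeff_point d g"
      by (simp add: mem_proj_point_self coeff_box_def)
    then obtain p' q' where pq: "represents d g p' q'" "v = coeff_vector d p' q'"
      unfolding coeff_point_def by blast
    have close: "nrm (v i - v0 i) < \<eta>" if "i \<le> n" for i
      using v(1) that by (simp add: coeff_box_def)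
    note deg = represents_degree_coeff(2,3)[OF rep] represents_degree_coeff(2,3)[OF pq(1)]
    have "nrm (coeff p' i - coeff p i) \<le> \<eta>" for i
    proof (cases "i \<le> d")
      case True
      then show ?thesis
        using close[of i] by (simp add: pq(2) v0_def coeff_vector_def n_def)
    next
      case False
      then show ?thesis
        using deg \<eta> by (simp add: coeff_eq_0)
    qed
    moreover have "nrm (coeff q' i - coeff q i) \<le> \<eta>" for i
    proof (cases "i \<le> d")
      case True
      then show ?thesis
        \<comment> \<open>The coefficients of the denominator start at index
          \<open>d + 1\<close>.\<close>
        using close[of "i + (d + 1)"] by (simp add: pq(2) v0_def coeff_vector_def n_def)
    next
      case False
      then show ?thesis
        using deg \<eta> by (simp add: coeff_eq_0)
    qed
    ultimately show ?thesis
      using pq(1) by blast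
  qed
  ultimately show ?thesis
    by blast
qed

theorem theorem1p2:
  fixes f :: "'k::{nonarch_normed_field, complete_space, alg_closed_field, field_char_0} proj_line
      \<Rightarrow> 'k proj_line"
    and d :: nat
  assumes "d > 2"
    and "f \<in> rational_maps d"
    and "immediately_expanding f"
    and "Infty \<notin> julia f"
  shows "\<exists>U. openin (rational_maps_topology d) U \<and> f \<in> U \<and>
    (\<forall>g\<in>U. \<exists>h h'. homeomorphism (julia f) (julia g) h h' \<and>
      (\<forall>z\<in>julia f. h (f z) = g (h z)))"
proof -
  obtain p q where rep: "represents d f p q"
    using assms(2) by (auto simp: rational_maps_def)
  define J where "J = {z. Fin z \<in> julia f}"
  have julia: "julia f = Fin ` J"
  proof (intro equalityI subsetI)
    fix X assume "X \<in> julia f"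
    then show "X \<in> Fin ` J"
      using assms(4) by (cases X) (auto simp: J_def)
  qed (auto simp: J_def)
  then have J: "J \<noteq> {}"
    using assms(3) by (auto simp: immediately_expanding_def)
  obtain D :: 'k where "1 < nrm D"
    using assms(3) unfolding immediately_expanding_def by (metis equals0I less_le_trans)
  then have nontrivial: "\<exists>c::'k. c \<noteq> 0 \<and> nrm c < e" if "0 < e" for e :: real
    using nontrivial_norm_if_gt_1 that by blast
  obtain R \<kappa> c M0 L where "expanding_rational_map f d p q J R \<kappa> c M0 L"
    using expanding_rational_map_julia[OF rep _ assms(3,4)] assms(1) unfolding J_def by auto
  then interpret expanding_rational_map f d p q J R \<kappa> c M0 L .
  obtain U where U: "openin (rational_maps_topology d) U" "f \<in> U"
    "\<And>g. g \<in> U \<Longrightarrow> \<exists>p' q'. represents d g p' q' \<and>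
      (\<forall>i. nrm (coeff p' i - coeff p i) \<le> \<eta>) \<and> (\<forall>i. nrm (coeff q' i - coeff q i) \<le> \<eta>)"
    using exists_coeff_neighbourhood[OF rep \<eta>(1)] by blast
  have "\<exists>h h'. homeomorphism (julia f) (julia g) h h' \<and> (\<forall>z\<in>julia f. h (f z) = g (h z))"
    if "g \<in> U" for g
    using U(3)[OF that] conjugate_perturbation[OF _ _ _ J nontrivial] unfolding julia by blast
  then show ?thesis
    using U(1,2) by blast
qed

end
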